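(* Let $G$ be a finite simple bipartite graph and let $e_1,\ldots,e_s$ ($s\ge 1$) be edges of $G$ (not necessarily distinct). Then $$\operatorname{reg}(I(G)^{s+1}:e_1\cdots e_s) \leq \operatorname{reg}(I(G))$$ if at least one of the following holds: (1) $G$ is unmixed; (2) $G$ is weakly chordal; (3) $G = W(H)$ for some bipartite graph $H$; or (4) $G$ is $P_6$-free.
   Context: Graphs are finite, simple and undirected. For a graph $G$ with vertex set $\{x_1,\ldots,x_n\}$ and a field $k$, the edge ideal is $I(G) = (x_ix_j \mid \{x_i,x_j\}\in E(G)) \subseteq k[x_1,\ldots,x_n]$. An edge $e=\{x_i,x_j\}$ is identified with the monomial $x_ix_j$. $\operatorname{reg}$ denotes Castelnuovo-Mumford regularity of a homogeneous ideal; $\operatorname{reg}(I(G)^{s+1}:e_1\cdots e_s)$ is the regularity of the colon ideal $(I(G)^{s+1}:e_1\cdots e_s)$. A graph is unmixed if all its minimal (with respect to inclusion) vertex covers have the same number of elements. A graph $G$ is weakly chordal if every induced cycle in both $G$ and its complement has length at most $4$. The whiskered graph $W(H)$ of a graph $H$ on $n$ vertices is the graph on $2n$ vertices obtained by adding to every vertex of $H$ a pendant vertex (an edge to a new vertex of degree 1). $P_6$ denotes the path on $6$ vertices; a graph is $P_6$-free if it has no induced subgraph isomorphic to $P_6$. *)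

theory Defs
  imports
    "HOL-Library.Poly_Mapping"
    "HOL-Library.Extended_Real"
    "Jordan_Normal_Form.Matrix_Kernel"
begin

section \<open>Graphs\<close>

record 'v graph =
  vertices :: "'v set"
  edges :: "'v set set"

definition simple_graph :: "'v graph \<Rightarrow> bool" where
  "simple_graph G \<longleftrightarrow> finite (vertices G) \<and> (\<forall>e\<in>edges G. e \<subseteq> vertices G \<and> card e = 2)"

definition bipartite :: "'v graph \<Rightarrow> bool" where
  "bipartite G \<longleftrightarrow> (\<exists>A B. A \<union> B = vertices G \<and> A \<inter> B = {} \<and>
     (\<forall>e\<in>edges G. \<exists>a\<in>A. \<exists>b\<in>B. e = {a, b}))"

definition vertex_cover :: "'v graph \<Rightarrow> 'v set \<Rightarrow> bool" where
  "vertex_cover G C \<longleftrightarrow> C \<subseteq> vertices G \<and> (\<forall>e\<in>edges G. e \<inter> C \<noteq> {})"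

definition minimal_vertex_cover :: "'v graph \<Rightarrow> 'v set \<Rightarrow> bool" where
  "minimal_vertex_cover G C \<longleftrightarrow> vertex_cover G C \<and> (\<forall>C'. C' \<subset> C \<longrightarrow> \<not> vertex_cover G C')"

definition unmixed :: "'v graph \<Rightarrow> bool" where
  "unmixed G \<longleftrightarrow>
     (\<forall>C C'. minimal_vertex_cover G C \<and> minimal_vertex_cover G C' \<longrightarrow> card C = card C')"

definition induced_subgraph :: "'v graph \<Rightarrow> 'v set \<Rightarrow> 'v graph" where
  "induced_subgraph G S = \<lparr>vertices = S, edges = {e \<in> edges G. e \<subseteq> S}\<rparr>"

definition graph_isomorphic :: "'v graph \<Rightarrow> 'w graph \<Rightarrow> bool" where
  "graph_isomorphic G H \<longleftrightarrow>
     (\<exists>f. bij_betw f (vertices G) (vertices H) \<and> edges H = (\<lambda>e. f ` e) ` edges G)"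

definition has_induced :: "'v graph \<Rightarrow> 'w graph \<Rightarrow> bool" where
  "has_induced G F \<longleftrightarrow>
     (\<exists>S\<subseteq>vertices G. graph_isomorphic (induced_subgraph G S) F)"

definition complement_graph :: "'v graph \<Rightarrow> 'v graph" where
  "complement_graph G =
     \<lparr>vertices = vertices G, edges = {e. e \<subseteq> vertices G \<and> card e = 2 \<and> e \<notin> edges G}\<rparr>"

definition path_graph :: "nat \<Rightarrow> nat graph" where
  "path_graph n = \<lparr>vertices = {..<n}, edges = {{i, i + 1} | i. i + 1 < n}\<rparr>"

text \<open>A cycle only for \<open>n \<ge> 3\<close>.\<close>

definition cycle_graph :: "nat \<Rightarrow> nat graph" where
  "cycle_graph n = \<lparr>vertices = {..<n}, edges = {{i, (i + 1) mod n} | i. i < n}\<rparr>"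

definition weakly_chordal :: "'v graph \<Rightarrow> bool" where
  "weakly_chordal G \<longleftrightarrow>
     (\<forall>n\<ge>3. has_induced G (cycle_graph n) \<or> has_induced (complement_graph G) (cycle_graph n)
        \<longrightarrow> n \<le> 4)"

definition P6_free :: "'v graph \<Rightarrow> bool" where
  "P6_free G \<longleftrightarrow> \<not> has_induced G (path_graph 6)"

text \<open>The pendant vertex attached to \<open>Inl v\<close> is \<open>Inr v\<close>.\<close>

definition whiskered_graph :: "'v graph \<Rightarrow> ('v + 'v) graph" where
  "whiskered_graph H =
     \<lparr>vertices = vertices H <+> vertices H,
      edges = (\<lambda>e. Inl ` e) ` edges H \<union> {{Inl v, Inr v} | v. v \<in> vertices H}\<rparr>"


section \<open>Ideals of a polynomial ring\<close>

text \<open>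
  The ring \<open>k[x\<^sub>v | v :: 'v]\<close>, for a finite type \<open>'v\<close>: the outer mapping sends exponent
  vectors to coefficients.
\<close>

type_synonym ('v, 'k) mpoly = "('v \<Rightarrow>\<^sub>0 nat) \<Rightarrow>\<^sub>0 'k"

definition Var :: "'v \<Rightarrow> ('v, 'k::comm_ring_1) mpoly" where
  "Var v = Poly_Mapping.single (Poly_Mapping.single v 1) 1"

definition monomial_deg :: "('v::finite \<Rightarrow>\<^sub>0 nat) \<Rightarrow> nat" where
  "monomial_deg m = (\<Sum>v\<in>UNIV. Poly_Mapping.lookup m v)"

definition ideal_generated :: "'a::comm_ring_1 set \<Rightarrow> 'a set" where
  "ideal_generated S = Modules.module.span (*) S"

fun ideal_power :: "'a::comm_ring_1 set \<Rightarrow> nat \<Rightarrow> 'a set" where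
  "ideal_power I 0 = UNIV"
| "ideal_power I (Suc n) = ideal_generated {a * b | a b. a \<in> I \<and> b \<in> ideal_power I n}"

definition colon_ideal :: "'a::comm_ring_1 set \<Rightarrow> 'a \<Rightarrow> 'a set" where
  "colon_ideal I f = {p. p * f \<in> I}"

definition edge_monomial :: "'v set \<Rightarrow> ('v, 'k::comm_ring_1) mpoly" where
  "edge_monomial e = (\<Prod>v\<in>e. Var v)"

definition edge_ideal :: "'v graph \<Rightarrow> ('v, 'k::comm_ring_1) mpoly set" where
  "edge_ideal G = ideal_generated (edge_monomial ` edges G)"


section \<open>Castelnuovo-Mumford regularity\<close>

text \<open>
  A list \<open>ds\<close> of degrees stands for the graded free module \<open>R(-d\<^sub>0) \<oplus> \<dots> \<oplus> R(-d\<^sub>r)\<close>, whose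
  basis elements have the degrees listed; the empty list is the zero module. A matrix is a
  homogeneous map of degree 0 from the module of \<open>src\<close> to that of \<open>tgt\<close> iff its \<open>(i, j)\<close> entry
  is homogeneous of degree \<open>src ! j - tgt ! i\<close> (in particular zero if that is negative).
\<close>

definition graded_map ::
  "nat list \<Rightarrow> nat list \<Rightarrow> ('v::finite, 'k::field) mpoly mat \<Rightarrow> bool" where
  "graded_map src tgt A \<longleftrightarrow>
     A \<in> carrier_mat (length tgt) (length src) \<and>
     (\<forall>i<length tgt. \<forall>j<length src. \<forall>m\<in>Poly_Mapping.keys (A $$ (i, j)).
        tgt ! i + monomial_deg m = src ! j)"

definition mat_image :: "'a::comm_ring_1 mat \<Rightarrow> 'a vec set" where
  "mat_image A = {A *\<^sub>v w | w. w \<in> carrier_vec (dim_col A)}"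

text \<open>
  A resolution \<open>\<dots> \<rightarrow> F\<^sub>1 \<rightarrow> F\<^sub>0 \<rightarrow> I \<rightarrow> 0\<close> with \<open>F\<^sub>i\<close> given by the degree list \<open>F i\<close>. The matrix
  \<open>D 0\<close> has a single row and is the augmentation \<open>F\<^sub>0 \<rightarrow> I \<subseteq> R\<close>; \<open>D (i + 1)\<close> is the
  differential \<open>F\<^sub>i\<^sub>+\<^sub>1 \<rightarrow> F\<^sub>i\<close>. Natural-number degrees suffice, as an ideal of \<open>R\<close> has no
  nonzero elements of negative degree.
\<close>

definition graded_free_resolution ::
  "('v::finite, 'k::field) mpoly set \<Rightarrow> (nat \<Rightarrow> nat list) \<Rightarrow> (nat \<Rightarrow> ('v, 'k) mpoly mat) \<Rightarrow> bool"
where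
  "graded_free_resolution I F D \<longleftrightarrow>
     graded_map (F 0) [0] (D 0) \<and>
     (\<forall>i. graded_map (F (Suc i)) (F i) (D (Suc i))) \<and>
     (\<lambda>w. w $ 0) ` mat_image (D 0) = I \<and>
     (\<forall>i. mat_image (D (Suc i)) = mat_kernel (D i))"

text \<open>
  Minimality is \<open>D (i + 1) F\<^sub>i\<^sub>+\<^sub>1 \<subseteq> \<mm> F\<^sub>i\<close>: no entry of a differential has a constant term.
  The augmentation is exempt.
\<close>

definition minimal_graded_free_resolution ::
  "('v::finite, 'k::field) mpoly set \<Rightarrow> (nat \<Rightarrow> nat list) \<Rightarrow> (nat \<Rightarrow> ('v, 'k) mpoly mat) \<Rightarrow> bool"
where
  "minimal_graded_free_resolution I F D \<longleftrightarrow>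
     graded_free_resolution I F D \<and>
     (\<forall>i. \<forall>r<length (F i). \<forall>c<length (F (Suc i)).
        Poly_Mapping.lookup (D (Suc i) $$ (r, c)) 0 = 0)"

text \<open>
  For homogeneous \<open>I\<close>, \<open>reg I = max {j - i | \<beta>\<^sub>i\<^sub>,\<^sub>j(I) \<noteq> 0}\<close>, where \<open>\<beta>\<^sub>i\<^sub>,\<^sub>j(I)\<close> is the
  multiplicity of \<open>R(-j)\<close> in the \<open>i\<close>-th module of a minimal graded free resolution. Such a
  resolution exists and is unique up to isomorphism, so it does not matter that it is
  quantified inside the set. The supremum is taken in the extended reals, which gives
  \<open>reg 0 = -\<infinity>\<close>.
\<close>

definition reg :: "('v::finite, 'k::field) mpoly set \<Rightarrow> ereal" where
  "reg I = Sup {ereal (real j - real i) | i j.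
     \<exists>F D. minimal_graded_free_resolution I F D \<and> j \<in> set (F i)}"

end

theory Submission
  imports Defs "HOL-Library.Function_Algebras"
begin

text \<open>
  A bipartite graph is handled as a set \<open>E \<subseteq> A \<times> B\<close> of oriented edges, and \<open>I\<close> is its edge ideal.

  The colon ideal. For an edge \<open>(x, y)\<close>, join every neighbour of \<open>x\<close> to every neighbour of \<open>y\<close>. The
  colon ideal of \<open>I\<^bsup>s+1\<^esup>\<close> by \<open>e\<^sub>1 \<cdots> e\<^sub>s\<close> is the edge ideal of the bipartite graph that
  results from performing this for \<open>e\<^sub>1, \<dots>, e\<^sub>s\<close> in turn (\<open>colon_edge_power\<close>). The reason is a
  form of Koenig's theorem (\<open>koenig_edge_multiples\<close>): \<open>m e\<^sub>1 \<cdots> e\<^sub>s\<close> lies in \<open>I\<^bsup>s+1\<^esup>\<close> iff the support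
  of \<open>m\<close> meets every vertex cover that contains exactly one end of each \<open>e\<^sub>i\<close>; and joining the
  neighbours along \<open>e\<^sub>1\<close> trades the condition on \<open>e\<^sub>1\<close> for the new edges
  (\<open>sparse_covers_join_neighbours\<close>). So it is enough to see that the regularity does not grow
  when neighbours are joined.

  The regularity. The degrees in a minimal graded free resolution of an ideal are the degrees of its
  Koszul homology (\<open>minimal_resolution_degree_iff\<close>), which for an edge ideal lives in squarefree
  multidegrees \<open>W\<close> and is there the homology of the complex of all \<open>\<tau> \<subseteq> W\<close> such that \<open>W - \<tau>\<close> spans an
  edge (\<open>koszul_class_squarefree_ideal_iff\<close>, Hochster's formula). That a minimal resolution exists
  comes from the same source: Koszul homology bounds the degrees of the generators of all syzygy
  modules, so these modules are finitely generated (\<open>minimal_resolution_exists\<close>). Altogether,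
  \<open>reg I\<close> is the largest \<open>card W - i\<close> for which there is a class of degree \<open>i\<close> on \<open>W\<close>.

  The comparison. A class on \<open>W\<close> for the joined graph yields a class for the original graph with the
  same value of \<open>card W - i\<close> (\<open>essential_cycle_join_neighbours\<close>). If \<open>y \<in> W\<close>, then in the joined graph
  all other neighbours of \<open>x\<close> are adjacent to everything that \<open>y\<close> is adjacent to, so they can be
  deleted from \<open>W\<close> without losing the class, and with them all new edges disappear. If
  \<open>y \<notin> W\<close>, an exact sequence leads either to \<open>insert y W\<close> and the first case, or to \<open>W\<close>
  without the neighbours of \<open>y\<close>, which again contains no new edge.
\<close>

section \<open>Chain complexes of set families\<close>

text \<open>
  The vertex type carries no order, so the signs of the chain complexes below refer to an arbitrary
  enumeration of the vertices.
\<close>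

definition vertex_index :: "'v::finite \<Rightarrow> nat" where
  "vertex_index = (SOME f. inj f)"

lemma inj_vertex_index: "inj (vertex_index :: 'v::finite \<Rightarrow> nat)"
proof -
  have "\<exists>f :: 'v \<Rightarrow> nat. inj f"
    using finite_imp_inj_to_nat_seg[OF finite_UNIV] by blast
  then show ?thesis
    unfolding vertex_index_def by (rule someI_ex)
qed

text \<open>
  The sign of \<open>v \<and> \<tau>\<close> relative to the increasing ordering of \<open>insert v \<tau>\<close>.
\<close>

definition koszul_sign :: "'v::finite \<Rightarrow> 'v set \<Rightarrow> 'a::comm_ring_1" where
  "koszul_sign v \<tau> = (-1) ^ card {u \<in> \<tau>. vertex_index u < vertex_index v}"

lemma koszul_sign_square [simp]:
  "koszul_sign v \<tau> * koszul_sign v \<tau> = (1 :: 'a::comm_ring_1)"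
  by (simp add: koszul_sign_def flip: power_add mult_2)

lemma koszul_sign_square_left [simp]:
  "koszul_sign v \<tau> * (koszul_sign v \<tau> * x) = (x :: 'a::comm_ring_1)"
  by (simp flip: mult.assoc)

lemma koszul_sign_insert:
  assumes "v \<notin> \<tau>"
  shows "koszul_sign u (insert v \<tau>) =
    (if vertex_index v < vertex_index u then - koszul_sign u \<tau> else
        (koszul_sign u \<tau> :: 'a::comm_ring_1))"
proof (cases "vertex_index v < vertex_index u")
  case True
  then have "{w \<in> insert v \<tau>. vertex_index w < vertex_index u} =
      insert v {w \<in> \<tau>. vertex_index w < vertex_index u}"
    by auto
  with True assms show ?thesis by (simp add: koszul_sign_def)
next
  case False
  then have "{w \<in> insert v \<tau>. vertex_index w < vertex_index u} =
      {w \<in> \<tau>. vertex_index w < vertex_index u}"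
    by auto
  with False show ?thesis by (simp add: koszul_sign_def)
qed

lemma koszul_sign_swap:
  assumes "u \<noteq> v" "u \<notin> \<tau>" "v \<notin> \<tau>"
  shows "koszul_sign v \<tau> * koszul_sign u (insert v \<tau>) =
    - (koszul_sign u \<tau> * (koszul_sign v (insert u \<tau>) :: 'a::comm_ring_1))"
proof -
  have "vertex_index u \<noteq> vertex_index v"
    using assms(1) inj_vertex_index by (metis injD)
  then show ?thesis
    using assms by (simp add: koszul_sign_insert)
qed

lemma koszul_sign_swap':
  assumes "u \<noteq> v" "u \<notin> \<tau>" "v \<notin> \<tau>"
  shows "koszul_sign u (insert v \<tau>) * koszul_sign v (insert u \<tau>) =
    - (koszul_sign u \<tau> * (koszul_sign v \<tau> :: 'a::comm_ring_1))"
proof -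
  have "vertex_index u \<noteq> vertex_index v"
    using assms(1) inj_vertex_index by (metis injD)
  then show ?thesis
    using assms by (auto simp: koszul_sign_insert)
qed

text \<open>
  The value of a chain at \<open>\<tau>\<close> is the coefficient of the face \<open>\<tau>\<close>, so the
  boundary at \<open>\<tau>\<close> collects the faces that contain \<open>\<tau>\<close> and one more vertex. The empty face
  is present: this is the augmented complex, in which a face with \<open>i\<close> elements has degree \<open>i\<close>.
\<close>

definition boundary :: "('v::finite set \<Rightarrow> 'k::comm_ring_1) \<Rightarrow> 'v set \<Rightarrow> 'k" where
  "boundary c = (\<lambda>\<tau>. \<Sum>v\<in>-\<tau>. koszul_sign v \<tau> * c (insert v \<tau>))"

lemma boundary_0 [simp]: "boundary 0 = 0"
  by (simp add: boundary_def fun_eq_iff)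

lemma boundary_add: "boundary (c + d) = boundary c + boundary d"
  by (simp add: boundary_def fun_eq_iff distrib_left sum.distrib)

lemma boundary_diff: "boundary (c - d) = boundary c - boundary d"
  by (simp add: boundary_def fun_eq_iff right_diff_distrib sum_subtractf)

lemma boundary_uminus: "boundary (- c) = - boundary c"
  by (simp add: boundary_def fun_eq_iff sum_negf)

text \<open>
  Antisymmetry alone gives only that twice the sum is zero, which says nothing in characteristic 2.
  The terms therefore have to be paired, and the enumeration of the vertices chooses one pair
  \<open>(u, v)\<close> out of \<open>(u, v)\<close> and \<open>(v, u)\<close>.
\<close>

lemma sum_off_diagonal_antisymmetric:
  fixes f :: "'v::finite \<Rightarrow> 'v \<Rightarrow> 'k::ab_group_add"
  assumes "\<And>u v. u \<in> S \<Longrightarrow> v \<in> S \<Longrightarrow> u \<noteq> v \<Longrightarrow> f u v = - f v u"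
  shows "(\<Sum>v\<in>S. \<Sum>u\<in>S - {v}. f v u) = 0"
proof -
  let ?i = "vertex_index :: 'v \<Rightarrow> nat"
  let ?P = "{p \<in> S \<times> S. ?i (fst p) < ?i (snd p)}" and ?Q = "{p \<in> S \<times> S. ?i (snd p) < ?i (fst p)}"
  have "(\<Sum>v\<in>S. \<Sum>u\<in>S - {v}. f v u) = (\<Sum>p\<in>(SIGMA v:S. S - {v}). f (fst p) (snd p))"
    by (subst sum.Sigma) (auto simp: case_prod_beta)
  also have "(SIGMA v:S. S - {v}) = ?P \<union> ?Q"
  proof (rule Set.set_eqI)
    fix p :: "'v \<times> 'v"
    obtain v u where p: "p = (v, u)" by (cases p)
    have "p \<in> (SIGMA v:S. S - {v}) \<longleftrightarrow> v \<in> S \<and> u \<in> S \<and> v \<noteq> u"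
      by (auto simp: p)
    moreover have "p \<in> ?P \<union> ?Q \<longleftrightarrow> v \<in> S \<and> u \<in> S \<and> (?i v < ?i u \<or> ?i u < ?i v)"
      by (auto simp: p)
    moreover have "v \<noteq> u \<longleftrightarrow> ?i v < ?i u \<or> ?i u < ?i v"
      by (simp flip: linorder_neq_iff add: inj_eq[OF inj_vertex_index])
    ultimately show "p \<in> (SIGMA v:S. S - {v}) \<longleftrightarrow> p \<in> ?P \<union> ?Q"
      by blast
  qed
  also have "(\<Sum>p\<in>?P \<union> ?Q. f (fst p) (snd p)) =
      (\<Sum>p\<in>?P. f (fst p) (snd p)) + (\<Sum>p\<in>?Q. f (fst p) (snd p))"
    by (rule sum.union_disjoint) auto
  also have "(\<Sum>p\<in>?Q. f (fst p) (snd p)) = (\<Sum>p\<in>?P. f (snd p) (fst p))"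
    by (rule sum.reindex_bij_witness[where i = prod.swap and j = prod.swap]) auto
  also have "\<dots> = (\<Sum>p\<in>?P. - f (fst p) (snd p))"
    by (rule sum.cong[OF refl]) (use assms in \<open>force\<close>)
  finally show ?thesis by (simp add: sum_negf)
qed

lemma boundary_boundary: "boundary (boundary c) = (0 :: 'v::finite set \<Rightarrow> 'k::comm_ring_1)"
proof
  fix \<tau> :: "'v set"
  define f where "f = (\<lambda>v u.
      koszul_sign v \<tau> * koszul_sign u (insert v \<tau>) * c (insert u (insert v \<tau>)))"
  have "boundary (boundary c) \<tau> = (\<Sum>v\<in>-\<tau>. \<Sum>u\<in>- insert v \<tau>. f v u)"
    by (simp add: boundary_def f_def sum_distrib_left mult.assoc)
  also have "\<dots> = (\<Sum>v\<in>-\<tau>. \<Sum>u\<in>- \<tau> - {v}. f v u)"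
    by (intro sum.cong) auto
  also have "\<dots> = 0"
  proof (rule sum_off_diagonal_antisymmetric)
    fix u v assume "u \<in> - \<tau>" "v \<in> - \<tau>" "u \<noteq> v"
    then have "koszul_sign u \<tau> * koszul_sign v (insert u \<tau>) =
        - (koszul_sign v \<tau> * (koszul_sign u (insert v \<tau>) :: 'k))"
      by (intro koszul_sign_swap) auto
    then show "f u v = - f v u"
      by (simp add: f_def insert_commute)
  qed
  finally show "boundary (boundary c) \<tau> = 0 \<tau>" by simp
qed

text \<open>
  Up to sign, \<open>cone_over v\<close> multiplies by \<open>v\<close> and \<open>link_part v\<close> is the coefficient of \<open>v\<close>;
  \<open>cone_over v\<close> is the contracting homotopy of a cone with apex \<open>v\<close>.
\<close>

definition cone_over :: "'v::finite \<Rightarrow> ('v set \<Rightarrow> 'k::comm_ring_1) \<Rightarrow> 'v set \<Rightarrow> 'k" where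
  "cone_over v c = (\<lambda>\<tau>. if v \<in> \<tau> then koszul_sign v (\<tau> - {v}) * c (\<tau> - {v}) else 0)"

definition link_part :: "'v::finite \<Rightarrow> ('v set \<Rightarrow> 'k::comm_ring_1) \<Rightarrow> 'v set \<Rightarrow> 'k" where
  "link_part v c = (\<lambda>\<tau>. if v \<notin> \<tau> then koszul_sign v \<tau> * c (insert v \<tau>) else 0)"

lemma cone_over_0 [simp]: "cone_over v 0 = 0"
  by (simp add: cone_over_def fun_eq_iff)

lemma link_part_0 [simp]: "link_part v 0 = 0"
  by (simp add: link_part_def fun_eq_iff)

lemma boundary_cone_over:
  fixes c :: "'v::finite set \<Rightarrow> 'k::comm_ring_1"
  shows "boundary (cone_over v c) = c - cone_over v (boundary c)"
proof
  fix \<tau> :: "'v set"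
  show "boundary (cone_over v c) \<tau> = (c - cone_over v (boundary c)) \<tau>"
  proof (cases "v \<in> \<tau>")
    case False
    have "boundary (cone_over v c) \<tau> = (\<Sum>u\<in>{v}. koszul_sign u \<tau> * cone_over v c (insert u \<tau>))"
      unfolding boundary_def using False
      by (intro sum.mono_neutral_right) (auto simp: cone_over_def)
    then show ?thesis using False by (simp add: cone_over_def)
  next
    case True
    define \<rho> where "\<rho> = \<tau> - {v}"
    have \<tau>: "\<tau> = insert v \<rho>" and "v \<notin> \<rho>" using True by (auto simp: \<rho>_def)
    have compl: "- \<rho> = insert v (- \<tau>)" by (auto simp: \<tau> \<open>v \<notin> \<rho>\<close>)
    have "boundary (cone_over v c) \<tau> =
        (\<Sum>u\<in>-\<tau>. koszul_sign u (insert v \<rho>) * (koszul_sign v (insert u \<rho>) * c (insert u \<rho>)))"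
      unfolding boundary_def
    proof (intro sum.cong refl)
      fix u assume "u \<in> - \<tau>"
      then have "insert u \<tau> - {v} = insert u \<rho>" by (auto simp: \<tau> \<open>v \<notin> \<rho>\<close>)
      then show "koszul_sign u \<tau> * cone_over v c (insert u \<tau>) =
          koszul_sign u (insert v \<rho>) * (koszul_sign v (insert u \<rho>) * c (insert u \<rho>))"
        using True by (simp add: cone_over_def flip: \<tau>)
    qed
    also have "\<dots> = (\<Sum>u\<in>-\<tau>. - (koszul_sign v \<rho> * (koszul_sign u \<rho> * c (insert u \<rho>))))"
    proof (intro sum.cong refl)
      fix u assume "u \<in> - \<tau>"
      then have "u \<noteq> v" "u \<notin> \<rho>" by (auto simp: \<tau>)
      then have "koszul_sign u (insert v \<rho>) * koszul_sign v (insert u \<rho>) =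
          - (koszul_sign u \<rho> * (koszul_sign v \<rho> :: 'k))"
        by (rule koszul_sign_swap') (rule \<open>v \<notin> \<rho>\<close>)
      then show "koszul_sign u (insert v \<rho>) * (koszul_sign v (insert u \<rho>) * c (insert u \<rho>)) =
          - (koszul_sign v \<rho> * (koszul_sign u \<rho> * c (insert u \<rho>)))"
        by (metis (no_types, lifting) mult.assoc mult.commute mult_minus_left)
    qed
    also have "\<dots> = c \<tau> - cone_over v (boundary c) \<tau>"
    proof -
      have "boundary c \<rho> = koszul_sign v \<rho> * c \<tau> + (\<Sum>u\<in>-\<tau>. koszul_sign u \<rho> * c (insert u \<rho>))"
        unfolding boundary_def compl by (subst sum.insert) (auto simp: \<tau>)
      then show ?thesis
        using True by (simp add: cone_over_def distrib_left sum_negf flip: \<rho>_def sum_distrib_left)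
    qed
    finally show ?thesis by simp
  qed
qed

lemma boundary_link_part:
  fixes c :: "'v::finite set \<Rightarrow> 'k::comm_ring_1"
  shows "boundary (link_part v c) = - link_part v (boundary c)"
proof
  fix \<tau> :: "'v set"
  show "boundary (link_part v c) \<tau> = (- link_part v (boundary c)) \<tau>"
  proof (cases "v \<in> \<tau>")
    case True
    then show ?thesis by (simp add: boundary_def link_part_def)
  next
    case False
    have "boundary (link_part v c) \<tau> =
        (\<Sum>u\<in>- insert v \<tau>. koszul_sign u \<tau> * link_part v c (insert u \<tau>))"
      unfolding boundary_def by (intro sum.mono_neutral_right) (auto simp: link_part_def)
    also have "\<dots> = (\<Sum>u\<in>- insert v \<tau>.
        - (koszul_sign v \<tau> * (koszul_sign u (insert v \<tau>) * c (insert u (insert v \<tau>)))))"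
    proof (intro sum.cong refl)
      fix u assume "u \<in> - insert v \<tau>"
      then have u: "u \<noteq> v" "u \<notin> \<tau>" by auto
      have "koszul_sign u \<tau> * koszul_sign v (insert u \<tau>) =
          - (koszul_sign v \<tau> * (koszul_sign u (insert v \<tau>) :: 'k))"
        using u False by (subst koszul_sign_swap) auto
      then show "koszul_sign u \<tau> * link_part v c (insert u \<tau>) =
          - (koszul_sign v \<tau> * (koszul_sign u (insert v \<tau>) * c (insert u (insert v \<tau>))))"
        using u False by (simp add: link_part_def insert_commute flip: mult.assoc)
    qed
    also have "\<dots> = (- link_part v (boundary c)) \<tau>"
      using False by (simp add: link_part_def boundary_def sum_negf sum_distrib_left)
    finally show ?thesis .
  qed
qed

lemma link_part_cone_over:
  assumes "\<And>\<tau>. v \<in> \<tau> \<Longrightarrow> c \<tau> = 0"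
  shows "link_part v (cone_over v c) = c"
  using assms by (auto simp: link_part_def cone_over_def fun_eq_iff)

lemma link_part_eq_0:
  assumes "\<And>\<tau>. v \<in> \<tau> \<Longrightarrow> c \<tau> = 0"
  shows "link_part v c = 0"
  using assms by (auto simp: link_part_def fun_eq_iff)

lemma cone_over_link_part: "cone_over v (link_part v c) = (\<lambda>\<tau>. if v \<in> \<tau> then c \<tau> else 0)"
  by (auto simp: link_part_def cone_over_def fun_eq_iff insert_absorb)

lemma link_part_diff: "link_part v (c - d) = link_part v c - link_part v d"
  by (auto simp: link_part_def fun_eq_iff right_diff_distrib)

definition chain_on :: "'v set set \<Rightarrow> nat \<Rightarrow> ('v set \<Rightarrow> 'k::comm_ring_1) \<Rightarrow> bool" where
  "chain_on K i c \<longleftrightarrow> (\<forall>\<tau>. c \<tau> \<noteq> 0 \<longrightarrow> \<tau> \<in> K \<and> card \<tau> = i)"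

lemma chain_on_add: "chain_on K i c \<Longrightarrow> chain_on K i d \<Longrightarrow> chain_on K i (c + d)"
  unfolding chain_on_def by (metis plus_fun_apply add.right_neutral)

lemma chain_on_uminus: "chain_on K i c \<Longrightarrow> chain_on K i (- c)"
  unfolding chain_on_def by simp

lemma chain_on_diff: "chain_on K i c \<Longrightarrow> chain_on K i d \<Longrightarrow> chain_on K i (c - d)"
  using chain_on_add[of K i c "- d"] chain_on_uminus[of K i d] by simp

lemma chain_on_cone_over:
  fixes c :: "'v::finite set \<Rightarrow> 'k::comm_ring_1"
  assumes "chain_on K i c" "\<And>\<tau>. \<tau> \<in> K \<Longrightarrow> v \<notin> \<tau> \<Longrightarrow> insert v \<tau> \<in> L"
  shows "chain_on L (Suc i) (cone_over v c)"
  unfolding chain_on_def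
proof (intro allI impI)
  fix \<tau> assume "cone_over v c \<tau> \<noteq> 0"
  then have v: "v \<in> \<tau>" and "c (\<tau> - {v}) \<noteq> 0"
    by (auto simp: cone_over_def split: if_splits)
  then have "\<tau> - {v} \<in> K" "card (\<tau> - {v}) = i"
    using assms(1) by (auto simp: chain_on_def)
  then have "insert v (\<tau> - {v}) \<in> L" "card (insert v (\<tau> - {v})) = Suc i"
    using assms(2)[of "\<tau> - {v}"] by (simp_all del: insert_Diff_single)
  then show "\<tau> \<in> L \<and> card \<tau> = Suc i"
    by (simp only: insert_Diff[OF v])
qed

lemma chain_on_link_part:
  fixes c :: "'v::finite set \<Rightarrow> 'k::comm_ring_1"
  assumes "chain_on K (Suc i) c"
  shows "chain_on {\<tau>. v \<notin> \<tau> \<and> insert v \<tau> \<in> K} i (link_part v c)"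
  unfolding chain_on_def
proof (intro allI impI)
  fix \<tau> assume "link_part v c \<tau> \<noteq> 0"
  then have "v \<notin> \<tau>" "c (insert v \<tau>) \<noteq> 0"
    by (auto simp: link_part_def split: if_splits)
  then show "\<tau> \<in> {\<tau>. v \<notin> \<tau> \<and> insert v \<tau> \<in> K} \<and> card \<tau> = i"
    using assms by (auto simp: chain_on_def)
qed

text \<open>
  A cycle that represents a nonzero homology class of the family \<open>K\<close>. If \<open>K\<close> is a simplicial
  complex, this is a class of \<open>K\<close> in reduced homology of dimension \<open>i - 1\<close>.
\<close>

definition essential_cycle :: "'v::finite set set \<Rightarrow> nat \<Rightarrow> ('v set \<Rightarrow> 'k::comm_ring_1) \<Rightarrow> bool" where
  "essential_cycle K i c \<longleftrightarrow>
     chain_on K i c \<and> boundary c = 0 \<and> \<not> (\<exists>d. chain_on K (Suc i) d \<and> boundary d = c)"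

lemma cone_acyclic:
  assumes "\<And>\<tau>. \<tau> \<in> K \<Longrightarrow> v \<notin> \<tau> \<Longrightarrow> insert v \<tau> \<in> K"
  shows "\<not> essential_cycle K i c"
proof
  assume c: "essential_cycle K i c"
  then have "boundary (cone_over v c) = c"
    by (simp add: essential_cycle_def boundary_cone_over)
  moreover have "chain_on K (Suc i) (cone_over v c)"
    using c assms by (intro chain_on_cone_over[of K]) (auto simp: essential_cycle_def)
  ultimately show False using c by (auto simp: essential_cycle_def)
qed

text \<open>
  The chains of the link of \<open>v\<close> are those of \<open>K\<close> modulo the deletion of \<open>v\<close>, shifted by one. When the deletion
  has no homology in degree \<open>i\<close>, the long exact sequence embeds the homology of \<open>K\<close> into that of the
  link.
\<close>

lemma essential_cycle_link:
  fixes c :: "'v::finite set \<Rightarrow> 'k::comm_ring_1"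
  assumes c: "essential_cycle K i c"
    and down: "\<And>\<tau>. insert v \<tau> \<in> K \<Longrightarrow> \<tau> \<in> K"
    and acyclic: "\<And>d :: 'v set \<Rightarrow> 'k. \<not> essential_cycle {\<tau> \<in> K. v \<notin> \<tau>} i d"
  shows "\<exists>i'. i = Suc i' \<and>
    essential_cycle {\<tau>. v \<notin> \<tau> \<and> insert v \<tau> \<in> K} i' (link_part v c)"
proof -
  let ?L = "{\<tau>. v \<notin> \<tau> \<and> insert v \<tau> \<in> K}" and ?D = "{\<tau> \<in> K. v \<notin> \<tau>}"
  have cK: "chain_on K i c" and bc: "boundary c = 0"
    and ess: "\<And>d. chain_on K (Suc i) d \<Longrightarrow> boundary d \<noteq> c"
    using c by (auto simp: essential_cycle_def)
  have key: False if d: "chain_on ?L i d" and bd: "boundary d = link_part v c" for d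
  proof -
    \<comment> \<open>Adding this boundary cancels the part of the cycle at v and moves it into the deletion.\<close>
    define c' where "c' = c + boundary (cone_over v d)"
    have c'_eq: "c' = (\<lambda>\<tau>. (if v \<in> \<tau> then 0 else c \<tau>) + d \<tau>)"
      by (auto simp: c'_def boundary_cone_over bd cone_over_link_part fun_eq_iff)
    have "chain_on ?D i c'"
      unfolding chain_on_def
    proof (intro allI impI)
      fix \<tau> assume "c' \<tau> \<noteq> 0"
      then have "v \<notin> \<tau> \<and> c \<tau> \<noteq> 0 \<or> d \<tau> \<noteq> 0"
        by (auto simp: c'_eq split: if_splits)
      then show "\<tau> \<in> ?D \<and> card \<tau> = i"
        using cK d down by (auto simp: chain_on_def)
    qed
    moreover have "boundary c' = 0"
      by (simp add: c'_def boundary_add boundary_boundary bc)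
    ultimately obtain e where e: "chain_on ?D (Suc i) e" "boundary e = c'"
      using acyclic unfolding essential_cycle_def by blast
    have "chain_on K (Suc i) e" using e(1) by (auto simp: chain_on_def)
    moreover have "chain_on K (Suc i) (cone_over v d)"
      by (rule chain_on_cone_over[OF d]) auto
    ultimately have "chain_on K (Suc i) (e - cone_over v d)" by (rule chain_on_diff)
    moreover have "boundary (e - cone_over v d) = c"
      by (simp add: boundary_diff e c'_def)
    ultimately show False using ess by blast
  qed
  show ?thesis
  proof (cases i)
    case 0
    have "link_part v c = 0"
    proof (rule link_part_eq_0)
      fix \<tau> :: "'v set" assume "v \<in> \<tau>"
      then have "card \<tau> \<noteq> 0" by (auto simp: card_eq_0_iff)
      then show "c \<tau> = 0" using cK 0 by (auto simp: chain_on_def)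
    qed
    then have False using key[of 0] by (simp add: chain_on_def)
    then show ?thesis ..
  next
    case (Suc i')
    have "chain_on ?L i' (link_part v c)"
      using cK Suc by (intro chain_on_link_part) simp
    moreover have "boundary (link_part v c) = 0"
      by (simp add: boundary_link_part bc)
    ultimately show ?thesis
      using key Suc unfolding essential_cycle_def by blast
  qed
qed

text \<open>
  The other part of the same long exact sequence: a class of the link either dies in the deletion,
  and then comes from a class of \<open>K\<close>, or survives there.
\<close>

lemma essential_cycle_from_link:
  fixes c :: "'v::finite set \<Rightarrow> 'k::comm_ring_1"
  assumes c: "essential_cycle {\<tau>. v \<notin> \<tau> \<and> insert v \<tau> \<in> K} i c"
    and down: "\<And>\<tau>. insert v \<tau> \<in> K \<Longrightarrow> \<tau> \<in> K"
  shows "(\<exists>d :: 'v set \<Rightarrow> 'k. essential_cycle K (Suc i) d) \<or>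
    essential_cycle {\<tau> \<in> K. v \<notin> \<tau>} i c"
proof (rule ccontr)
  let ?L = "{\<tau>. v \<notin> \<tau> \<and> insert v \<tau> \<in> K}" and ?D = "{\<tau> \<in> K. v \<notin> \<tau>}"
  assume "\<not> ?thesis"
  then have nK: "\<And>d :: 'v set \<Rightarrow> 'k. \<not> essential_cycle K (Suc i) d"
    and nD: "\<not> essential_cycle ?D i c" by auto
  have cL: "chain_on ?L i c" and bc: "boundary c = 0"
    and ess: "\<And>d. chain_on ?L (Suc i) d \<Longrightarrow> boundary d \<noteq> c"
    using c by (auto simp: essential_cycle_def)
  have "chain_on ?D i c" using cL down by (auto simp: chain_on_def)
  with bc nD obtain f where f: "chain_on ?D (Suc i) f" "boundary f = c"
    unfolding essential_cycle_def by blast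
  let ?g = "cone_over v c - f"
  have "chain_on K (Suc i) (cone_over v c)"
    by (rule chain_on_cone_over[OF cL]) auto
  moreover have "chain_on K (Suc i) f" using f(1) by (auto simp: chain_on_def)
  ultimately have "chain_on K (Suc i) ?g" by (rule chain_on_diff)
  moreover have "boundary ?g = 0" by (simp add: boundary_diff boundary_cone_over bc f)
  ultimately obtain e where e: "chain_on K (Suc (Suc i)) e" "boundary e = ?g"
    using nK unfolding essential_cycle_def by blast
  have "link_part v ?g = c"
  proof -
    have "link_part v f = 0" using f(1) by (intro link_part_eq_0) (auto simp: chain_on_def)
    moreover have "link_part v (cone_over v c) = c"
      using cL by (intro link_part_cone_over) (auto simp: chain_on_def)
    ultimately show ?thesis by (simp add: link_part_diff)
  qed
  then have "boundary (- link_part v e) = c"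
    by (simp add: boundary_uminus boundary_link_part e)
  moreover have "chain_on ?L (Suc i) (- link_part v e)"
    by (rule chain_on_uminus[OF chain_on_link_part[OF e(1)]])
  ultimately show False using ess by blast
qed

section \<open>Independence complexes of bipartite graphs\<close>

lemma card_add_card_Diff: "X \<subseteq> (W :: 'v::finite set) \<Longrightarrow> card X + card (W - X) = card W"
  by (simp add: card_Diff_subset card_mono)

text \<open>
  A bipartite graph is a set \<open>E \<subseteq> A \<times> B\<close> of edges oriented from \<open>A\<close> to \<open>B\<close>, where \<open>A\<close> and \<open>B\<close> are
  disjoint. A set that spans no edge is independent.
\<close>

definition spans_edge :: "('v \<times> 'v) set \<Rightarrow> 'v set \<Rightarrow> bool" where
  "spans_edge E S \<longleftrightarrow> (\<exists>(a, b)\<in>E. a \<in> S \<and> b \<in> S)"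

text \<open>
  The Alexander dual of the independence complex of the subgraph induced on \<open>W\<close>. A class of degree
  \<open>i\<close> corresponds to a reduced cohomology class of the independence complex in dimension
  \<open>card W - i - 2\<close>, so constructions that keep \<open>card W - i\<close> keep that dimension.
\<close>

definition dual_complex :: "('v \<times> 'v) set \<Rightarrow> 'v set \<Rightarrow> 'v set set" where
  "dual_complex E W = {\<tau>. \<tau> \<subseteq> W \<and> spans_edge E (W - \<tau>)}"

lemma spans_edge_mono: "spans_edge E S \<Longrightarrow> S \<subseteq> T \<Longrightarrow> spans_edge E T"
  unfolding spans_edge_def by fast

lemma dual_complex_down: "insert v \<tau> \<in> dual_complex E W \<Longrightarrow> \<tau> \<in> dual_complex E W"
  unfolding dual_complex_def by (auto elim: spans_edge_mono)

lemma dual_complex_link: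
  assumes "v \<in> W"
  shows "{\<tau>. v \<notin> \<tau> \<and> insert v \<tau> \<in> dual_complex E W} = dual_complex E (W - {v})"
proof -
  have "W - insert v \<tau> = W - {v} - \<tau>" for \<tau> by auto
  with assms have "v \<notin> \<tau> \<and> insert v \<tau> \<in> dual_complex E W \<longleftrightarrow> \<tau> \<in> dual_complex E (W - {v})" for \<tau>
    unfolding dual_complex_def mem_Collect_eq by (metis insert_subset subset_Diff_insert Diff_empty)
  then show ?thesis by blast
qed

text \<open>
  The fold lemma for independence complexes. If all neighbours of \<open>y\<close> are neighbours of \<open>b\<close>, then
  in a set which spans an edge and contains \<open>b\<close>, an edge at \<open>y\<close> can be exchanged for one at \<open>b\<close>.
  Hence the deletion of \<open>b\<close> is a cone with apex \<open>y\<close>, and what remains of the homology lives in the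
  link of \<open>b\<close>, which belongs to \<open>W - {b}\<close>.
\<close>

lemma essential_cycle_delete_dominated:
  fixes c :: "'v::finite set \<Rightarrow> 'k::comm_ring_1"
  assumes c: "essential_cycle (dual_complex E W) i c"
    and W: "X \<subseteq> W" "y \<in> W" "y \<notin> X"
    and y: "\<And>b. (y, b) \<notin> E"
    and dom: "\<And>a b. b \<in> X \<Longrightarrow> (a, y) \<in> E \<Longrightarrow> (a, b) \<in> E \<and> a \<notin> X"
  shows "\<exists>i' (c' :: 'v set \<Rightarrow> 'k). i = i' + card X \<and> essential_cycle (dual_complex E (W - X)) i' c'"
proof -
  have "finite X" by simp
  then show ?thesis using c W dom
  proof (induction X arbitrary: W i c rule: finite_induct)
    case empty
    then show ?case by auto
  next
    case (insert b X)
    have "\<not> essential_cycle {\<tau> \<in> dual_complex E W. b \<notin> \<tau>} i d" for d :: "'v set \<Rightarrow> 'k"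
    proof (rule cone_acyclic[where v = y])
      fix \<tau> assume \<tau>: "\<tau> \<in> {\<tau> \<in> dual_complex E W. b \<notin> \<tau>}" "y \<notin> \<tau>"
      then obtain u w where uw: "(u, w) \<in> E" "u \<in> W - \<tau>" "w \<in> W - \<tau>" and "\<tau> \<subseteq> W"
        by (auto simp: dual_complex_def spans_edge_def)
      have "b \<in> W" "b \<noteq> y" using insert.prems(2,4) by auto
      have "spans_edge E (W - insert y \<tau>)"
      proof (cases "w = y")
        case True
        then have "(u, b) \<in> E" "u \<noteq> y" using insert.prems(5)[of b u] uw(1) y by blast+
        then show ?thesis unfolding spans_edge_def using uw \<tau> \<open>b \<in> W\<close> \<open>b \<noteq> y\<close> by fast
      next
        case False
        moreover have "u \<noteq> y" using uw y by auto
        ultimately show ?thesis unfolding spans_edge_def using uw by fast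
      qed
      then show "insert y \<tau> \<in> {\<tau> \<in> dual_complex E W. b \<notin> \<tau>}"
        using \<tau> \<open>\<tau> \<subseteq> W\<close> \<open>b \<noteq> y\<close> insert.prems(3) by (auto simp: dual_complex_def)
    qed
    note acyclic = this
    have "\<exists>i'. i = Suc i' \<and>
        essential_cycle {\<tau>. b \<notin> \<tau> \<and> insert b \<tau> \<in> dual_complex E W} i' (link_part b c)"
      by (rule essential_cycle_link[OF insert.prems(1) _ acyclic]) (rule dual_complex_down)
    moreover have "b \<in> W" using insert.prems(2) by simp
    ultimately obtain i' where i': "i = Suc i'"
        "essential_cycle (dual_complex E (W - {b})) i' (link_part b c)"
      unfolding dual_complex_link[OF \<open>b \<in> W\<close>] by blast
    moreover have "X \<subseteq> W - {b}" "y \<in> W - {b}" "y \<notin> X" using insert.prems(2-4) insert.hyps by auto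
    moreover have "(a, b') \<in> E \<and> a \<notin> X" if "b' \<in> X" "(a, y) \<in> E" for a b'
      using insert.prems(5)[of b' a] that by auto
    ultimately have "\<exists>i'' (c' :: 'v set \<Rightarrow> 'k). i' = i'' + card X \<and>
        essential_cycle (dual_complex E (W - {b} - X)) i'' c'"
      by (intro insert.IH)
    moreover have "W - {b} - X = W - insert b X" by auto
    ultimately show ?case using i' insert.hyps by auto
  qed
qed

text \<open>
  The complex in the hypothesis is the deletion of a vertex with neighbourhood \<open>Y\<close> from the
  dual complex of \<open>W\<close> with that vertex added: a complement that meets \<open>Y\<close> spans an edge together
  with the vertex. Deleting \<open>y \<in> Y\<close> from it leaves a full simplex on the rest of \<open>W\<close>, which is
  a cone as long as \<open>W\<close> has a vertex outside \<open>Y\<close>.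
\<close>

lemma essential_cycle_delete_neighbours:
  fixes c :: "'v::finite set \<Rightarrow> 'k::comm_ring_1"
  assumes c: "essential_cycle {\<tau>. \<tau> \<subseteq> W \<and> (spans_edge E (W - \<tau>) \<or> \<not> Y \<subseteq> \<tau>)} i c"
    and Y: "Y \<subseteq> W" "Y \<noteq> W"
  shows "\<exists>i' (c' :: 'v set \<Rightarrow> 'k). i = i' + card Y \<and> essential_cycle (dual_complex E (W - Y)) i' c'"
proof -
  have "finite Y" by simp
  then show ?thesis using c Y
  proof (induction Y arbitrary: W i c rule: finite_induct)
    case empty
    then show ?case by (auto simp: dual_complex_def)
  next
    case (insert y Y)
    define K where "K = {\<tau>. \<tau> \<subseteq> W \<and> (spans_edge E (W - \<tau>) \<or> \<not> insert y Y \<subseteq> \<tau>)}"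
    obtain w where w: "w \<in> W" "w \<notin> insert y Y" using insert.prems(2,3) by auto
    have "\<not> essential_cycle {\<tau> \<in> K. y \<notin> \<tau>} i d" for d :: "'v set \<Rightarrow> 'k"
      by (rule cone_acyclic[where v = w]) (use w in \<open>auto simp: K_def\<close>)
    moreover have "\<tau> \<in> K" if "insert v \<tau> \<in> K" for v \<tau>
    proof -
      have "\<not> insert y Y \<subseteq> \<tau> \<or> spans_edge E (W - \<tau>)"
        using that spans_edge_mono[of E "W - insert v \<tau>" "W - \<tau>"] unfolding K_def by blast
      then show ?thesis using that by (auto simp: K_def)
    qed
    ultimately obtain i' where i': "i = Suc i'"
        "essential_cycle {\<tau>. y \<notin> \<tau> \<and> insert y \<tau> \<in> K} i' (link_part y c)"
      using essential_cycle_link[of K i c y] insert.prems(1) unfolding K_def[symmetric] by metis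
    have K_link: "{\<tau>. y \<notin> \<tau> \<and> insert y \<tau> \<in> K} =
        {\<tau>. \<tau> \<subseteq> W - {y} \<and> (spans_edge E (W - {y} - \<tau>) \<or> \<not> Y \<subseteq> \<tau>)}"
    proof -
      have "W - insert y \<tau> = W - {y} - \<tau>" for \<tau> by auto
      moreover have "insert y Y \<subseteq> insert y \<tau> \<longleftrightarrow> Y \<subseteq> \<tau>" for \<tau> using insert.hyps by auto
      moreover have "y \<notin> \<tau> \<and> insert y \<tau> \<subseteq> W \<longleftrightarrow> \<tau> \<subseteq> W - {y}" for \<tau> using insert.prems(2) by auto
      ultimately have "y \<notin> \<tau> \<and> insert y \<tau> \<in> K \<longleftrightarrow>
          \<tau> \<subseteq> W - {y} \<and> (spans_edge E (W - {y} - \<tau>) \<or> \<not> Y \<subseteq> \<tau>)" for \<tau>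
        unfolding K_def mem_Collect_eq by metis
      then show ?thesis by blast
    qed
    have "Y \<subseteq> W - {y}" "Y \<noteq> W - {y}" using insert.prems(2,3) insert.hyps by auto
    with i'(2)[unfolded K_link] have "\<exists>i'' (c' :: 'v set \<Rightarrow> 'k). i' = i'' + card Y \<and>
        essential_cycle (dual_complex E (W - {y} - Y)) i'' c'"
      by (rule insert.IH)
    moreover have "W - {y} - Y = W - insert y Y" by auto
    ultimately show ?case using i' insert.hyps by auto
  qed
qed

text \<open>
  For an edge \<open>e = (x, y)\<close> of a bipartite graph with edge ideal \<open>I\<close>, this is the graph whose edge
  ideal is \<open>I\<^sup>2 : xy\<close>.
\<close>

definition join_neighbours :: "('v \<times> 'v) set \<Rightarrow> 'v \<times> 'v \<Rightarrow> ('v \<times> 'v) set" where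
  "join_neighbours E e = E \<union> {(a, b). (a, snd e) \<in> E \<and> (fst e, b) \<in> E}"

text \<open>
  After the join, the neighbours of \<open>y\<close> are adjacent to each neighbour \<open>b\<close> of \<open>x\<close>, so every such \<open>b \<noteq> y\<close>
  is dominated by \<open>y\<close> and can be deleted. All added edges end in a neighbour of \<open>x\<close>, and those at
  \<open>y\<close> were edges before; what remains is an induced subgraph of the original graph.
\<close>

lemma essential_cycle_join_neighbours_pivot:
  fixes c :: "'v::finite set \<Rightarrow> 'k::comm_ring_1"
  assumes E: "E \<subseteq> A \<times> B" "A \<inter> B = {}" and xy: "(x, y) \<in> E" and "y \<in> W"
    and c: "essential_cycle (dual_complex (join_neighbours E (x, y)) W) i c"
  shows "\<exists>W' i' (c' :: 'v set \<Rightarrow> 'k). essential_cycle (dual_complex E W') i' c' \<and>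
      card W' + i = card W + i'"
proof -
  let ?E' = "join_neighbours E (x, y)"
  define X where "X = {b \<in> W. (x, b) \<in> E \<and> b \<noteq> y}"
  have "\<exists>i' (c' :: 'v set \<Rightarrow> 'k). i = i' + card X \<and> essential_cycle (dual_complex ?E' (W - X)) i' c'"
    by (rule essential_cycle_delete_dominated[OF c _ \<open>y \<in> W\<close>])
       (use E xy in \<open>auto simp: X_def join_neighbours_def\<close>)
  then obtain i' and c' :: "'v set \<Rightarrow> 'k" where c': "i = i' + card X"
      "essential_cycle (dual_complex ?E' (W - X)) i' c'"
    by blast
  have "spans_edge ?E' S \<longleftrightarrow> spans_edge E S" if "S \<subseteq> W - X" for S
    using that by (auto simp: spans_edge_def join_neighbours_def X_def)
  then have "dual_complex ?E' (W - X) = dual_complex E (W - X)"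
    by (auto simp: dual_complex_def)
  moreover have "card X + card (W - X) = card W"
    by (rule card_add_card_Diff) (auto simp: X_def)
  ultimately show ?thesis using c' by (intro exI[of _ "W - X"] exI[of _ i'] exI[of _ c']) auto
qed

text \<open>
  If \<open>y\<close> is absent from \<open>W\<close>, put it in. A class for \<open>W\<close> comes from a class for \<open>insert y W\<close>, where
  the previous lemma applies, or survives in the deletion of \<open>y\<close>. The latter has the homology
  of \<open>W\<close> without the neighbours of \<open>y\<close>, a set in which no added edge is left.
\<close>

theorem essential_cycle_join_neighbours:
  fixes c :: "'v::finite set \<Rightarrow> 'k::comm_ring_1"
  assumes E: "E \<subseteq> A \<times> B" "A \<inter> B = {}" and xy: "(x, y) \<in> E"
    and c: "essential_cycle (dual_complex (join_neighbours E (x, y)) W) i c"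
  shows "\<exists>W' i' (c' :: 'v set \<Rightarrow> 'k). essential_cycle (dual_complex E W') i' c' \<and>
      card W' + i = card W + i'"
proof (cases "y \<in> W")
  case True
  then show ?thesis using essential_cycle_join_neighbours_pivot[OF E xy _ c] by blast
next
  case False
  let ?E' = "join_neighbours E (x, y)"
  define K where "K = dual_complex ?E' (insert y W)"
  define Y where "Y = {a \<in> W. (a, y) \<in> E}"
  have link: "{\<tau>. y \<notin> \<tau> \<and> insert y \<tau> \<in> K} = dual_complex ?E' W"
    using dual_complex_link[of y "insert y W" ?E'] False by (simp add: K_def)
  have "(\<exists>d :: 'v set \<Rightarrow> 'k. essential_cycle K (Suc i) d) \<or> essential_cycle {\<tau> \<in> K. y \<notin> \<tau>} i c"
  proof (rule essential_cycle_from_link)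
    show "essential_cycle {\<tau>. y \<notin> \<tau> \<and> insert y \<tau> \<in> K} i c"
      unfolding link by (rule c)
    show "\<And>\<tau>. insert y \<tau> \<in> K \<Longrightarrow> \<tau> \<in> K"
      unfolding K_def by (rule dual_complex_down)
  qed
  then show ?thesis
  proof
    assume "\<exists>d :: 'v set \<Rightarrow> 'k. essential_cycle K (Suc i) d"
    then obtain W' i' and c' :: "'v set \<Rightarrow> 'k"
      where "essential_cycle (dual_complex E W') i' c' \<and> card W' + Suc i = card (insert y W) + i'"
      using essential_cycle_join_neighbours_pivot[OF E xy] unfolding K_def by blast
    then show ?thesis using False by auto
  next
    assume D: "essential_cycle {\<tau> \<in> K. y \<notin> \<tau>} i c"
    have nbrs: "(a, b) \<in> ?E' \<Longrightarrow> b = y \<Longrightarrow> (a, y) \<in> E" "(y, b) \<notin> ?E'" for a b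
      using E xy by (auto simp: join_neighbours_def)
    have step: "spans_edge ?E' (insert y W - \<tau>) \<longleftrightarrow> spans_edge ?E' (W - \<tau>) \<or> \<not> Y \<subseteq> \<tau>" if "y \<notin> \<tau>" for \<tau>
    proof
      assume "spans_edge ?E' (insert y W - \<tau>)"
      then obtain a b where ab: "(a, b) \<in> ?E'" "a \<in> insert y W - \<tau>" "b \<in> insert y W - \<tau>"
        by (auto simp: spans_edge_def)
      then have "a \<noteq> y" using nbrs by blast
      show "spans_edge ?E' (W - \<tau>) \<or> \<not> Y \<subseteq> \<tau>"
      proof (cases "b = y")
        case True
        then have "a \<in> Y" using ab \<open>a \<noteq> y\<close> nbrs by (auto simp: Y_def)
        then show ?thesis using ab by auto
      next
        case False
        then show ?thesis using ab \<open>a \<noteq> y\<close> unfolding spans_edge_def by blast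
      qed
    next
      assume "spans_edge ?E' (W - \<tau>) \<or> \<not> Y \<subseteq> \<tau>"
      then show "spans_edge ?E' (insert y W - \<tau>)"
      proof
        assume "\<not> Y \<subseteq> \<tau>"
        then obtain a where "a \<in> W - \<tau>" "(a, y) \<in> ?E'" by (auto simp: Y_def join_neighbours_def)
        then show ?thesis using that unfolding spans_edge_def by blast
      qed (auto elim: spans_edge_mono)
    qed
    have "{\<tau> \<in> K. y \<notin> \<tau>} = {\<tau>. \<tau> \<subseteq> W \<and> (spans_edge ?E' (W - \<tau>) \<or> \<not> Y \<subseteq> \<tau>)}"
    proof (rule Set.set_eqI)
      fix \<tau>
      have "\<tau> \<subseteq> insert y W \<and> y \<notin> \<tau> \<longleftrightarrow> \<tau> \<subseteq> W" using False by blast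
      then show "\<tau> \<in> {\<tau> \<in> K. y \<notin> \<tau>} \<longleftrightarrow>
          \<tau> \<in> {\<tau>. \<tau> \<subseteq> W \<and> (spans_edge ?E' (W - \<tau>) \<or> \<not> Y \<subseteq> \<tau>)}"
        using step[of \<tau>] unfolding K_def dual_complex_def mem_Collect_eq by blast
    qed
    note D = D[unfolded this]
    have "Y \<noteq> W"
    proof
      assume "Y = W"
      then have "W \<subseteq> A" using E by (auto simp: Y_def)
      then have "\<not> spans_edge ?E' W"
        using E by (fastforce simp: spans_edge_def join_neighbours_def)
      then have "dual_complex ?E' W = {}"
        by (auto simp: dual_complex_def dest: spans_edge_mono[of _ _ W])
      then have "c = 0" using c by (auto simp: essential_cycle_def chain_on_def fun_eq_iff)
      then show False using c unfolding essential_cycle_def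
        by (metis boundary_0 chain_on_def zero_fun_apply)
    qed
    then obtain i' and c' :: "'v set \<Rightarrow> 'k"
      where c': "i = i' + card Y" "essential_cycle (dual_complex ?E' (W - Y)) i' c'"
      using essential_cycle_delete_neighbours[OF D] by (auto simp: Y_def)
    have "spans_edge ?E' S \<longleftrightarrow> spans_edge E S" if "S \<subseteq> W - Y" for S
      using that by (auto simp: spans_edge_def join_neighbours_def Y_def)
    then have "dual_complex ?E' (W - Y) = dual_complex E (W - Y)"
      by (auto simp: dual_complex_def)
    moreover have "card Y + card (W - Y) = card W"
      by (rule card_add_card_Diff) (auto simp: Y_def)
    ultimately show ?thesis using c' by (intro exI[of _ "W - Y"] exI[of _ i'] exI[of _ c']) auto
  qed
qed

section \<open>Graded polynomials\<close>

lemma lookup_single_mult_plus: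
  "Poly_Mapping.lookup (Poly_Mapping.single k c * p) (k + m) =
    c * Poly_Mapping.lookup (p :: ('v, 'k::comm_ring_1) mpoly) m"
proof -
  have "Poly_Mapping.lookup (Poly_Mapping.single k c * p) (k + m) =
      (\<Sum>l. (c when k = l) * (\<Sum>q. Poly_Mapping.lookup p q when k + m = l + q))"
    by (simp add: lookup_mult lookup_single)
  also have "\<dots> = (\<Sum>l. c * (\<Sum>q. Poly_Mapping.lookup p q when k + m = l + q) when l = k)"
    by (intro Sum_any.cong) (auto simp: when_def)
  also have "\<dots> = c * (\<Sum>q. Poly_Mapping.lookup p q when m = q)"
    by simp
  finally show ?thesis by simp
qed

lemma lookup_single_mult_eq_0:
  assumes "\<And>m'. m \<noteq> k + m'"
  shows "Poly_Mapping.lookup (Poly_Mapping.single k c * (p :: ('v, 'k::comm_ring_1) mpoly)) m = 0"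
proof (rule ccontr)
  assume "\<not> ?thesis"
  then have "m \<in> Poly_Mapping.keys (Poly_Mapping.single k c * p)" by (simp add: in_keys_iff)
  then obtain a b where "m = a + b" "a \<in> Poly_Mapping.keys (Poly_Mapping.single k c)"
    using keys_mult[of "Poly_Mapping.single k c" p] by auto
  then show False using assms by (auto split: if_splits)
qed

lemma lookup_koszul_sign_mult:
  "Poly_Mapping.lookup (koszul_sign v \<tau> * (p :: ('v::finite, 'k::comm_ring_1) mpoly)) m =
    koszul_sign v \<tau> * Poly_Mapping.lookup p m"
  by (cases "even (card {u \<in> \<tau>. vertex_index u < vertex_index v})") (simp_all add: koszul_sign_def)

lemma monomial_deg_0 [simp]: "monomial_deg 0 = 0"
  by (simp add: monomial_deg_def)

lemma monomial_deg_add: "monomial_deg (m + m') = monomial_deg m + monomial_deg m'"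
  by (simp add: monomial_deg_def lookup_add sum.distrib)

lemma monomial_deg_eq_0_iff: "monomial_deg m = 0 \<longleftrightarrow> m = 0"
  by (auto simp: monomial_deg_def poly_mapping_eq_iff fun_eq_iff)

lemma sum_single_lookup:
  "(\<Sum>m\<in>Poly_Mapping.keys p. Poly_Mapping.single m (Poly_Mapping.lookup p m)) = p"
  by (rule poly_mapping_eqI)
    (auto simp: lookup_sum lookup_single when_def in_keys_iff sum.delta[OF finite_keys])

text \<open>
  The part of degree \<open>j\<close> of a polynomial whose constants are placed in degree \<open>a\<close>. Carrying the shift
  \<open>a\<close> as an argument avoids the truncated difference \<open>j - a\<close>.
\<close>

definition homogeneous_part ::
  "nat \<Rightarrow> nat \<Rightarrow> ('v::finite, 'k::comm_ring_1) mpoly \<Rightarrow> ('v, 'k) mpoly" where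
  "homogeneous_part a j p =
    (\<Sum>m\<in>{m \<in> Poly_Mapping.keys p. a + monomial_deg m = j}.
      Poly_Mapping.single m (Poly_Mapping.lookup p m))"

lemma lookup_homogeneous_part:
  "Poly_Mapping.lookup (homogeneous_part a j p) m =
    (if a + monomial_deg m = j then Poly_Mapping.lookup p m else 0)"
  by (auto simp: homogeneous_part_def lookup_sum lookup_single when_def in_keys_iff sum.delta)

lemma homogeneous_part_0 [simp]: "homogeneous_part a j 0 = 0"
  by (simp add: homogeneous_part_def)

lemma homogeneous_part_sum: "homogeneous_part a j (\<Sum>i\<in>I. f i) = (\<Sum>i\<in>I. homogeneous_part a j (f i))"
  by (rule poly_mapping_eqI) (simp add: lookup_homogeneous_part lookup_sum)

lemma homogeneous_part_id:
  assumes "\<And>m. m \<in> Poly_Mapping.keys p \<Longrightarrow> a + monomial_deg m = j"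
  shows "homogeneous_part a j p = p"
  using assms by (intro poly_mapping_eqI) (auto simp: lookup_homogeneous_part in_keys_iff)

lemma homogeneous_part_eq_0:
  assumes "\<And>m. m \<in> Poly_Mapping.keys p \<Longrightarrow> a + monomial_deg m \<noteq> j"
  shows "homogeneous_part a j p = 0"
  using assms by (intro poly_mapping_eqI) (auto simp: lookup_homogeneous_part in_keys_iff)

lemma keys_homogeneous_part:
  "Poly_Mapping.keys (homogeneous_part a j p) = {m \<in> Poly_Mapping.keys p. a + monomial_deg m = j}"
  by (auto simp: in_keys_iff lookup_homogeneous_part split: if_splits)

lemma homogeneous_part_mult:
  assumes p: "\<And>m. m \<in> Poly_Mapping.keys p \<Longrightarrow> a + monomial_deg m = a'"
  shows "homogeneous_part a j (p * q) = p * homogeneous_part a' j q"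
proof -
  have mono: "homogeneous_part a j (p * Poly_Mapping.single m c) =
      p * homogeneous_part a' j (Poly_Mapping.single m c)" for m c
  proof -
    have deg: "a + monomial_deg n = a' + monomial_deg m"
      if n: "n \<in> Poly_Mapping.keys (p * Poly_Mapping.single m c)" for n
    proof -
      obtain u m' where "u \<in> Poly_Mapping.keys p" "n = u + m'"
          "m' \<in> Poly_Mapping.keys (Poly_Mapping.single m c)"
        using n keys_mult[of p "Poly_Mapping.single m c"] by blast
      then have "u \<in> Poly_Mapping.keys p" "n = u + m" by (auto split: if_splits)
      then show ?thesis using p[of u] by (simp add: monomial_deg_add)
    qed
    show ?thesis
    proof (cases "a' + monomial_deg m = j")
      case True
      then have "homogeneous_part a j (p * Poly_Mapping.single m c) = p * Poly_Mapping.single m c"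
        using deg by (intro homogeneous_part_id) auto
      moreover have "homogeneous_part a' j (Poly_Mapping.single m c) = Poly_Mapping.single m c"
        using True by (intro homogeneous_part_id) (auto split: if_splits)
      ultimately show ?thesis by simp
    next
      case False
      then have "homogeneous_part a j (p * Poly_Mapping.single m c) = 0"
        using deg by (intro homogeneous_part_eq_0) auto
      moreover have "homogeneous_part a' j (Poly_Mapping.single m c) = 0"
        using False by (intro homogeneous_part_eq_0) (auto split: if_splits)
      ultimately show ?thesis by simp
    qed
  qed
  have "homogeneous_part a j
      (p * (\<Sum>m\<in>Poly_Mapping.keys q. Poly_Mapping.single m (Poly_Mapping.lookup q m))) =
      p * homogeneous_part a' j
          (\<Sum>m\<in>Poly_Mapping.keys q. Poly_Mapping.single m (Poly_Mapping.lookup q m))"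
    by (simp add: sum_distrib_left homogeneous_part_sum mono)
  then show ?thesis by (simp only: sum_single_lookup)
qed

section \<open>Koszul complexes\<close>

definition squarefree_monomial :: "'v set \<Rightarrow> 'v \<Rightarrow>\<^sub>0 nat" where
  "squarefree_monomial \<tau> = (\<Sum>v\<in>\<tau>. Poly_Mapping.single v 1)"

lemma lookup_squarefree_monomial:
  "Poly_Mapping.lookup (squarefree_monomial \<tau>) (v :: 'v::finite) = (if v \<in> \<tau> then 1 else 0)"
  by (simp add: squarefree_monomial_def lookup_sum lookup_single when_def)

lemma monomial_deg_squarefree_monomial [simp]: "monomial_deg (squarefree_monomial \<tau>) =
    card (\<tau> :: 'v::finite set)"
  by (simp add: monomial_deg_def lookup_squarefree_monomial sum.If_cases)

lemma keys_squarefree_monomial [simp]: "Poly_Mapping.keys (squarefree_monomial \<tau>) =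
    (\<tau> :: 'v::finite set)"
  by (auto simp: in_keys_iff lookup_squarefree_monomial split: if_splits)

lemma minus_squarefree_monomial_add:
  "(\<tau> :: 'v::finite set) \<subseteq> Poly_Mapping.keys b \<Longrightarrow>
      b - squarefree_monomial \<tau> + squarefree_monomial \<tau> = b"
  by (rule poly_mapping_eqI)
     (auto simp: lookup_add lookup_minus lookup_squarefree_monomial in_keys_iff subset_iff)

lemma subset_keys_add_squarefree_monomial: "(\<tau> :: 'v::finite set) \<subseteq>
    Poly_Mapping.keys (m + squarefree_monomial \<tau>)"
  by (auto simp: in_keys_iff lookup_add lookup_squarefree_monomial)

text \<open>
  The strand in multidegree \<open>b\<close> of the \<open>r\<close>-th coordinate of a Koszul chain: the basis element for
  \<open>\<tau>\<close> has the multidegree of the product of the variables in \<open>\<tau>\<close>. The strands turn questions about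
  polynomials into questions about chains on families of sets.
\<close>

definition strand ::
  "('v::finite set \<Rightarrow> nat \<Rightarrow> ('v, 'k::comm_ring_1) mpoly) \<Rightarrow> nat \<Rightarrow> ('v \<Rightarrow>\<^sub>0 nat) \<Rightarrow> 'v set \<Rightarrow> 'k" where
  "strand C r b = (\<lambda>\<tau>. if \<tau> \<subseteq> Poly_Mapping.keys b
     then Poly_Mapping.lookup (C \<tau> r) (b - squarefree_monomial \<tau>) else 0)"

definition koszul_boundary ::
  "('v::finite set \<Rightarrow> nat \<Rightarrow> ('v, 'k::comm_ring_1) mpoly) \<Rightarrow> 'v set \<Rightarrow> nat \<Rightarrow> ('v, 'k) mpoly" where
  "koszul_boundary C = (\<lambda>\<tau> r. \<Sum>v\<in>-\<tau>. koszul_sign v \<tau> * (Var v * C (insert v \<tau>) r))"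

lemma lookup_eq_strand: "Poly_Mapping.lookup (C \<tau> r) m = strand C r (m + squarefree_monomial \<tau>) \<tau>"
  by (simp add: strand_def subset_keys_add_squarefree_monomial)

lemma strand_ext:
  assumes "\<And>r b. strand C r b = strand C' r b"
  shows "C = C'"
  by (intro ext poly_mapping_eqI) (simp add: lookup_eq_strand assms)

lemma strand_0 [simp]: "strand 0 r b = 0"
  by (auto simp: strand_def fun_eq_iff)

lemma strand_diff: "strand (C - C') r b = strand C r b - strand C' r b"
  by (auto simp: strand_def fun_eq_iff lookup_minus)

lemma strand_koszul_boundary: "strand (koszul_boundary C) r b = boundary (strand C r b)"
proof
  fix \<tau>
  show "strand (koszul_boundary C) r b \<tau> = boundary (strand C r b) \<tau>"
  proof (cases "\<tau> \<subseteq> Poly_Mapping.keys b")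
    case False
    then show ?thesis by (auto simp: strand_def boundary_def)
  next
    case True
    define m where "m = b - squarefree_monomial \<tau>"
    have "Poly_Mapping.lookup (Var v * C (insert v \<tau>) r) m = strand C r b (insert v \<tau>)"
        if "v \<in> - \<tau>" for v
    proof (cases "v \<in> Poly_Mapping.keys b")
      case v: True
      have "m = Poly_Mapping.single v 1 + (b - squarefree_monomial (insert v \<tau>))"
        using v that by (intro poly_mapping_eqI)
          (auto simp: m_def lookup_add lookup_minus lookup_single lookup_squarefree_monomial
              in_keys_iff when_def)
      then show ?thesis
        using True v by (simp add: strand_def Var_def lookup_single_mult_plus)
    next
      case False
      have "Poly_Mapping.lookup m v \<noteq> Poly_Mapping.lookup (Poly_Mapping.single v 1 + m') v" for m'
        using False by (simp add: m_def lookup_minus lookup_add in_keys_iff)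
      then have "m \<noteq> Poly_Mapping.single v 1 + m'" for m' by metis
      then show ?thesis
        using False by (simp add: strand_def Var_def lookup_single_mult_eq_0)
    qed
    then show ?thesis
      using True unfolding strand_def[of "koszul_boundary C"] boundary_def
      by (simp add: koszul_boundary_def lookup_sum lookup_koszul_sign_mult flip: m_def)
  qed
qed

lemma strand_exists:
  fixes d :: "nat \<Rightarrow> ('v::finite \<Rightarrow>\<^sub>0 nat) \<Rightarrow> 'v set \<Rightarrow> 'k::comm_ring_1"
  assumes sub: "\<And>r b \<tau>. d r b \<tau> \<noteq> 0 \<Longrightarrow> \<tau> \<subseteq> Poly_Mapping.keys b"
    and fin: "\<And>r. finite {b. d r b \<noteq> 0}"
  obtains C where "\<And>r b. strand C r b = d r b"
proof
  define C where "C = (\<lambda>\<tau> r. Abs_poly_mapping (\<lambda>m. d r (m + squarefree_monomial \<tau>) \<tau>))"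
  have "finite {m. d r (m + squarefree_monomial \<tau>) \<tau> \<noteq> 0}" for r \<tau>
  proof (rule finite_imageD)
    show "finite ((\<lambda>m. m + squarefree_monomial \<tau>) ` {m. d r (m + squarefree_monomial \<tau>) \<tau> \<noteq> 0})"
      by (rule finite_subset[OF _ fin[of r]]) (auto simp: fun_eq_iff)
  qed (auto simp: inj_on_def)
  then have lookup: "Poly_Mapping.lookup (C \<tau> r) m = d r (m + squarefree_monomial \<tau>) \<tau>" for \<tau> r m
    by (simp add: C_def)
  show "strand C r b = d r b" for r b
    using sub by (auto simp: strand_def lookup fun_eq_iff minus_squarefree_monomial_add)
qed

lemma koszul_boundary_0 [simp]: "koszul_boundary 0 = 0"
  by (simp add: koszul_boundary_def fun_eq_iff)

lemma koszul_boundary_diff: "koszul_boundary (C - C') = koszul_boundary C - koszul_boundary C'"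
  by (rule strand_ext) (simp add: strand_koszul_boundary strand_diff boundary_diff)

lemma koszul_boundary_koszul_boundary: "koszul_boundary (koszul_boundary C) = 0"
  by (rule strand_ext) (simp add: strand_koszul_boundary boundary_boundary)

text \<open>
  Vectors of every rank live in the one type \<^typ>\<open>nat \<Rightarrow> 'a\<close>, which is a group under pointwise
  addition.
\<close>

definition free_module :: "nat \<Rightarrow> (nat \<Rightarrow> ('v, 'k::comm_ring_1) mpoly) set" where
  "free_module n = {w. \<forall>r\<ge>n. w r = 0}"

lemma free_moduleD: "w \<in> free_module n \<Longrightarrow> w r \<noteq> 0 \<Longrightarrow> r < n"
  by (rule ccontr) (simp add: free_module_def)

text \<open>
  Chains in homological degree \<open>i\<close> and internal degree \<open>j\<close> of the Koszul complex of a graded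
  submodule \<open>Z\<close> of the free module whose basis elements have the degrees \<open>E\<close>.
\<close>

definition koszul_chain ::
  "nat list \<Rightarrow> (nat \<Rightarrow> ('v::finite, 'k::comm_ring_1) mpoly) set \<Rightarrow> nat \<Rightarrow> nat \<Rightarrow>
    ('v set \<Rightarrow> nat \<Rightarrow> ('v, 'k) mpoly) \<Rightarrow> bool" where
  "koszul_chain E Z i j C \<longleftrightarrow>
     (\<forall>\<tau>. C \<tau> \<in> Z \<and> (card \<tau> \<noteq> i \<longrightarrow> C \<tau> = 0) \<and>
       (\<forall>r. \<forall>m\<in>Poly_Mapping.keys (C \<tau> r). E ! r + monomial_deg m + card \<tau> = j))"

text \<open>
  For a graded submodule \<open>Z\<close> and a field \<open>k\<close>, such a chain exists iff \<open>Tor\<^sub>i(Z, k)\<close> is nonzero in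
  degree \<open>j\<close>.
\<close>

definition koszul_class ::
  "nat list \<Rightarrow> (nat \<Rightarrow> ('v::finite, 'k::comm_ring_1) mpoly) set \<Rightarrow> nat \<Rightarrow> nat \<Rightarrow>
    ('v set \<Rightarrow> nat \<Rightarrow> ('v, 'k) mpoly) \<Rightarrow> bool" where
  "koszul_class E Z i j C \<longleftrightarrow> koszul_chain E Z i j C \<and> koszul_boundary C = 0 \<and>
     \<not> (\<exists>D. koszul_chain E Z (Suc i) j D \<and> koszul_boundary D = C)"

lemma koszul_chain_iff_strand:
  "koszul_chain E (free_module n) i j C \<longleftrightarrow>
    (\<forall>r b \<tau>. strand C r b \<tau> \<noteq> 0 \<longrightarrow> r < n \<and> card \<tau> = i \<and> E ! r + monomial_deg b = j)"
    (is "?L \<longleftrightarrow> ?R")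
proof
  assume ?L
  show ?R
  proof (intro allI impI)
    fix r b \<tau> assume "strand C r b \<tau> \<noteq> 0"
    then have \<tau>: "\<tau> \<subseteq> Poly_Mapping.keys b"
        and m: "b - squarefree_monomial \<tau> \<in> Poly_Mapping.keys (C \<tau> r)"
      by (auto simp: strand_def in_keys_iff split: if_splits)
    have "E ! r + monomial_deg (b - squarefree_monomial \<tau>) + card \<tau> = j"
      using \<open>?L\<close> m unfolding koszul_chain_def by blast
    moreover have "monomial_deg (b - squarefree_monomial \<tau>) + card \<tau> = monomial_deg b"
      using arg_cong[OF minus_squarefree_monomial_add[OF \<tau>], of monomial_deg]
      by (simp add: monomial_deg_add)
    moreover have "C \<tau> r \<noteq> 0" using m by auto
    then have "C \<tau> \<noteq> 0" by (auto simp: fun_eq_iff)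
    then have "card \<tau> = i" using \<open>?L\<close> unfolding koszul_chain_def by blast
    moreover have "C \<tau> \<in> free_module n" using \<open>?L\<close> unfolding koszul_chain_def by blast
    then have "r < n" using \<open>C \<tau> r \<noteq> 0\<close> by (rule free_moduleD)
    ultimately show "r < n \<and> card \<tau> = i \<and> E ! r + monomial_deg b = j" by simp
  qed
next
  assume ?R
  have *: "r < n \<and> card \<tau> = i \<and> E ! r + monomial_deg m + card \<tau> = j"
    if "m \<in> Poly_Mapping.keys (C \<tau> r)" for \<tau> r m
    using that \<open>?R\<close>[rule_format, of r "m + squarefree_monomial \<tau>" \<tau>]
    by (simp add: in_keys_iff lookup_eq_strand monomial_deg_add)
  have nonzero: "\<exists>m. m \<in> Poly_Mapping.keys (C \<tau> r)" if "C \<tau> r \<noteq> 0" for \<tau> r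
    using that by (metis poly_mapping_eqI in_keys_iff lookup_zero)
  show ?L
    unfolding koszul_chain_def
  proof (intro allI conjI impI ballI)
    show "C \<tau> \<in> free_module n" for \<tau>
      unfolding free_module_def mem_Collect_eq using nonzero * by (meson not_le)
    show "C \<tau> = 0" if "card \<tau> \<noteq> i" for \<tau>
    proof
      show "C \<tau> r = 0 r" for r using nonzero * that unfolding zero_fun_apply by blast
    qed
  qed (use * in blast)
qed

lemma koszul_chain_boundary:
  assumes "koszul_chain E (free_module n) (Suc i) j C"
  shows "koszul_chain E (free_module n) i j (koszul_boundary C)"
  unfolding koszul_chain_iff_strand strand_koszul_boundary
proof (intro allI impI)
  fix r b \<tau> assume "boundary (strand C r b) \<tau> \<noteq> 0"
  then obtain v where "v \<in> - \<tau>" "koszul_sign v \<tau> * strand C r b (insert v \<tau>) \<noteq> 0"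
    unfolding boundary_def by (rule sum.not_neutral_contains_not_neutral)
  then have v: "v \<notin> \<tau>" "strand C r b (insert v \<tau>) \<noteq> 0" by auto
  then have "r < n \<and> card (insert v \<tau>) = Suc i \<and> E ! r + monomial_deg b = j"
    using assms unfolding koszul_chain_iff_strand by blast
  then show "r < n \<and> card \<tau> = i \<and> E ! r + monomial_deg b = j"
    using v(1) by simp
qed

lemma koszul_chain_free_diff:
  assumes "koszul_chain E (free_module n) i j C" "koszul_chain E (free_module n) i j C'"
  shows "koszul_chain E (free_module n) i j (C - C')"
  unfolding koszul_chain_iff_strand strand_diff
proof (intro allI impI)
  fix r b \<tau> assume "(strand C r b - strand C' r b) \<tau> \<noteq> 0"
  then have "strand C r b \<tau> \<noteq> 0 \<or> strand C' r b \<tau> \<noteq> 0" by auto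
  then show "r < n \<and> card \<tau> = i \<and> E ! r + monomial_deg b = j"
    using assms unfolding koszul_chain_iff_strand by blast
qed

lemma finite_strand_support: "finite {b. strand C r b \<noteq> 0}"
proof (rule finite_subset)
  show "{b. strand C r b \<noteq> 0} \<subseteq>
      (\<Union>\<tau>. (\<lambda>m. m + squarefree_monomial \<tau>) ` Poly_Mapping.keys (C \<tau> r))"
  proof
    fix b assume "b \<in> {b. strand C r b \<noteq> 0}"
    then obtain \<tau> where "strand C r b \<tau> \<noteq> 0" by (auto simp: fun_eq_iff)
    then have "\<tau> \<subseteq> Poly_Mapping.keys b" "b - squarefree_monomial \<tau> \<in> Poly_Mapping.keys (C \<tau> r)"
      by (auto simp: strand_def in_keys_iff split: if_splits)
    then show "b \<in> (\<Union>\<tau>. (\<lambda>m. m + squarefree_monomial \<tau>) ` Poly_Mapping.keys (C \<tau> r))"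
      by (intro UN_I[OF UNIV_I] image_eqI) (rule minus_squarefree_monomial_add[symmetric])
  qed
qed auto

text \<open>
  In a multidegree \<open>b \<noteq> 0\<close> the faces of the strand are all subsets of the support of \<open>b\<close>, hence a cone
  over any variable that divides the monomial. In multidegree zero only the constants remain, and
  they are excluded by the hypothesis on the strands.
\<close>

lemma koszul_acyclic_free:
  fixes C :: "'v::finite set \<Rightarrow> nat \<Rightarrow> ('v, 'k::comm_ring_1) mpoly"
  assumes C: "koszul_chain E (free_module n) i j C" and cycle: "koszul_boundary C = 0"
    and const: "\<And>r. strand C r 0 = 0"
  obtains D where "koszul_chain E (free_module n) (Suc i) j D" "koszul_boundary D = C"
proof -
  have "\<exists>v. v \<in> Poly_Mapping.keys b" if "b \<noteq> 0" for b :: "'v \<Rightarrow>\<^sub>0 nat"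
    using that by (metis poly_mapping_eqI in_keys_iff lookup_zero)
  then obtain apex where apex: "\<And>b :: 'v \<Rightarrow>\<^sub>0 nat. b \<noteq> 0 \<Longrightarrow> apex b \<in> Poly_Mapping.keys b" by metis
  define d where "d = (\<lambda>r b. if b = 0 then 0 else cone_over (apex b) (strand C r b))"
  have d_nonzero: "apex b \<in> \<tau> \<and> b \<noteq> 0 \<and> strand C r b (\<tau> - {apex b}) \<noteq> 0" if "d r b \<tau> \<noteq> 0" for r b \<tau>
    using that by (auto simp: d_def cone_over_def split: if_splits)
  have "\<tau> \<subseteq> Poly_Mapping.keys b" if "d r b \<tau> \<noteq> 0" for r b \<tau>
  proof -
    have "\<tau> - {apex b} \<subseteq> Poly_Mapping.keys b"
      using d_nonzero[OF that] by (auto simp: strand_def split: if_splits)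
    then show ?thesis using apex[of b] d_nonzero[OF that] by auto
  qed
  moreover have "finite {b. d r b \<noteq> 0}" for r
    by (rule finite_subset[OF _ finite_strand_support[of C r]]) (auto simp: d_def)
  ultimately obtain D where D: "\<And>r b. strand D r b = d r b"
    using strand_exists[of d] by metis
  have "koszul_chain E (free_module n) (Suc i) j D"
    unfolding koszul_chain_iff_strand D
  proof (intro allI impI)
    fix r b \<tau> assume "d r b \<tau> \<noteq> 0"
    note * = d_nonzero[OF this]
    then have "r < n \<and> card (\<tau> - {apex b}) = i \<and> E ! r + monomial_deg b = j"
      using C unfolding koszul_chain_iff_strand by blast
    moreover have "card \<tau> = Suc (card (\<tau> - {apex b}))"
      using * by (intro card.remove) auto
    ultimately show "r < n \<and> card \<tau> = Suc i \<and> E ! r + monomial_deg b = j"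
      by linarith
  qed
  moreover have "koszul_boundary D = C"
  proof (rule strand_ext)
    fix r b
    have "boundary (strand C r b) = 0"
      by (simp add: cycle flip: strand_koszul_boundary)
    then show "strand (koszul_boundary D) r b = strand C r b"
      by (simp add: strand_koszul_boundary D d_def boundary_cone_over const)
  qed
  ultimately show ?thesis by (rule that)
qed

section \<open>Minimal covers by free modules\<close>

definition matrix_apply :: "nat \<Rightarrow> (nat \<Rightarrow> nat \<Rightarrow> 'a::comm_ring_1) \<Rightarrow> (nat \<Rightarrow> 'a) \<Rightarrow> nat \<Rightarrow> 'a" where
  "matrix_apply n A w = (\<lambda>r. \<Sum>c<n. A r c * w c)"

lemma matrix_apply_0 [simp]: "matrix_apply n A 0 = 0"
  by (simp add: matrix_apply_def fun_eq_iff)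

lemma matrix_apply_add: "matrix_apply n A (w + w') = matrix_apply n A w + matrix_apply n A w'"
  by (simp add: matrix_apply_def fun_eq_iff distrib_left sum.distrib)

lemma matrix_apply_diff: "matrix_apply n A (w - w') = matrix_apply n A w - matrix_apply n A w'"
  by (simp add: matrix_apply_def fun_eq_iff right_diff_distrib sum_subtractf)

lemma matrix_apply_koszul_boundary:
  "(\<lambda>\<tau>. matrix_apply n A (koszul_boundary C \<tau>)) = koszul_boundary (\<lambda>\<tau>. matrix_apply n A (C \<tau>))"
  unfolding koszul_boundary_def matrix_apply_def sum_distrib_left
  by (intro ext, subst sum.swap) (simp add: mult_ac)

definition relations :: "nat list \<Rightarrow> (nat \<Rightarrow> nat \<Rightarrow> ('v, 'k::comm_ring_1) mpoly) \<Rightarrow>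
    (nat \<Rightarrow> ('v, 'k) mpoly) set" where
  "relations F A = {w \<in> free_module (length F). matrix_apply (length F) A w = 0}"

definition graded_entries ::
  "nat list \<Rightarrow> nat list \<Rightarrow> (nat \<Rightarrow> nat \<Rightarrow> ('v::finite, 'k::comm_ring_1) mpoly) \<Rightarrow> bool" where
  "graded_entries E F A \<longleftrightarrow> (\<forall>r c. \<forall>m\<in>Poly_Mapping.keys (A r c).
     r < length E \<and> c < length F \<and> E ! r + monomial_deg m = F ! c)"

text \<open>
  One step of a minimal graded free resolution of \<open>Z\<close>. The condition on the relations says that the
  kernel lies in the maximal ideal times the free module.
\<close>

definition minimal_cover ::
  "nat list \<Rightarrow> (nat \<Rightarrow> ('v::finite, 'k::comm_ring_1) mpoly) set \<Rightarrow> nat list \<Rightarrow>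
    (nat \<Rightarrow> nat \<Rightarrow> ('v, 'k) mpoly) \<Rightarrow> bool" where
  "minimal_cover E Z F A \<longleftrightarrow> graded_entries E F A \<and>
     Z = matrix_apply (length F) A ` free_module (length F) \<and>
     (\<forall>w\<in>relations F A. \<forall>c. Poly_Mapping.lookup (w c) 0 = 0)"

definition component :: "nat list \<Rightarrow> nat \<Rightarrow> (nat \<Rightarrow> ('v::finite, 'k::comm_ring_1) mpoly) \<Rightarrow> nat \<Rightarrow>
    ('v, 'k) mpoly" where
  "component E j w = (\<lambda>r. homogeneous_part (E ! r) j (w r))"

lemma component_0 [simp]: "component E j 0 = 0"
  by (simp add: component_def fun_eq_iff)

lemma component_free_module: "w \<in> free_module n \<Longrightarrow> component E j w \<in> free_module n"
  by (simp add: component_def free_module_def)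

lemma component_matrix_apply:
  assumes "graded_entries E F A"
  shows "component E j (matrix_apply (length F) A w) = matrix_apply (length F) A (component F j w)"
  unfolding component_def matrix_apply_def homogeneous_part_sum
  using assms by (intro ext sum.cong homogeneous_part_mult) (auto simp: graded_entries_def)

lemma keys_matrix_apply:
  assumes A: "graded_entries E F A" and m: "m \<in> Poly_Mapping.keys (matrix_apply (length F) A w r)"
  shows "r < length E" "\<exists>c<length F. \<exists>m'\<in>Poly_Mapping.keys (w c). E ! r + monomial_deg m =
      F ! c + monomial_deg m'"
proof -
  have "m \<in> (\<Union>c\<in>{..<length F}. Poly_Mapping.keys (A r c * w c))"
    using m keys_sum[of "\<lambda>c. A r c * w c" "{..<length F}"] by (auto simp: matrix_apply_def)
  then obtain c u m' where c: "c < length F" "m = u + m'" "u \<in> Poly_Mapping.keys (A r c)"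
      "m' \<in> Poly_Mapping.keys (w c)"
    using keys_mult by blast
  then have "r < length E" "E ! r + monomial_deg u = F ! c" using A
    by (auto simp: graded_entries_def)
  with c show "r < length E"
      "\<exists>c<length F. \<exists>m'\<in>Poly_Mapping.keys (w c). E ! r + monomial_deg m = F ! c + monomial_deg m'"
    by (auto simp: monomial_deg_add intro!: exI[of _ c] bexI[of _ m'])
qed

lemma koszul_chain_matrix_apply:
  assumes A: "graded_entries E F A" and C: "koszul_chain F (free_module (length F)) i j C"
  shows "koszul_chain E (matrix_apply (length F) A ` free_module (length F)) i j (\<lambda>\<tau>.
      matrix_apply (length F) A (C \<tau>))"
  unfolding koszul_chain_def
proof (intro allI conjI impI ballI)
  show "matrix_apply (length F) A (C \<tau>) \<in> matrix_apply (length F) A ` free_module (length F)" for \<tau>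
    using C by (auto simp: koszul_chain_def)
  show "matrix_apply (length F) A (C \<tau>) = 0" if "card \<tau> \<noteq> i" for \<tau>
    using C that by (simp add: koszul_chain_def)
  show "E ! r + monomial_deg m + card \<tau> = j"
      if "m \<in> Poly_Mapping.keys (matrix_apply (length F) A (C \<tau>) r)" for \<tau> r m
    using keys_matrix_apply(2)[OF A that] C unfolding koszul_chain_def by metis
qed

lemma koszul_chain_lift:
  fixes C :: "'v::finite set \<Rightarrow> nat \<Rightarrow> ('v, 'k::comm_ring_1) mpoly"
  assumes A: "graded_entries E F A"
    and C: "koszul_chain E (matrix_apply (length F) A ` free_module (length F)) i j C"
  obtains L where "koszul_chain F (free_module (length F)) i j L"
      "(\<lambda>\<tau>. matrix_apply (length F) A (L \<tau>)) = C"
proof -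
  let ?P = "\<lambda>\<tau> w. w \<in> free_module (length F) \<and> matrix_apply (length F) A w = C \<tau> \<and>
    (C \<tau> = 0 \<longrightarrow> w = 0) \<and> (\<forall>r. \<forall>m\<in>Poly_Mapping.keys (w r). F ! r + monomial_deg m + card \<tau> = j)"
  have "\<exists>w. ?P \<tau> w" for \<tau>
  proof (cases "C \<tau> = 0")
    case True
    then show ?thesis by (intro exI[of _ 0]) (simp add: free_module_def)
  next
    case False
    then obtain r where "C \<tau> r \<noteq> 0" by (auto simp: fun_eq_iff)
    then obtain m where "m \<in> Poly_Mapping.keys (C \<tau> r)"
      by (metis poly_mapping_eqI in_keys_iff lookup_zero)
    then have "card \<tau> \<le> j" using C unfolding koszul_chain_def by (metis le_add2)
    obtain w where w: "w \<in> free_module (length F)" "C \<tau> = matrix_apply (length F) A w"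
      using C unfolding koszul_chain_def by blast
    have "C \<tau> = component E (j - card \<tau>) (C \<tau>)"
      unfolding component_def
    proof (rule ext, rule homogeneous_part_id[symmetric])
      fix r m assume "m \<in> Poly_Mapping.keys (C \<tau> r)"
      then have "E ! r + monomial_deg m + card \<tau> = j" using C unfolding koszul_chain_def by blast
      then show "E ! r + monomial_deg m = j - card \<tau>" by simp
    qed
    also have "\<dots> = matrix_apply (length F) A (component F (j - card \<tau>) w)"
      by (simp add: w component_matrix_apply[OF A])
    finally have "matrix_apply (length F) A (component F (j - card \<tau>) w) = C \<tau>" ..
    then have "?P \<tau> (component F (j - card \<tau>) w)"
      using component_free_module[OF w(1)] False \<open>card \<tau> \<le> j\<close>
      by (auto simp: component_def keys_homogeneous_part)
    then show ?thesis by blast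
  qed
  then obtain L where L: "\<And>\<tau>. ?P \<tau> (L \<tau>)" by metis
  have "koszul_chain F (free_module (length F)) i j L"
    unfolding koszul_chain_def
  proof (intro allI conjI impI ballI)
    show "L \<tau> = 0" if "card \<tau> \<noteq> i" for \<tau>
      using C L that by (simp add: koszul_chain_def)
  qed (use L in blast)+
  then show ?thesis using L that by auto
qed

lemma koszul_chain_relations_iff:
  "koszul_chain F (relations F A) i j C \<longleftrightarrow>
    koszul_chain F (free_module (length F)) i j C \<and> (\<lambda>\<tau>. matrix_apply (length F) A (C \<tau>)) = 0"
  by (auto simp: koszul_chain_def relations_def fun_eq_iff)

text \<open>
  The long exact Koszul homology sequence of the kernel, the free module and \<open>Z\<close>. The
  connecting map is an isomorphism because the free module is acyclic; at \<open>i = 0\<close> this uses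
  that the elements of the kernel have no constant terms.
\<close>

theorem koszul_dimension_shift:
  fixes Z :: "(nat \<Rightarrow> ('v::finite, 'k::comm_ring_1) mpoly) set"
  assumes cover: "minimal_cover E Z F A"
  shows "(\<exists>C. koszul_class E Z (Suc i) j C) \<longleftrightarrow> (\<exists>C. koszul_class F (relations F A) i j C)"
proof
  let ?n = "length F"
  let ?F = "free_module ?n :: (nat \<Rightarrow> ('v, 'k) mpoly) set"
  let ?\<phi> = "\<lambda>C :: 'v set \<Rightarrow> nat \<Rightarrow> ('v, 'k) mpoly. \<lambda>\<tau>. matrix_apply ?n A (C \<tau>)"
  have A: "graded_entries E F A" and Z: "Z = matrix_apply ?n A ` ?F"
    and const: "\<And>w c. w \<in> relations F A \<Longrightarrow> Poly_Mapping.lookup (w c) 0 = 0"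
    using cover by (auto simp: minimal_cover_def)
  have \<phi>_diff: "?\<phi> (C - C') = ?\<phi> C - ?\<phi> C'" for C C'
    by (simp add: matrix_apply_diff fun_eq_iff)
  {
    assume "\<exists>C. koszul_class E Z (Suc i) j C"
    then obtain C where C: "koszul_chain E Z (Suc i) j C" "koszul_boundary C = 0"
      and ess: "\<And>D. koszul_chain E Z (Suc (Suc i)) j D \<Longrightarrow> koszul_boundary D \<noteq> C"
      by (auto simp: koszul_class_def)
    obtain L where L: "koszul_chain F ?F (Suc i) j L" "?\<phi> L = C"
      using koszul_chain_lift[OF A] C(1) unfolding Z by metis
    have "koszul_class F (relations F A) i j (koszul_boundary L)"
      unfolding koszul_class_def
    proof (intro conjI notI)
      show "koszul_chain F (relations F A) i j (koszul_boundary L)"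
        unfolding koszul_chain_relations_iff matrix_apply_koszul_boundary L(2) C(2)
        using koszul_chain_boundary[OF L(1)] by simp
      show "koszul_boundary (koszul_boundary L) = 0" by (rule koszul_boundary_koszul_boundary)
      assume "\<exists>D. koszul_chain F (relations F A) (Suc i) j D \<and>
          koszul_boundary D = koszul_boundary L"
      then obtain D where D: "koszul_chain F ?F (Suc i) j D" "?\<phi> D = 0"
          "koszul_boundary D = koszul_boundary L"
        unfolding koszul_chain_relations_iff by blast
      have LD: "koszul_chain F ?F (Suc i) j (L - D)" by (rule koszul_chain_free_diff[OF L(1) D(1)])
      moreover have "koszul_boundary (L - D) = 0" by (simp add: koszul_boundary_diff D)
      moreover have "strand (L - D) r 0 = 0" for r
      proof
        fix \<tau>
        show "strand (L - D) r 0 \<tau> = 0 \<tau>"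
        proof (rule ccontr)
          assume ne: "\<not> ?thesis"
          then have "card \<tau> = Suc i" using LD unfolding koszul_chain_iff_strand by auto
          moreover have "\<tau> = {}" using ne by (auto simp: strand_def split: if_splits)
          ultimately show False by simp
        qed
      qed
      ultimately obtain M where M: "koszul_chain F ?F (Suc (Suc i)) j M" "koszul_boundary M = L - D"
        using koszul_acyclic_free by metis
      have "koszul_chain E Z (Suc (Suc i)) j (?\<phi> M)"
        using koszul_chain_matrix_apply[OF A M(1)] by (simp add: Z)
      moreover have "koszul_boundary (?\<phi> M) = C"
        by (simp only: matrix_apply_koszul_boundary[symmetric] M \<phi>_diff L D) simp
      ultimately show False using ess by blast
    qed
    then show "\<exists>C. koszul_class F (relations F A) i j C" by blast
  next
    assume "\<exists>C. koszul_class F (relations F A) i j C"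
    then obtain C where C: "koszul_chain F ?F i j C" "?\<phi> C = 0" "koszul_boundary C = 0"
      and CZ: "koszul_chain F (relations F A) i j C"
      and ess: "\<And>D. koszul_chain F ?F (Suc i) j D \<Longrightarrow> ?\<phi> D = 0 \<Longrightarrow> koszul_boundary D \<noteq> C"
      by (auto simp: koszul_class_def koszul_chain_relations_iff)
    have "strand C r 0 = 0" for r
    proof
      fix \<tau>
      have "C \<tau> \<in> relations F A" using CZ unfolding koszul_chain_def by blast
      then have "Poly_Mapping.lookup (C \<tau> r) 0 = 0" by (rule const)
      then show "strand C r 0 \<tau> = 0 \<tau>" by (auto simp: strand_def squarefree_monomial_def)
    qed
    then obtain L where L: "koszul_chain F ?F (Suc i) j L" "koszul_boundary L = C"
      using koszul_acyclic_free[OF C(1,3)] by metis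
    have "koszul_class E Z (Suc i) j (?\<phi> L)"
      unfolding koszul_class_def
    proof (intro conjI notI)
      show "koszul_chain E Z (Suc i) j (?\<phi> L)"
        using koszul_chain_matrix_apply[OF A L(1)] by (simp add: Z)
      show "koszul_boundary (?\<phi> L) = 0"
        by (simp add: matrix_apply_koszul_boundary[symmetric] L C)
      assume "\<exists>D. koszul_chain E Z (Suc (Suc i)) j D \<and> koszul_boundary D = ?\<phi> L"
      then obtain D where D: "koszul_chain E Z (Suc (Suc i)) j D" "koszul_boundary D = ?\<phi> L"
        by blast
      obtain M where M: "koszul_chain F ?F (Suc (Suc i)) j M" "?\<phi> M = D"
        using koszul_chain_lift[OF A] D(1) unfolding Z by metis
      have "koszul_chain F ?F (Suc i) j (L - koszul_boundary M)"
        by (rule koszul_chain_free_diff[OF L(1) koszul_chain_boundary[OF M(1)]])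
      moreover have "?\<phi> (L - koszul_boundary M) = 0"
        by (simp only: \<phi>_diff matrix_apply_koszul_boundary M D) simp
      moreover have "koszul_boundary (L - koszul_boundary M) = C"
        by (simp add: koszul_boundary_diff koszul_boundary_koszul_boundary L)
      ultimately show False using ess by blast
    qed
    then show "\<exists>C. koszul_class E Z (Suc i) j C" by blast
  }
qed

text \<open>
  Nakayama's lemma in graded form: the degrees of the generators in a minimal cover are the
  degrees in which \<open>Z\<close> modulo the maximal ideal times \<open>Z\<close> is nonzero.
\<close>

lemma koszul_class_0_iff:
  fixes Z :: "(nat \<Rightarrow> ('v::finite, 'k::field) mpoly) set"
  assumes cover: "minimal_cover E Z F A"
  shows "(\<exists>C. koszul_class E Z 0 j C) \<longleftrightarrow> j \<in> set F"
proof
  let ?n = "length F"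
  let ?F = "free_module ?n :: (nat \<Rightarrow> ('v, 'k) mpoly) set"
  let ?\<phi> = "\<lambda>C :: 'v set \<Rightarrow> nat \<Rightarrow> ('v, 'k) mpoly. \<lambda>\<tau>. matrix_apply ?n A (C \<tau>)"
  have A: "graded_entries E F A" and Z: "Z = matrix_apply ?n A ` ?F"
    and const: "\<And>w c. w \<in> relations F A \<Longrightarrow> Poly_Mapping.lookup (w c) 0 = 0"
    using cover by (auto simp: minimal_cover_def)
  {
    assume "\<exists>C. koszul_class E Z 0 j C"
    then obtain C where C: "koszul_chain E Z 0 j C"
      and ess: "\<And>D. koszul_chain E Z (Suc 0) j D \<Longrightarrow> koszul_boundary D \<noteq> C"
      by (auto simp: koszul_class_def)
    obtain L where L: "koszul_chain F ?F 0 j L" "?\<phi> L = C"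
      using koszul_chain_lift[OF A] C unfolding Z by metis
    have Lcard: "L \<tau> = 0" if "\<tau> \<noteq> {}" for \<tau>
      using L(1) that unfolding koszul_chain_def by (metis card_eq_0_iff finite)
    have "koszul_boundary L = 0"
      by (auto simp: koszul_boundary_def Lcard fun_eq_iff)
    show "j \<in> set F"
    proof (cases "\<forall>r. strand L r 0 = 0")
      case True
      then obtain D where D: "koszul_chain F ?F (Suc 0) j D" "koszul_boundary D = L"
        using koszul_acyclic_free[OF L(1) \<open>koszul_boundary L = 0\<close>] by metis
      have "koszul_chain E Z (Suc 0) j (?\<phi> D)"
        using koszul_chain_matrix_apply[OF A D(1)] by (simp add: Z)
      moreover have "koszul_boundary (?\<phi> D) = C"
        by (simp only: matrix_apply_koszul_boundary[symmetric] D L)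
      ultimately show ?thesis using ess by blast
    next
      case False
      then obtain r \<tau> where "strand L r 0 \<tau> \<noteq> 0" by (auto simp: fun_eq_iff)
      then have "r < ?n \<and> F ! r + monomial_deg (0 :: 'v \<Rightarrow>\<^sub>0 nat) = j"
        using L(1) unfolding koszul_chain_iff_strand by blast
      then show ?thesis by auto
    qed
  next
    assume "j \<in> set F"
    then obtain c where c: "c < ?n" "F ! c = j" by (auto simp: in_set_conv_nth)
    define L :: "'v set \<Rightarrow> nat \<Rightarrow> ('v, 'k) mpoly"
      where "L = (\<lambda>\<tau> r. if \<tau> = {} \<and> r = c then 1 else 0)"
    have L: "koszul_chain F ?F 0 j L"
      using c by (auto simp: koszul_chain_def L_def free_module_def fun_eq_iff)
    have "koszul_class E Z 0 j (?\<phi> L)"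
      unfolding koszul_class_def
    proof (intro conjI notI)
      show "koszul_chain E Z 0 j (?\<phi> L)"
        using koszul_chain_matrix_apply[OF A L] by (simp add: Z)
      have "koszul_boundary L = 0" by (simp add: koszul_boundary_def L_def fun_eq_iff)
      then show "koszul_boundary (?\<phi> L) = 0"
        by (simp only: matrix_apply_koszul_boundary[symmetric]) (simp add: fun_eq_iff)
      assume "\<exists>D. koszul_chain E Z (Suc 0) j D \<and> koszul_boundary D = ?\<phi> L"
      then obtain D where D: "koszul_chain E Z (Suc 0) j D" "koszul_boundary D = ?\<phi> L" by blast
      obtain M where M: "koszul_chain F ?F (Suc 0) j M" "?\<phi> M = D"
        using koszul_chain_lift[OF A] D(1) unfolding Z by metis
      let ?N = "L - koszul_boundary M"
      have "koszul_chain F ?F 0 j ?N"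
        by (rule koszul_chain_free_diff[OF L koszul_chain_boundary[OF M(1)]])
      moreover have "?\<phi> ?N = ?\<phi> L - ?\<phi> (koszul_boundary M)"
        by (simp add: matrix_apply_diff fun_eq_iff)
      then have "?\<phi> ?N = 0"
        by (simp only: matrix_apply_koszul_boundary M D diff_self)
      ultimately have "koszul_chain F (relations F A) 0 j ?N"
        by (simp only: koszul_chain_relations_iff simp_thms)
      then have "?N {} \<in> relations F A" unfolding koszul_chain_def by blast
      then have "Poly_Mapping.lookup (?N {} c) 0 = 0" by (rule const)
      moreover have "Poly_Mapping.lookup (koszul_boundary M {} c) 0 = 0"
      proof -
        have "Poly_Mapping.lookup (koszul_boundary M {} c) 0 = boundary (strand M c 0) {}"
          by (simp add: lookup_eq_strand[of "koszul_boundary M"] strand_koszul_boundary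
            squarefree_monomial_def)
        also have "\<dots> = 0" by (simp add: boundary_def strand_def)
        finally show ?thesis .
      qed
      ultimately show False by (simp add: L_def lookup_minus lookup_one)
    qed
    then show "\<exists>C. koszul_class E Z 0 j C" by blast
  }
qed

section \<open>Existence of minimal covers\<close>

interpretation poly_vec: Modules.module "\<lambda>(p :: ('v, 'k::comm_ring_1) mpoly) (w :: nat \<Rightarrow>
    ('v, 'k) mpoly) r. p * w r"
  by unfold_locales (auto simp: fun_eq_iff algebra_simps)

interpretation coeff_vec: vector_space "\<lambda>(a :: 'k::field) (w :: nat \<Rightarrow> ('v, 'k) mpoly) r.
    Poly_Mapping.single 0 a * w r"
  by unfold_locales
     (auto simp: fun_eq_iff distrib_left distrib_right single_add mult_single simp flip: mult.assoc)

definition homogeneous_vec :: "nat list \<Rightarrow> nat \<Rightarrow> (nat \<Rightarrow> ('v::finite, 'k::comm_ring_1) mpoly) \<Rightarrow>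
    bool" where
  "homogeneous_vec E j w \<longleftrightarrow> (\<forall>r. \<forall>m\<in>Poly_Mapping.keys (w r). E ! r + monomial_deg m = j)"

definition graded_submodule :: "nat list \<Rightarrow> (nat \<Rightarrow> ('v::finite, 'k::comm_ring_1) mpoly) set \<Rightarrow> bool"
    where
  "graded_submodule E Z \<longleftrightarrow> poly_vec.subspace Z \<and> Z \<subseteq> free_module (length E) \<and>
     (\<forall>w\<in>Z. \<forall>j. component E j w \<in> Z)"

lemma homogeneous_component: "homogeneous_vec E j (component E j w)"
  by (simp add: homogeneous_vec_def component_def keys_homogeneous_part)

lemma sum_fun_apply: "(\<Sum>i\<in>I. f i) x = (\<Sum>i\<in>I. f i x)" for f :: "'i \<Rightarrow> 'a \<Rightarrow> 'b::comm_monoid_add"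
  by (induction I rule: infinite_finite_induct) auto

lemma sum_components:
  assumes w: "w \<in> free_module (length E)"
  shows "\<exists>J. finite J \<and> w = (\<Sum>j\<in>J. component E j w)"
proof -
  define J where "J = (\<Union>r<length E. (\<lambda>m. E ! r + monomial_deg m) ` Poly_Mapping.keys (w r))"
  have fin: "finite J" by (simp add: J_def)
  have "w r = (\<Sum>j\<in>J. component E j w r)" for r
  proof (rule poly_mapping_eqI)
    fix m
    show "Poly_Mapping.lookup (w r) m = Poly_Mapping.lookup (\<Sum>j\<in>J. component E j w r) m"
    proof (cases "m \<in> Poly_Mapping.keys (w r)")
      case True
      then have "w r \<noteq> 0" by auto
      then have "r < length E" by (rule free_moduleD[OF w])
      then have "E ! r + monomial_deg m \<in> J" using True by (auto simp: J_def)
      then show ?thesis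
        by (simp add: lookup_sum component_def lookup_homogeneous_part sum.delta fin)
    next
      case False
      then have "Poly_Mapping.lookup (w r) m = 0" by (simp add: in_keys_iff)
      then show ?thesis by (simp add: lookup_sum component_def lookup_homogeneous_part)
    qed
  qed
  then have "w = (\<Sum>j\<in>J. component E j w)" by (simp add: fun_eq_iff sum_fun_apply)
  with fin show ?thesis by blast
qed

lemma finite_monomials_of_bounded_degree: "finite {m :: 'v::finite \<Rightarrow>\<^sub>0 nat. monomial_deg m \<le> d}"
proof (rule finite_imageD)
  have "finite {f :: 'v \<Rightarrow> nat. \<forall>x. (x \<in> UNIV \<longrightarrow> f x \<in> {..d}) \<and> (x \<notin> UNIV \<longrightarrow> f x = 0)}"
    by (rule finite_set_of_finite_funs) auto
  then show "finite (Poly_Mapping.lookup ` {m :: 'v \<Rightarrow>\<^sub>0 nat. monomial_deg m \<le> d})"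
  proof (rule rev_finite_subset)
    have "Poly_Mapping.lookup m v \<le> monomial_deg m" for m :: "'v \<Rightarrow>\<^sub>0 nat" and v
      unfolding monomial_deg_def by (rule member_le_sum) auto
    then show "Poly_Mapping.lookup ` {m :: 'v \<Rightarrow>\<^sub>0 nat. monomial_deg m \<le> d}
        \<subseteq> {f. \<forall>x. (x \<in> UNIV \<longrightarrow> f x \<in> {..d}) \<and> (x \<notin> UNIV \<longrightarrow> f x = 0)}"
      by (auto intro: order_trans)
  qed
next
  show "inj_on Poly_Mapping.lookup {m :: 'v \<Rightarrow>\<^sub>0 nat. monomial_deg m \<le> d}"
    by (rule inj_onI) (metis poly_mapping_eqI)
qed

text \<open>
  A subspace of one graded piece of a free module is finite-dimensional, as there are finitely many
  monomials of each degree.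
\<close>

lemma homogeneous_subspace_finite_basis:
  fixes V :: "(nat \<Rightarrow> ('v::finite, 'k::field) mpoly) set"
  assumes V: "V \<subseteq> free_module (length E)" "\<And>w. w \<in> V \<Longrightarrow> homogeneous_vec E j w"
  obtains B where "finite B" "B \<subseteq> V" "V \<subseteq> coeff_vec.span B"
proof -
  define unit :: "nat \<times> ('v \<Rightarrow>\<^sub>0 nat) \<Rightarrow> nat \<Rightarrow> ('v, 'k) mpoly"
    where "unit = (\<lambda>(r, m) s. if s = r then Poly_Mapping.single m 1 else 0)"
  define T where "T = unit ` ({..<length E} \<times> {m. monomial_deg m \<le> j})"
  have "finite T" unfolding T_def by (simp add: finite_monomials_of_bounded_degree)
  have "w \<in> coeff_vec.span T" if w: "w \<in> V" for w
  proof -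
    have zero: "w s = 0" if "s \<ge> length E" for s using w V that by (auto simp: free_module_def)
    have deg: "monomial_deg m \<le> j" if "m \<in> Poly_Mapping.keys (w r)" for r m
      using V(2)[OF w] that unfolding homogeneous_vec_def by (metis le_add2)
    let ?w = "\<Sum>r<length E. \<Sum>m\<in>Poly_Mapping.keys (w r).
        (\<lambda>s. Poly_Mapping.single 0 (Poly_Mapping.lookup (w r) m) * unit (r, m) s)"
    have "w s = ?w s" for s
    proof -
      have "?w s = (\<Sum>r<length E. \<Sum>m\<in>Poly_Mapping.keys (w r).
            if s = r then Poly_Mapping.single m (Poly_Mapping.lookup (w r) m) else 0)"
        unfolding sum_fun_apply unit_def by (intro sum.cong refl) (auto simp: mult_single)
      also have "\<dots> = (\<Sum>r<length E. if s = r then w r else 0)"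
      proof (intro sum.cong refl)
        fix r
        show "(\<Sum>m\<in>Poly_Mapping.keys (w r).
            if s = r then Poly_Mapping.single m (Poly_Mapping.lookup (w r) m) else 0) =
            (if s = r then w r else 0)"
          by (cases "s = r") (simp_all add: sum_single_lookup)
      qed
      also have "\<dots> = w s" using zero[of s] by (simp add: not_less)
      finally show ?thesis ..
    qed
    then have "w = ?w" by (rule ext)
    also have "?w \<in> coeff_vec.span T"
    proof (intro coeff_vec.span_sum coeff_vec.span_scale coeff_vec.span_base)
      fix r m assume "r \<in> {..<length E}" "m \<in> Poly_Mapping.keys (w r)"
      then show "unit (r, m) \<in> T" using deg unfolding T_def by blast
    qed
    finally show ?thesis .
  qed
  then have "V \<subseteq> coeff_vec.span T" by blast
  obtain B where B: "B \<subseteq> V" "coeff_vec.independent B" "V \<subseteq> coeff_vec.span B"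
    using coeff_vec.maximal_independent_subset[of V] by blast
  have "finite B"
    using coeff_vec.independent_span_bound[OF \<open>finite T\<close> B(2)] B(1) \<open>V \<subseteq> coeff_vec.span T\<close> by blast
  then show ?thesis using that B by blast
qed

lemma coeff_span_subset_poly_span: "coeff_vec.span B \<subseteq> poly_vec.span B"
proof (rule coeff_vec.span_minimal)
  show "coeff_vec.subspace (poly_vec.span B)"
    by (rule coeff_vec.subspaceI)
       (use poly_vec.span_zero poly_vec.span_add poly_vec.span_scale in auto)
qed (rule poly_vec.span_superset)

text \<open>
  By induction on the degree. An element of degree above \<open>N\<close> is a zero-cycle of the Koszul
  complex and bounds, so it is a combination of elements of \<open>Z\<close> of smaller degree. Up to degree
  \<open>N\<close>, the bases of the graded pieces generate.
\<close>

lemma graded_submodule_finitely_generated: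
  fixes Z :: "(nat \<Rightarrow> ('v::finite, 'k::field) mpoly) set"
  assumes Z: "graded_submodule E Z"
    and bound: "\<And>j. \<exists>C. koszul_class E Z 0 j C \<Longrightarrow> j \<le> N"
  obtains G where "finite G" "poly_vec.span G = Z" "\<And>g. g \<in> G \<Longrightarrow> \<exists>j. homogeneous_vec E j g"
proof -
  have sub: "poly_vec.subspace Z" and free: "Z \<subseteq> free_module (length E)"
    and comp: "\<And>w j. w \<in> Z \<Longrightarrow> component E j w \<in> Z"
    using Z by (auto simp: graded_submodule_def)
  have "\<exists>B. finite B \<and> B \<subseteq> {w \<in> Z. homogeneous_vec E j w} \<and>
      {w \<in> Z. homogeneous_vec E j w} \<subseteq> coeff_vec.span B" for j
  proof (rule homogeneous_subspace_finite_basis[of "{w \<in> Z. homogeneous_vec E j w}" E j])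
    show "{w \<in> Z. homogeneous_vec E j w} \<subseteq> free_module (length E)" using free by blast
  next
    fix B assume "finite B" "B \<subseteq> {w \<in> Z. homogeneous_vec E j w}"
        "{w \<in> Z. homogeneous_vec E j w} \<subseteq> coeff_vec.span B"
    then show ?thesis by (intro exI[of _ B] conjI)
  qed simp
  from choice[OF allI[OF this]] obtain B
    where "\<forall>j. finite (B j) \<and> B j \<subseteq> {w \<in> Z. homogeneous_vec E j w} \<and>
      {w \<in> Z. homogeneous_vec E j w} \<subseteq> coeff_vec.span (B j)" by (rule exE)
  then have B: "\<And>j. finite (B j)" "\<And>j. B j \<subseteq> {w \<in> Z. homogeneous_vec E j w}"
    "\<And>j. {w \<in> Z. homogeneous_vec E j w} \<subseteq> coeff_vec.span (B j)" by simp_all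
  define G where "G = (\<Union>j\<le>N. B j)"
  have "w \<in> poly_vec.span G" if "w \<in> Z" "homogeneous_vec E j w" for j w
    using that
  proof (induction j arbitrary: w rule: less_induct)
    case (less j)
    show ?case
    proof (cases "j \<le> N")
      case True
      have "w \<in> coeff_vec.span (B j)" using B(3) less.prems by blast
      then have "w \<in> poly_vec.span (B j)" using coeff_span_subset_poly_span by blast
      moreover have "B j \<subseteq> G" using True by (auto simp: G_def)
      ultimately show ?thesis using poly_vec.span_mono by blast
    next
      case False
      define C :: "'v set \<Rightarrow> nat \<Rightarrow> ('v, 'k) mpoly" where "C = (\<lambda>\<tau>. if \<tau> = {} then w else 0)"
      have "koszul_chain E Z 0 j C"
        using less.prems poly_vec.subspace_0[OF sub]
        by (auto simp: koszul_chain_def C_def homogeneous_vec_def)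
      moreover have "koszul_boundary C = 0"
        by (simp add: koszul_boundary_def C_def fun_eq_iff)
      moreover have "\<not> koszul_class E Z 0 j C" using bound[of j] False by blast
      ultimately obtain D where D: "koszul_chain E Z (Suc 0) j D" "koszul_boundary D = C"
        unfolding koszul_class_def by blast
      have "koszul_boundary D {} = w" by (simp add: D C_def)
      moreover have "koszul_boundary D {} = (\<Sum>v\<in>UNIV. (\<lambda>r. Var v * D {v} r))"
        unfolding koszul_boundary_def koszul_sign_def by (rule ext) (simp add: sum_fun_apply)
      moreover have "D {v} \<in> poly_vec.span G" for v
      proof (rule less.IH)
        show "j - 1 < j" using False by simp
        show "D {v} \<in> Z" using D(1) by (simp add: koszul_chain_def)
        show "homogeneous_vec E (j - 1) (D {v})"
          using D(1) unfolding koszul_chain_def homogeneous_vec_def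
          by (metis card_1_singleton_iff One_nat_def add_diff_cancel_right')
      qed
      ultimately show ?thesis
        by (auto intro!: poly_vec.span_sum poly_vec.span_scale)
    qed
  qed
  note homogeneous = this
  have "Z \<subseteq> poly_vec.span G"
  proof
    fix w assume w: "w \<in> Z"
    then obtain J where "w = (\<Sum>j\<in>J. component E j w)" using sum_components free by blast
    also have "\<dots> \<in> poly_vec.span G"
      by (intro poly_vec.span_sum homogeneous[OF comp[OF w] homogeneous_component])
    finally show "w \<in> poly_vec.span G" .
  qed
  moreover have "poly_vec.span G \<subseteq> Z"
    using B(2) by (intro poly_vec.span_minimal[OF _ sub]) (auto simp: G_def)
  moreover have "finite G" by (simp add: G_def B)
  moreover have "\<exists>j. homogeneous_vec E j g" if "g \<in> G" for g using that B(2) by (auto simp: G_def)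
  ultimately show ?thesis using that by blast
qed

text \<open>
  Among the finite sets of homogeneous generators take one of least cardinality. A relation with a
  nonzero constant coefficient would express the generator at that place by the others.
\<close>

lemma minimal_cover_exists:
  fixes Z :: "(nat \<Rightarrow> ('v::finite, 'k::field) mpoly) set"
  assumes Z: "graded_submodule E Z"
    and bound: "\<And>j. \<exists>C. koszul_class E Z 0 j C \<Longrightarrow> j \<le> N"
  obtains F A where "minimal_cover E Z F A"
proof -
  let ?P = "\<lambda>G. finite G \<and> poly_vec.span G = Z \<and> (\<forall>g\<in>G. \<exists>j. homogeneous_vec E j g)"
  obtain G0 where "?P G0"
    by (rule graded_submodule_finitely_generated[OF Z bound]) blast+
  from ex_has_least_nat[where P = ?P and m = card, OF this]
  obtain G where "?P G \<and> (\<forall>G'. ?P G' \<longrightarrow> card G \<le> card G')" by (rule exE)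
  then have G: "?P G" and min: "\<And>G'. ?P G' \<Longrightarrow> card G \<le> card G'"
    by simp_all
  have free: "Z \<subseteq> free_module (length E)" using Z by (auto simp: graded_submodule_def)
  have irredundant: "g \<notin> poly_vec.span (G - {g})" if "g \<in> G" for g
  proof
    assume g: "g \<in> poly_vec.span (G - {g})"
    have "G \<subseteq> poly_vec.span (G - {g})"
      using g poly_vec.span_superset[of "G - {g}"] by blast
    then have "poly_vec.span G \<subseteq> poly_vec.span (G - {g})"
      by (rule poly_vec.span_minimal) simp
    moreover have "poly_vec.span (G - {g}) \<subseteq> poly_vec.span G" by (rule poly_vec.span_mono) auto
    ultimately have "?P (G - {g})" using G by auto
    then have "card G \<le> card (G - {g})" by (rule min)
    then show False using that G card_Diff1_less[of G g] by simp
  qed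
  obtain deg where deg: "\<And>g. g \<in> G \<Longrightarrow> homogeneous_vec E (deg g) g" using G by metis
  obtain gs where gs: "set gs = G" "distinct gs" using finite_distinct_list G by blast
  define F where "F = map deg gs"
  define A where "A = (\<lambda>r c. if c < length gs then (gs ! c) r else 0)"
  have len: "length F = length gs" by (simp add: F_def)
  have inG: "gs ! c \<in> G" if "c < length gs" for c using gs that by auto
  have inZ: "gs ! c \<in> Z" if "c < length gs" for c
    using inG[OF that] G poly_vec.span_superset[of G] by blast
  have matrix_apply_eq: "matrix_apply (length F) A w = (\<Sum>c<length gs. (\<lambda>r. w c * (gs ! c) r))" for w
    by (auto simp: matrix_apply_def A_def fun_eq_iff sum_fun_apply len mult.commute
      intro!: sum.cong)
  have A: "graded_entries E F A"
    unfolding graded_entries_def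
  proof (intro allI ballI)
    fix r c m assume m: "m \<in> Poly_Mapping.keys (A r c)"
    then have c: "c < length gs" by (auto simp: A_def split: if_splits)
    with m have m': "m \<in> Poly_Mapping.keys ((gs ! c) r)" by (simp add: A_def)
    then have "(gs ! c) r \<noteq> 0" by auto
    then have "r < length E" using inZ[OF c] free free_moduleD by blast
    moreover have "E ! r + monomial_deg m = deg (gs ! c)"
      using deg[OF inG[OF c]] m' by (simp add: homogeneous_vec_def)
    ultimately show "r < length E \<and> c < length F \<and> E ! r + monomial_deg m = F ! c"
      using c by (simp add: F_def)
  qed
  moreover have "Z = matrix_apply (length F) A ` free_module (length F)"
  proof
    have "poly_vec.subspace (matrix_apply (length F) A ` free_module (length F))"
    proof (rule poly_vec.subspaceI)
      show "0 \<in> matrix_apply (length F) A ` free_module (length F)"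
        by (rule image_eqI[of _ _ 0]) (auto simp: free_module_def)
    next
      fix x y assume "x \<in> matrix_apply (length F) A ` free_module (length F)"
          "y \<in> matrix_apply (length F) A ` free_module (length F)"
      then obtain u w where "x = matrix_apply (length F) A u" "y = matrix_apply (length F) A w"
        "u \<in> free_module (length F)" "w \<in> free_module (length F)" by blast
      then show "x + y \<in> matrix_apply (length F) A ` free_module (length F)"
        by (intro image_eqI[of _ _ "u + w"]) (auto simp: matrix_apply_add free_module_def)
    next
      fix p x assume "x \<in> matrix_apply (length F) A ` free_module (length F)"
      then obtain u where "x = matrix_apply (length F) A u" "u \<in> free_module (length F)" by blast
      then show "(\<lambda>r. p * x r) \<in> matrix_apply (length F) A ` free_module (length F)"
        by (intro image_eqI[of _ _ "\<lambda>c. p * u c"])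
           (auto simp: matrix_apply_def free_module_def sum_distrib_left mult_ac)
    qed
    moreover have "G \<subseteq> matrix_apply (length F) A ` free_module (length F)"
    proof
      fix g assume "g \<in> G"
      then obtain c where c: "c < length gs" "g = gs ! c" using gs by (metis in_set_conv_nth)
      have "matrix_apply (length F) A (\<lambda>d. if d = c then 1 else 0) = g"
        using c by (simp add: matrix_apply_def A_def len fun_eq_iff if_distrib sum.delta
            cong: if_cong)
      then show "g \<in> matrix_apply (length F) A ` free_module (length F)"
        using c by (intro image_eqI[of _ _ "\<lambda>d. if d = c then 1 else 0"])
            (auto simp: free_module_def len)
    qed
    ultimately show "Z \<subseteq> matrix_apply (length F) A ` free_module (length F)"
      using G poly_vec.span_minimal by blast
    show "matrix_apply (length F) A ` free_module (length F) \<subseteq> Z"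
    proof clarify
      fix w
      have "matrix_apply (length F) A w \<in> poly_vec.span G"
        unfolding matrix_apply_eq
        by (intro poly_vec.span_sum poly_vec.span_scale poly_vec.span_base inG) auto
      then show "matrix_apply (length F) A w \<in> Z" using G by simp
    qed
  qed
  moreover have "Poly_Mapping.lookup (w c) 0 = 0" if w: "w \<in> relations F A" for w c
  proof (rule ccontr)
    assume ne: "Poly_Mapping.lookup (w c) 0 \<noteq> 0"
    have "w c \<noteq> 0" using ne by auto
    then have c: "c < length gs" using w free_moduleD by (auto simp: relations_def len)
    \<comment> \<open>In this degree the coefficient of the generator at c is a constant and can be inverted.\<close>
    define u where "u = component F (F ! c) w"
    define a where "a = Poly_Mapping.lookup (w c) 0"
    have "matrix_apply (length F) A u = component E (F ! c) (matrix_apply (length F) A w)"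
      unfolding u_def by (rule component_matrix_apply[OF A, symmetric])
    also have "matrix_apply (length F) A w = 0" using w by (simp add: relations_def)
    finally have rel: "(\<Sum>d<length gs. (\<lambda>r. u d * (gs ! d) r)) = 0"
      by (simp only: matrix_apply_eq component_0)
    have uc: "u c = Poly_Mapping.single 0 a"
      by (rule poly_mapping_eqI)
         (auto simp: u_def component_def lookup_homogeneous_part lookup_single when_def a_def
             monomial_deg_eq_0_iff)
    let ?others = "\<Sum>d\<in>{..<length gs} - {c}. (\<lambda>r. u d * (gs ! d) r)"
    have others: "?others \<in> poly_vec.span (G - {gs ! c})"
    proof (intro poly_vec.span_sum poly_vec.span_scale poly_vec.span_base)
      fix d assume "d \<in> {..<length gs} - {c}"
      then show "gs ! d \<in> G - {gs ! c}" using inG gs(2) c by (auto simp: nth_eq_iff_index_eq)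
    qed
    have aa: "Poly_Mapping.single 0 (inverse a) * Poly_Mapping.single 0 a = (1 :: ('v, 'k) mpoly)"
      using ne by (simp add: mult_single flip: a_def)
    have "gs ! c = (\<lambda>r. Poly_Mapping.single 0 (- inverse a) * ?others r)"
    proof
      fix r
      have "(\<lambda>r. u c * (gs ! c) r) + ?others = 0"
        using rel c by (subst (asm) sum.remove[of _ c]) auto
      then have "Poly_Mapping.single 0 a * (gs ! c) r + ?others r = 0"
        by (simp add: uc fun_eq_iff)
      then have "?others r = - (Poly_Mapping.single 0 a * (gs ! c) r)"
        by (simp add: add_eq_0_iff)
      then show "(gs ! c) r = Poly_Mapping.single 0 (- inverse a) * ?others r"
        using aa by (simp add: single_uminus flip: mult.assoc)
    qed
    moreover have "(\<lambda>r. Poly_Mapping.single 0 (- inverse a) * ?others r) \<in>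
        poly_vec.span (G - {gs ! c})"
      by (rule poly_vec.span_scale[OF others])
    ultimately have "gs ! c \<in> poly_vec.span (G - {gs ! c})" by (simp only:)
    then show False using irredundant[OF inG[OF c]] by blast
  qed
  ultimately have "minimal_cover E Z F A" by (simp add: minimal_cover_def)
  then show ?thesis by (rule that)
qed

lemma graded_submodule_relations:
  assumes A: "graded_entries E F A"
  shows "graded_submodule F (relations F A)"
  unfolding graded_submodule_def
proof (intro conjI ballI allI)
  show "poly_vec.subspace (relations F A)"
  proof (rule poly_vec.subspaceI)
    fix p x assume "x \<in> relations F A"
    moreover have "matrix_apply (length F) A (\<lambda>c. p * x c) =
        (\<lambda>r. p * matrix_apply (length F) A x r)"
      by (simp add: matrix_apply_def sum_distrib_left mult_ac)
    ultimately show "(\<lambda>c. p * x c) \<in> relations F A"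
      by (auto simp: relations_def free_module_def fun_eq_iff)
  qed (auto simp: relations_def free_module_def matrix_apply_add)
  show "relations F A \<subseteq> free_module (length F)" by (auto simp: relations_def)
  show "component F j w \<in> relations F A" if "w \<in> relations F A" for w j
    using that by (auto simp: relations_def component_free_module
        component_matrix_apply[OF A, symmetric])
qed

section \<open>Resolutions and regularity\<close>

definition entries :: "'a::zero mat \<Rightarrow> nat \<Rightarrow> nat \<Rightarrow> 'a" where
  "entries M r c = (if r < dim_row M \<and> c < dim_col M then M $$ (r, c) else 0)"

text \<open>
  An ideal as a submodule of the free module of rank one.
\<close>

definition rank_one :: "('v, 'k::comm_ring_1) mpoly set \<Rightarrow> (nat \<Rightarrow> ('v, 'k) mpoly) set" where
  "rank_one I = {w \<in> free_module 1. w 0 \<in> I}"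

lemma vec_inj_on_free_module:
  "inj_on (vec n) (free_module n :: (nat \<Rightarrow> ('v, 'k::comm_ring_1) mpoly) set)"
proof (rule inj_onI, rule ext)
  fix u w :: "nat \<Rightarrow> ('v, 'k) mpoly" and r
  assume u: "u \<in> free_module n" and w: "w \<in> free_module n" and eq: "vec n u = vec n w"
  show "u r = w r"
  proof (cases "r < n")
    case True
    then show ?thesis using arg_cong[OF eq, of "\<lambda>v. v $ r"] by simp
  next
    case False
    then show ?thesis using u w by (simp add: free_module_def)
  qed
qed

lemma vec_image_free_module:
  "vec n ` free_module n = (carrier_vec n :: ('v, 'k::comm_ring_1) mpoly vec set)"
proof
  show "vec n ` free_module n \<subseteq> (carrier_vec n :: ('v, 'k) mpoly vec set)" by auto
  show "carrier_vec n \<subseteq> vec n ` (free_module n :: (nat \<Rightarrow> ('v, 'k) mpoly) set)"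
  proof
    fix v :: "('v, 'k) mpoly vec" assume v: "v \<in> carrier_vec n"
    then have "v = vec n (\<lambda>r. if r < n then v $ r else 0)" by (intro eq_vecI) auto
    moreover have "(\<lambda>r. if r < n then v $ r else 0) \<in> free_module n"
      by (simp add: free_module_def)
    ultimately show "v \<in> vec n ` free_module n" by (rule image_eqI)
  qed
qed

lemma mult_mat_vec_entries:
  assumes "M \<in> carrier_mat a b"
  shows "M *\<^sub>v vec b w = vec a (matrix_apply b (entries M) w)"
proof (rule eq_vecI)
  fix r assume "r < dim_vec (vec a (matrix_apply b (entries M) w))"
  then have "r < a" by simp
  then show "(M *\<^sub>v vec b w) $ r = vec a (matrix_apply b (entries M) w) $ r"
    using assms by (auto simp: scalar_prod_def matrix_apply_def entries_def atLeast0LessThan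
        intro!: sum.cong)
qed (use assms in auto)

lemma matrix_apply_entries_free_module:
  assumes "M \<in> carrier_mat a b"
  shows "matrix_apply b (entries M) w \<in> free_module a"
  using assms by (auto simp: matrix_apply_def entries_def free_module_def)

lemma mat_image_entries:
  assumes "M \<in> carrier_mat a b"
  shows "mat_image M = vec a ` matrix_apply b (entries M) ` free_module b"
proof -
  have "mat_image M = (\<lambda>v. M *\<^sub>v v) ` carrier_vec b"
    using assms by (auto simp: mat_image_def)
  also have "\<dots> = (\<lambda>w. M *\<^sub>v vec b w) ` free_module b"
    by (simp only: vec_image_free_module[symmetric] image_image)
  finally show ?thesis by (simp add: mult_mat_vec_entries[OF assms] image_image)
qed

lemma mat_kernel_entries:
  fixes M :: "('v, 'k::comm_ring_1) mpoly mat"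
  assumes M: "M \<in> carrier_mat a b"
  shows "mat_kernel M = vec b ` {w \<in> free_module b. matrix_apply b (entries M) w = 0}"
proof -
  have zero: "M *\<^sub>v vec b w = 0\<^sub>v a \<longleftrightarrow> matrix_apply b (entries M) w = 0" for w
  proof -
    have "0\<^sub>v a = vec a (0 :: nat \<Rightarrow> ('v, 'k) mpoly)" by (intro eq_vecI) auto
    moreover have "(0 :: nat \<Rightarrow> ('v, 'k) mpoly) \<in> free_module a" by (simp add: free_module_def)
    ultimately show ?thesis
      using matrix_apply_entries_free_module[OF M, of w]
      by (simp only: mult_mat_vec_entries[OF M] inj_on_eq_iff[OF vec_inj_on_free_module])
  qed
  have "mat_kernel M = {v \<in> vec b ` free_module b. M *\<^sub>v v = 0\<^sub>v a}"
    using M by (auto simp: mat_kernel_def vec_image_free_module)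
  then show ?thesis using zero by auto
qed

lemma graded_map_entries:
  assumes "graded_map F E M"
  shows "graded_entries E F (entries M)"
  using assms by (auto simp: graded_map_def graded_entries_def entries_def split: if_splits)

lemma exact_iff_entries:
  assumes M: "M \<in> carrier_mat a b" and N: "N \<in> carrier_mat b c"
  shows "mat_image N = mat_kernel M \<longleftrightarrow>
    matrix_apply c (entries N) ` free_module c =
        {w \<in> free_module b. matrix_apply b (entries M) w = 0}"
  unfolding mat_image_entries[OF N] mat_kernel_entries[OF M]
  by (rule inj_on_image_eq_iff[OF vec_inj_on_free_module])
     (use matrix_apply_entries_free_module[OF N] in auto)

lemma augmentation_iff_entries:
  fixes I :: "('v, 'k::comm_ring_1) mpoly set"
  assumes M: "M \<in> carrier_mat 1 b"
  shows "(\<lambda>w. w $ 0) ` mat_image M = I \<longleftrightarrow> matrix_apply b (entries M) ` free_module b = rank_one I"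
    (is "?L = I \<longleftrightarrow> ?S = _")
proof -
  have L: "?L = (\<lambda>w. w 0) ` ?S"
    unfolding mat_image_entries[OF M] by (simp add: image_image)
  have S: "?S \<subseteq> free_module 1" using matrix_apply_entries_free_module[OF M] by auto
  have inj: "w = w'" if "w \<in> free_module 1" "w' \<in> free_module 1" "w 0 = w' 0"
    for w w' :: "nat \<Rightarrow> ('v, 'k) mpoly"
  proof
    fix r show "w r = w' r" using that by (cases r) (auto simp: free_module_def)
  qed
  show ?thesis
  proof
    assume "?L = I"
    then have I: "I = (\<lambda>w. w 0) ` ?S" using L by simp
    show "?S = rank_one I"
    proof
      show "?S \<subseteq> rank_one I" using S by (auto simp: rank_one_def I)
      show "rank_one I \<subseteq> ?S"
      proof
        fix w assume "w \<in> rank_one I"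
        then obtain u where "w \<in> free_module 1" "u \<in> ?S" "w 0 = u 0" by (auto simp: rank_one_def I)
        moreover from this have "w = u" using S by (intro inj) auto
        ultimately show "w \<in> ?S" by simp
      qed
    qed
  next
    assume "?S = rank_one I"
    then have "?L = (\<lambda>w. w 0) ` rank_one I" using L by simp
    also have "\<dots> = I"
    proof
      show "I \<subseteq> (\<lambda>w. w 0) ` rank_one I"
      proof
        fix p assume "p \<in> I"
        then show "p \<in> (\<lambda>w. w 0) ` rank_one I"
          by (intro image_eqI[of _ _ "\<lambda>r. if r = 0 then p else 0"])
            (auto simp: rank_one_def free_module_def)
      qed
    qed (auto simp: rank_one_def)
    finally show "?L = I" .
  qed
qed

lemma lookup_mult_0:
  assumes "Poly_Mapping.lookup p 0 = 0"
  shows "Poly_Mapping.lookup (p * q) (0 :: 'v::finite \<Rightarrow>\<^sub>0 nat) = (0 :: 'k::comm_ring_1)"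
proof (rule ccontr)
  assume "\<not> ?thesis"
  then have "0 \<in> Poly_Mapping.keys (p * q)" by (simp add: in_keys_iff)
  then obtain a b where ab: "0 = a + b" "a \<in> Poly_Mapping.keys p"
    using keys_mult[of p q] by blast
  then have "monomial_deg a + monomial_deg b = 0" by (metis monomial_deg_add monomial_deg_0)
  then have "a = 0" by (simp add: monomial_deg_eq_0_iff)
  then show False using ab(2) assms by (simp add: in_keys_iff)
qed

text \<open>
  Shifting dimensions along the resolution moves the Koszul class of \<open>I\<close> in homological degree
  \<open>i\<close> down to homological degree zero of the \<open>i\<close>-th syzygy module, where it detects
  generators. In particular the degrees do not depend on the resolution.
\<close>

lemma minimal_resolution_degree_iff:
  fixes I :: "('v::finite, 'k::field) mpoly set"
  assumes res: "minimal_graded_free_resolution I F D"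
  shows "j \<in> set (F i) \<longleftrightarrow> (\<exists>C. koszul_class [0] (rank_one I) i j C)"
proof -
  define E where "E i = (case i of 0 \<Rightarrow> [0] | Suc i' \<Rightarrow> F i')" for i
  define Z where "Z i = (case i of 0 \<Rightarrow> rank_one I | Suc i' \<Rightarrow> relations (F i') (entries (D i')))"
      for i
  have graded: "graded_map (F i) (E i) (D i)" for i
    using res by (cases i) (auto simp: E_def minimal_graded_free_resolution_def
        graded_free_resolution_def)
  then have carrier: "D i \<in> carrier_mat (length (E i)) (length (F i))" for i
    by (auto simp: graded_map_def)
  have image: "Z i = matrix_apply (length (F i)) (entries (D i)) ` free_module (length (F i))" for i
  proof (cases i)
    case 0
    have "(\<lambda>w. w $ 0) ` mat_image (D 0) = I"
      using res by (simp add: minimal_graded_free_resolution_def graded_free_resolution_def)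
    then show ?thesis
      using augmentation_iff_entries[of "D 0" "length (F 0)" I] carrier[of 0] 0
      by (simp add: Z_def E_def)
  next
    case (Suc i')
    have "mat_image (D (Suc i')) = mat_kernel (D i')"
      using res by (simp add: minimal_graded_free_resolution_def graded_free_resolution_def)
    moreover have "D (Suc i') \<in> carrier_mat (length (F i')) (length (F (Suc i')))"
      using carrier[of "Suc i'"] by (simp add: E_def)
    ultimately show ?thesis
      using exact_iff_entries[OF carrier[of i'], of "D (Suc i')" "length (F (Suc i'))"] Suc
      by (simp add: Z_def relations_def)
  qed
  have minimal: "Poly_Mapping.lookup (entries (D (Suc i)) r c) 0 = 0" for i r c
    using res carrier[of "Suc i"]
    by (auto simp: entries_def minimal_graded_free_resolution_def E_def)
  have cover: "minimal_cover (E i) (Z i) (F i) (entries (D i))" for i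
    unfolding minimal_cover_def
  proof (intro conjI ballI allI)
    show "graded_entries (E i) (F i) (entries (D i))" by (rule graded_map_entries[OF graded])
    fix w c assume "w \<in> relations (F i) (entries (D i))"
    then have "w \<in> Z (Suc i)" by (simp add: Z_def)
    then obtain u where "w = matrix_apply (length (F (Suc i))) (entries (D (Suc i))) u"
      using image[of "Suc i"] by auto
    then show "Poly_Mapping.lookup (w c) 0 = 0"
      by (simp add: matrix_apply_def lookup_sum lookup_mult_0 minimal)
  qed (rule image)
  have "(\<exists>C. koszul_class (E l) (Z l) p j C) \<longleftrightarrow> j \<in> set (F (l + p))" for l p
  proof (induction p arbitrary: l)
    case 0
    then show ?case using koszul_class_0_iff[OF cover] by simp
  next
    case (Suc p)
    have "(\<exists>C. koszul_class (E l) (Z l) (Suc p) j C) \<longleftrightarrow>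
        (\<exists>C. koszul_class (F l) (relations (F l) (entries (D l))) p j C)"
      by (rule koszul_dimension_shift[OF cover])
    also have "\<dots> \<longleftrightarrow> j \<in> set (F (l + Suc p))"
      using Suc.IH[of "Suc l"] by (simp add: E_def Z_def)
    finally show ?case .
  qed
  from this[of 0 i] show ?thesis by (simp add: E_def Z_def)
qed

lemma entries_mat:
  assumes "graded_entries E F A"
  shows "entries (mat (length E) (length F) (\<lambda>(r, c). A r c)) = A"
proof (intro ext)
  fix r c
  have "A r c = 0" if "\<not> (r < length E \<and> c < length F)"
  proof -
    have "Poly_Mapping.keys (A r c) = {}" using assms that unfolding graded_entries_def by blast
    then show ?thesis by (intro poly_mapping_eqI) (auto simp flip: not_in_keys_iff_lookup_eq_zero)
  qed
  then show "entries (mat (length E) (length F) (\<lambda>(r, c). A r c)) r c = A r c"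
    by (auto simp: entries_def)
qed

text \<open>
  Minimal covers are chosen one after the other. The bound \<open>N\<close> on the degrees of all Koszul classes
  is inherited by the kernels through the dimension shift, so every kernel is finitely generated.
\<close>

theorem minimal_resolution_exists:
  fixes I :: "('v::finite, 'k::field) mpoly set"
  assumes I: "graded_submodule [0] (rank_one I)"
    and bound: "\<And>i j. \<exists>C. koszul_class [0] (rank_one I) i j C \<Longrightarrow> j \<le> N"
  obtains F D where "minimal_graded_free_resolution I F D"
proof -
  define bounded :: "nat list \<Rightarrow> (nat \<Rightarrow> ('v, 'k) mpoly) set \<Rightarrow> bool"
    where "bounded E Z \<longleftrightarrow> graded_submodule E Z \<and> (\<forall>i j. (\<exists>C. koszul_class E Z i j C) \<longrightarrow> j \<le> N)"
        for E Z
  define P where "P n x \<longleftrightarrow> (case x of (E, Z, F, A) \<Rightarrow>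
      bounded E Z \<and> minimal_cover E Z F A \<and> (n = (0::nat) \<longrightarrow> E = [0] \<and> Z = rank_one I))" for n x
  define Q where "Q (n::nat) x y \<longleftrightarrow>
      (case x of (E, Z, F, A) \<Rightarrow> fst y = F \<and> fst (snd y) = relations F A)"
    for n and x y :: "nat list \<times> (nat \<Rightarrow> ('v, 'k) mpoly) set \<times> nat list \<times> (nat \<Rightarrow> nat \<Rightarrow>
        ('v, 'k) mpoly)"
  have cover: "\<exists>F A. minimal_cover E Z F A" if "bounded E Z" for E Z
    using minimal_cover_exists[of E Z N] that unfolding bounded_def by metis
  have "\<exists>f. \<forall>n. P n (f n) \<and> Q n (f n) (f (Suc n))"
  proof (rule dependent_nat_choice)
    have "bounded [0] (rank_one I)" using I bound by (auto simp: bounded_def)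
    then show "\<exists>x. P 0 x" using cover by (fastforce simp: P_def)
  next
    fix x n assume "P n x"
    then obtain E Z F A where x: "x = (E, Z, F, A)" and *: "bounded E Z" "minimal_cover E Z F A"
      by (auto simp: P_def)
    have "bounded F (relations F A)"
      unfolding bounded_def
    proof (intro conjI allI impI)
      show "graded_submodule F (relations F A)"
        using * by (intro graded_submodule_relations) (auto simp: minimal_cover_def)
      show "j \<le> N" if "\<exists>C. koszul_class F (relations F A) i j C" for i j
        using * that koszul_dimension_shift[OF *(2), of i j] unfolding bounded_def by metis
    qed
    then show "\<exists>y. P (Suc n) y \<and> Q n x y" using cover by (fastforce simp: P_def Q_def x)
  qed
  then obtain f where f: "\<And>n. P n (f n)" "\<And>n. Q n (f n) (f (Suc n))" by blast
  define E where "E n = fst (f n)" for n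
  define Z where "Z n = fst (snd (f n))" for n
  define F where "F n = fst (snd (snd (f n)))" for n
  define A where "A n = snd (snd (snd (f n)))" for n
  define D where "D n = mat (length (E n)) (length (F n)) (\<lambda>(r, c). A n r c)" for n
  have cov: "minimal_cover (E n) (Z n) (F n) (A n)" for n
    using f(1)[of n] by (auto simp: P_def E_def Z_def F_def A_def split: prod.splits)
  have E0: "E 0 = [0]" and Z0: "Z 0 = rank_one I"
    using f(1)[of 0] by (auto simp: P_def E_def Z_def split: prod.splits)
  have ESuc: "E (Suc n) = F n" and ZSuc: "Z (Suc n) = relations (F n) (A n)" for n
    using f(2)[of n] by (auto simp: Q_def E_def Z_def F_def A_def split: prod.splits)
  have gr: "graded_entries (E n) (F n) (A n)"
    and im: "Z n = matrix_apply (length (F n)) (A n) ` free_module (length (F n))"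
    and const: "\<And>w c. w \<in> relations (F n) (A n) \<Longrightarrow> Poly_Mapping.lookup (w c) 0 = 0" for n
    using cov[of n] by (auto simp: minimal_cover_def)
  have ent: "entries (D n) = A n" for n unfolding D_def by (rule entries_mat[OF gr])
  have carrier: "D n \<in> carrier_mat (length (E n)) (length (F n))" for n by (simp add: D_def)
  have graded: "graded_map (F n) (E n) (D n)" for n
    using gr[of n] carrier[of n] by (auto simp: graded_map_def graded_entries_def D_def)
  have aug: "(\<lambda>w. w $ 0) ` mat_image (D 0) = I"
    using augmentation_iff_entries[of "D 0" "length (F 0)" I] carrier[of 0] im[of 0]
    by (simp add: E0 Z0 ent)
  have exact: "mat_image (D (Suc n)) = mat_kernel (D n)" for n
    using exact_iff_entries[OF carrier[of n], of "D (Suc n)"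
        "length (F (Suc n))"] carrier[of "Suc n"] im[of "Suc n"]
    by (simp add: ESuc ZSuc ent relations_def)
  have minimal: "Poly_Mapping.lookup (D (Suc n) $$ (r, c)) 0 = 0"
    if "r < length (F n)" "c < length (F (Suc n))" for n r c
  proof -
    let ?u = "\<lambda>d. if d = c then 1 else (0 :: ('v, 'k) mpoly)"
    have "matrix_apply (length (F (Suc n))) (A (Suc n)) ?u r = A (Suc n) r c"
      using that by (simp add: matrix_apply_def if_distrib sum.delta cong: if_cong)
    moreover have "?u \<in> free_module (length (F (Suc n)))" using that by (simp add: free_module_def)
    then have "matrix_apply (length (F (Suc n))) (A (Suc n)) ?u \<in> relations (F n) (A n)"
      using im[of "Suc n"] by (auto simp flip: ZSuc)
    then have "Poly_Mapping.lookup (matrix_apply (length (F (Suc n))) (A (Suc n)) ?u r) 0 = 0"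
      by (rule const)
    ultimately show ?thesis using that by (simp add: D_def ESuc)
  qed
  have "minimal_graded_free_resolution I F D"
    unfolding minimal_graded_free_resolution_def graded_free_resolution_def
    using graded[of 0] graded[of "Suc _"] aug exact minimal by (simp add: E0 ESuc)
  then show ?thesis by (rule that)
qed

theorem reg_eq_koszul:
  fixes I :: "('v::finite, 'k::field) mpoly set"
  assumes I: "graded_submodule [0] (rank_one I)"
    and bound: "\<And>i j. \<exists>C. koszul_class [0] (rank_one I) i j C \<Longrightarrow> j \<le> N"
  shows "reg I = Sup {ereal (real j - real i) | i j. \<exists>C. koszul_class [0] (rank_one I) i j C}"
proof -
  obtain F D where res: "minimal_graded_free_resolution I F D"
    by (rule minimal_resolution_exists[OF I bound])
  have "(\<exists>F D. minimal_graded_free_resolution I F D \<and> j \<in> set (F i)) \<longleftrightarrow>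
      (\<exists>C. koszul_class [0] (rank_one I) i j C)" for i j
    using res minimal_resolution_degree_iff by metis
  then show ?thesis by (simp add: reg_def)
qed

section \<open>Monomial ideals\<close>

definition monomial_ideal :: "('v \<Rightarrow>\<^sub>0 nat) set \<Rightarrow> ('v, 'k::comm_ring_1) mpoly set" where
  "monomial_ideal U = {p. Poly_Mapping.keys p \<subseteq> U}"

definition upward_closed :: "('v \<Rightarrow>\<^sub>0 nat) set \<Rightarrow> bool" where
  "upward_closed U \<longleftrightarrow> (\<forall>m\<in>U. \<forall>n. m + n \<in> U)"

lemma monomial_ideal_0: "0 \<in> monomial_ideal U"
  by (simp add: monomial_ideal_def)

lemma monomial_ideal_add: "p \<in> monomial_ideal U \<Longrightarrow> q \<in> monomial_ideal U \<Longrightarrow> p + q \<in> monomial_ideal U"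
  using keys_add[of p q] by (auto simp: monomial_ideal_def)

lemma monomial_ideal_mult:
  assumes "upward_closed U" "p \<in> monomial_ideal U"
  shows "q * p \<in> monomial_ideal U"
  unfolding monomial_ideal_def
proof clarify
  fix m assume "m \<in> Poly_Mapping.keys (q * p)"
  then obtain a b where "m = a + b" "b \<in> Poly_Mapping.keys p"
    using keys_mult[of q p] by blast
  then have "m = b + a" "b \<in> U" using assms by (auto simp: monomial_ideal_def add.commute)
  then show "m \<in> U" using assms(1) by (simp add: upward_closed_def)
qed

interpretation ring_module: Modules.module "(*) :: 'a::comm_ring_1 \<Rightarrow> 'a \<Rightarrow> 'a"
  by unfold_locales (auto simp: algebra_simps)

lemma subspace_monomial_ideal: "upward_closed U \<Longrightarrow> ring_module.subspace (monomial_ideal U)"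
  by (intro ring_module.subspaceI monomial_ideal_0 monomial_ideal_add monomial_ideal_mult)

lemma monomial_ideal_subset_span:
  fixes S :: "('v, 'k::comm_ring_1) mpoly set"
  assumes "\<And>m c. m \<in> U \<Longrightarrow> Poly_Mapping.single m c \<in> ideal_generated S"
  shows "monomial_ideal U \<subseteq> ideal_generated S"
proof
  fix p :: "('v, 'k) mpoly" assume "p \<in> monomial_ideal U"
  then have "(\<Sum>m\<in>Poly_Mapping.keys p. Poly_Mapping.single m (Poly_Mapping.lookup p m)) \<in>
      ideal_generated S"
    unfolding ideal_generated_def
    by (intro ring_module.span_sum)
      (use assms in \<open>auto simp: ideal_generated_def monomial_ideal_def\<close>)
  then show "p \<in> ideal_generated S" by (simp only: sum_single_lookup)
qed

lemma ideal_generated_monomials: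
  "ideal_generated ((\<lambda>m. Poly_Mapping.single m 1) ` M) =
    (monomial_ideal {m + n | m n. m \<in> M} :: ('v, 'k::comm_ring_1) mpoly set)"
proof
  have up: "upward_closed {m + n | m n. m \<in> M}"
    unfolding upward_closed_def
  proof clarify
    fix l m n assume "m \<in> M"
    then show "\<exists>m' n'. m + n + l = m' + n' \<and> m' \<in> M"
      by (intro exI[of _ m] exI[of _ "n + l"]) (simp add: add.assoc)
  qed
  show "ideal_generated ((\<lambda>m. Poly_Mapping.single m 1) ` M) \<subseteq>
      (monomial_ideal {m + n | m n. m \<in> M} :: ('v, 'k) mpoly set)"
    unfolding ideal_generated_def
  proof (rule ring_module.span_minimal[OF _ subspace_monomial_ideal[OF up]])
    have "m \<in> {m + n | m n. m \<in> M}" if "m \<in> M" for m using that by force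
    then show "(\<lambda>m. Poly_Mapping.single m 1) ` M \<subseteq>
        (monomial_ideal {m + n | m n. m \<in> M} :: ('v, 'k) mpoly set)"
      by (auto simp: monomial_ideal_def)
  qed
  show "(monomial_ideal {m + n | m n. m \<in> M} :: ('v, 'k) mpoly set) \<subseteq>
      ideal_generated ((\<lambda>m. Poly_Mapping.single m 1) ` M)"
  proof (rule monomial_ideal_subset_span)
    fix k and c :: 'k assume "k \<in> {m + n | m n. m \<in> M}"
    then obtain m n where k: "k = n + m" and "m \<in> M" by (auto simp: add.commute)
    then have "Poly_Mapping.single n c * Poly_Mapping.single m 1 \<in>
        (ideal_generated ((\<lambda>m. Poly_Mapping.single m 1) ` M) :: ('v, 'k) mpoly set)"
      unfolding ideal_generated_def
      by (intro ring_module.span_scale ring_module.span_base) auto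
    then show "Poly_Mapping.single k c \<in>
        (ideal_generated ((\<lambda>m. Poly_Mapping.single m 1) ` M) :: ('v, 'k) mpoly set)"
      by (simp add: mult_single k)
  qed
qed

lemma ideal_generated_products:
  assumes U: "upward_closed U"
  shows "ideal_generated {a * b | a b. a \<in> monomial_ideal U \<and> b \<in> monomial_ideal V} =
    (monomial_ideal {m + n | m n. m \<in> U \<and> n \<in> V} :: ('v, 'k::comm_ring_1) mpoly set)"
proof
  let ?W = "{m + n | m n. m \<in> U \<and> n \<in> V}"
  let ?S = "{a * b | a b. a \<in> monomial_ideal U \<and> b \<in> (monomial_ideal V :: ('v, 'k) mpoly set)}"
  have up: "upward_closed ?W"
    unfolding upward_closed_def
  proof (intro ballI allI)
    fix k l assume "k \<in> ?W"
    then obtain m n where "k = m + n" "m \<in> U" "n \<in> V" by blast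
    then have "k + l = (m + l) + n" "m + l \<in> U"
      using U by (auto simp: upward_closed_def add_ac)
    then show "k + l \<in> ?W" using \<open>n \<in> V\<close> by blast
  qed
  show "ideal_generated ?S \<subseteq> monomial_ideal ?W"
    unfolding ideal_generated_def
  proof (rule ring_module.span_minimal[OF _ subspace_monomial_ideal[OF up]])
    show "?S \<subseteq> monomial_ideal ?W"
    proof
      fix p assume "p \<in> ?S"
      then obtain a b where p: "p = a * b" and ab: "a \<in> monomial_ideal U" "b \<in> monomial_ideal V"
        by blast
      have "Poly_Mapping.keys p \<subseteq> {k + l | k l. k \<in> Poly_Mapping.keys a \<and> l \<in> Poly_Mapping.keys b}"
        unfolding p by (rule keys_mult)
      then show "p \<in> monomial_ideal ?W" using ab unfolding monomial_ideal_def by blast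
    qed
  qed
  show "monomial_ideal ?W \<subseteq> ideal_generated ?S"
  proof (rule monomial_ideal_subset_span)
    fix k and c :: 'k assume "k \<in> ?W"
    then obtain m n where k: "k = m + n" and mn: "m \<in> U" "n \<in> V" by blast
    have "Poly_Mapping.single m c * Poly_Mapping.single n 1 \<in> ?S"
      using mn by (intro CollectI exI conjI refl) (auto simp: monomial_ideal_def split: if_splits)
    then show "Poly_Mapping.single k c \<in> ideal_generated ?S"
      unfolding ideal_generated_def by (intro ring_module.span_base) (simp add: k mult_single)
  qed
qed

lemma colon_monomial_ideal:
  "colon_ideal (monomial_ideal U) (Poly_Mapping.single f 1) =
    (monomial_ideal {m. m + f \<in> U} :: ('v, 'k::comm_ring_1) mpoly set)"
proof -
  have "p * Poly_Mapping.single f 1 \<in> monomial_ideal U \<longleftrightarrow> p \<in> monomial_ideal {m. m + f \<in> U}"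
    for p :: "('v, 'k) mpoly"
  proof
    assume p: "p * Poly_Mapping.single f 1 \<in> monomial_ideal U"
    have "m + f \<in> U" if "m \<in> Poly_Mapping.keys p" for m
    proof -
      have "Poly_Mapping.lookup (Poly_Mapping.single f 1 * p) (f + m) \<noteq> 0"
        using that by (simp add: lookup_single_mult_plus in_keys_iff)
      then have "m + f \<in> Poly_Mapping.keys (p * Poly_Mapping.single f 1)"
        by (simp add: in_keys_iff mult.commute add.commute)
      then show ?thesis using p by (auto simp: monomial_ideal_def)
    qed
    then show "p \<in> monomial_ideal {m. m + f \<in> U}" by (auto simp: monomial_ideal_def)
  next
    assume p: "p \<in> monomial_ideal {m. m + f \<in> U}"
    have "Poly_Mapping.keys (p * Poly_Mapping.single f 1) \<subseteq>
        {a + b | a b. a \<in> Poly_Mapping.keys p \<and>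
            b \<in> Poly_Mapping.keys (Poly_Mapping.single f (1::'k))}"
      by (rule keys_mult)
    then show "p * Poly_Mapping.single f 1 \<in> monomial_ideal U"
      using p by (fastforce simp: monomial_ideal_def)
  qed
  then show ?thesis by (auto simp: colon_ideal_def)
qed

lemma graded_submodule_monomial_ideal:
  assumes "upward_closed U"
  shows "graded_submodule [0]
      (rank_one (monomial_ideal U :: ('v::finite, 'k::comm_ring_1) mpoly set))"
  unfolding graded_submodule_def
proof (intro conjI ballI allI)
  show "poly_vec.subspace (rank_one (monomial_ideal U :: ('v, 'k) mpoly set))"
    by (rule poly_vec.subspaceI)
       (auto simp: rank_one_def free_module_def intro: monomial_ideal_0 monomial_ideal_add
           monomial_ideal_mult[OF assms])
  show "rank_one (monomial_ideal U) \<subseteq> free_module (length [0 :: nat])"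
    by (auto simp: rank_one_def)
  show "component [0] j w \<in> rank_one (monomial_ideal U)"
      if "w \<in> rank_one (monomial_ideal U :: ('v, 'k) mpoly set)" for w j
    using that
    by (auto simp: rank_one_def component_free_module)
      (auto simp: monomial_ideal_def component_def keys_homogeneous_part)
qed

section \<open>Hochster's formula\<close>

definition squarefree_ideal :: "('v \<times> 'v) set \<Rightarrow> ('v, 'k::comm_ring_1) mpoly set" where
  "squarefree_ideal E = monomial_ideal {m. spans_edge E (Poly_Mapping.keys m)}"

text \<open>
  The upper Koszul simplicial complex of the edge ideal in multidegree \<open>b\<close>.
\<close>

definition multidegree_complex :: "('v \<times> 'v) set \<Rightarrow> ('v::finite \<Rightarrow>\<^sub>0 nat) \<Rightarrow> 'v set set" where
  "multidegree_complex E b = {\<tau>. \<tau> \<subseteq> Poly_Mapping.keys b \<and>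
      spans_edge E (Poly_Mapping.keys (b - squarefree_monomial \<tau>))}"

lemma koszul_chain_squarefree_ideal_iff:
  fixes C :: "'v::finite set \<Rightarrow> nat \<Rightarrow> ('v, 'k::comm_ring_1) mpoly"
  shows "koszul_chain [0] (rank_one (squarefree_ideal E)) i j C \<longleftrightarrow>
    (\<forall>r b. strand C r b \<noteq> 0 \<longrightarrow> r = 0 \<and> monomial_deg b = j) \<and>
    (\<forall>b. chain_on (multidegree_complex E b) i (strand C 0 b))" (is "?L \<longleftrightarrow> ?R")
proof -
  have "?L \<longleftrightarrow> koszul_chain [0] (free_module 1) i j C \<and> (\<forall>\<tau>. C \<tau> 0 \<in> squarefree_ideal E)"
    by (auto simp: koszul_chain_def rank_one_def)
  also have "(\<forall>\<tau>. C \<tau> 0 \<in> squarefree_ideal E) \<longleftrightarrow>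
      (\<forall>b \<tau>. strand C 0 b \<tau> \<noteq> 0 \<longrightarrow> \<tau> \<in> multidegree_complex E b)"
  proof (intro iffI allI impI)
    fix b \<tau> assume *: "\<forall>\<tau>. C \<tau> 0 \<in> squarefree_ideal E" "strand C 0 b \<tau> \<noteq> 0"
    then have "\<tau> \<subseteq> Poly_Mapping.keys b" "b - squarefree_monomial \<tau> \<in> Poly_Mapping.keys (C \<tau> 0)"
      by (auto simp: strand_def in_keys_iff split: if_splits)
    then show "\<tau> \<in> multidegree_complex E b"
      using *(1) by (auto simp: multidegree_complex_def squarefree_ideal_def monomial_ideal_def)
  next
    fix \<tau> assume *: "\<forall>b \<tau>. strand C 0 b \<tau> \<noteq> 0 \<longrightarrow> \<tau> \<in> multidegree_complex E b"
    show "C \<tau> 0 \<in> squarefree_ideal E"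
      unfolding squarefree_ideal_def monomial_ideal_def
    proof clarify
      fix m assume "m \<in> Poly_Mapping.keys (C \<tau> 0)"
      then have "strand C 0 (m + squarefree_monomial \<tau>) \<tau> \<noteq> 0"
        by (simp add: in_keys_iff lookup_eq_strand)
      then have "\<tau> \<in> multidegree_complex E (m + squarefree_monomial \<tau>)" using * by blast
      then show "spans_edge E (Poly_Mapping.keys m)" by (simp add: multidegree_complex_def)
    qed
  qed
  also have "koszul_chain [0] (free_module 1) i j C \<and> \<dots> \<longleftrightarrow> ?R"
    unfolding koszul_chain_iff_strand chain_on_def fun_eq_iff by fastforce
  finally show ?thesis .
qed

lemma koszul_class_squarefree_ideal_iff_multidegree:
  "(\<exists>C. koszul_class [0] (rank_one
      (squarefree_ideal E :: ('v::finite, 'k::comm_ring_1) mpoly set)) i j C) \<longleftrightarrow>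
    (\<exists>b (c :: 'v set \<Rightarrow> 'k). monomial_deg b = j \<and> essential_cycle (multidegree_complex E b) i c)"
proof
  let ?Z = "rank_one (squarefree_ideal E :: ('v, 'k) mpoly set)"
  {
    assume "\<exists>C. koszul_class [0] ?Z i j C"
    then obtain C where C: "koszul_chain [0] ?Z i j C" "koszul_boundary C = 0"
      and ess: "\<And>D. koszul_chain [0] ?Z (Suc i) j D \<Longrightarrow> koszul_boundary D \<noteq> C"
      by (auto simp: koszul_class_def)
    show "\<exists>b (c :: 'v set \<Rightarrow> 'k). monomial_deg b = j \<and> essential_cycle (multidegree_complex E b) i c"
    proof (rule ccontr)
      assume none: "\<not> ?thesis"
      have "\<exists>d. chain_on (multidegree_complex E b) (Suc i) d \<and> boundary d = strand C 0 b \<and>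
          (strand C 0 b = 0 \<longrightarrow> d = 0)" for b
      proof (cases "strand C 0 b = 0")
        case True
        then show ?thesis by (intro exI[of _ 0]) (simp add: chain_on_def)
      next
        case False
        then have "monomial_deg b = j" "chain_on (multidegree_complex E b) i (strand C 0 b)"
          using C(1) unfolding koszul_chain_squarefree_ideal_iff by blast+
        moreover have "boundary (strand C 0 b) = 0"
          using C(2) by (simp flip: strand_koszul_boundary)
        ultimately show ?thesis using none False unfolding essential_cycle_def by blast
      qed
      then have "\<exists>d. \<forall>b. chain_on (multidegree_complex E b) (Suc i) (d b) \<and>
          boundary (d b) = strand C 0 b \<and> (strand C 0 b = 0 \<longrightarrow> d b = 0)"
        by (intro choice allI)
      then obtain d where d: "\<And>b. chain_on (multidegree_complex E b) (Suc i) (d b)"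
        "\<And>b. boundary (d b) = strand C 0 b" "\<And>b. strand C 0 b = 0 \<Longrightarrow> d b = 0" by blast
      have "\<exists>D. \<forall>r b. strand D r b = (if r = 0 then d b else 0)"
      proof (rule strand_exists[of "\<lambda>r b. if r = 0 then d b else 0"])
        show "\<tau> \<subseteq> Poly_Mapping.keys b" if "(if r = 0 then d b else 0) \<tau> \<noteq> 0" for r :: nat and b \<tau>
          using that d(1)[of b] by (auto simp: chain_on_def multidegree_complex_def
              split: if_splits)
        show "finite {b. (if r = 0 then d b else 0) \<noteq> 0}" for r :: nat
          by (rule finite_subset[OF _ finite_strand_support[of C 0]])
            (use d(3) in \<open>auto split: if_splits\<close>)
      qed blast
      then obtain D where D: "\<And>r b. strand D r b = (if r = 0 then d b else 0)" by blast
      have "koszul_chain [0] ?Z (Suc i) j D"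
        unfolding koszul_chain_squarefree_ideal_iff D
      proof (intro conjI allI impI)
        fix r b assume "(if r = 0 then d b else 0) \<noteq> 0"
        then show "r = 0" "monomial_deg b = j"
          using d(3)[of b] C(1) unfolding koszul_chain_squarefree_ideal_iff
          by (auto split: if_splits)
      qed (use d(1) in simp)
      moreover have "koszul_boundary D = C"
      proof (rule strand_ext)
        fix r b
        show "strand (koszul_boundary D) r b = strand C r b"
        proof (cases "r = 0")
          case False
          then have "strand C r b = 0" using C(1) unfolding koszul_chain_squarefree_ideal_iff
            by blast
          then show ?thesis using False by (simp add: strand_koszul_boundary D)
        qed (simp add: strand_koszul_boundary D d(2))
      qed
      ultimately show False using ess by blast
    qed
  next
    assume "\<exists>b (c :: 'v set \<Rightarrow> 'k). monomial_deg b = j \<and>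
        essential_cycle (multidegree_complex E b) i c"
    then obtain b and c :: "'v set \<Rightarrow> 'k" where b: "monomial_deg b = j"
      and c: "chain_on (multidegree_complex E b) i c" "boundary c = 0"
      and ess: "\<And>d. chain_on (multidegree_complex E b) (Suc i) d \<Longrightarrow> boundary d \<noteq> c"
      by (auto simp: essential_cycle_def)
    have "\<exists>C. \<forall>r b'. strand C r b' = (if r = 0 \<and> b' = b then c else 0)"
    proof (rule strand_exists[of "\<lambda>r b'. if r = 0 \<and> b' = b then c else 0"])
      show "\<tau> \<subseteq> Poly_Mapping.keys b'" if "(if r = 0 \<and> b' = b then c else 0) \<tau> \<noteq> 0"
          for r :: nat and b' \<tau>
        using that c(1) by (auto simp: chain_on_def multidegree_complex_def split: if_splits)
      show "finite {b'. (if r = 0 \<and> b' = b then c else 0) \<noteq> 0}" for r :: nat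
        by (rule finite_subset[of _ "{b}"]) auto
    qed blast
    then obtain C where C: "\<And>r b'. strand C r b' = (if r = 0 \<and> b' = b then c else 0)" by blast
    have "koszul_class [0] ?Z i j C"
      unfolding koszul_class_def
    proof (intro conjI notI)
      show "koszul_chain [0] ?Z i j C"
        unfolding koszul_chain_squarefree_ideal_iff C using b c(1) by (auto simp: chain_on_def)
      show "koszul_boundary C = 0"
        by (rule strand_ext) (simp add: strand_koszul_boundary C c(2))
      assume "\<exists>D. koszul_chain [0] ?Z (Suc i) j D \<and> koszul_boundary D = C"
      then obtain D where D: "koszul_chain [0] ?Z (Suc i) j D" "koszul_boundary D = C" by blast
      have "boundary (strand D 0 b) = strand C 0 b"
        using D(2) by (simp flip: strand_koszul_boundary)
      then have "boundary (strand D 0 b) = c" by (simp add: C)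
      moreover have "chain_on (multidegree_complex E b) (Suc i) (strand D 0 b)"
        using D(1) unfolding koszul_chain_squarefree_ideal_iff by blast
      ultimately show False using ess by blast
    qed
    then show "\<exists>C. koszul_class [0] ?Z i j C" by blast
  }
qed

lemma multidegree_complex_squarefree: "multidegree_complex E (squarefree_monomial W) =
    dual_complex E W"
proof -
  have "Poly_Mapping.keys (squarefree_monomial W - squarefree_monomial \<tau>) = W - \<tau>" for \<tau>
    by (auto simp: in_keys_iff lookup_minus lookup_squarefree_monomial split: if_splits)
  then show ?thesis by (simp add: multidegree_complex_def dual_complex_def)
qed

text \<open>
  If \<open>v\<close> occurs twice in the multidegree, dividing by \<open>v\<close> once does not change the support, and
  membership in a squarefree ideal depends only on the support; so the complex is a cone over \<open>v\<close>.
\<close>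

lemma multidegree_complex_acyclic:
  assumes "Poly_Mapping.lookup b v > 1"
  shows "\<not> essential_cycle (multidegree_complex E b) i c"
proof (rule cone_acyclic[where v = v])
  fix \<tau> assume \<tau>: "\<tau> \<in> multidegree_complex E b" "v \<notin> \<tau>"
  have "Poly_Mapping.keys (b - squarefree_monomial \<tau>) \<subseteq>
      Poly_Mapping.keys (b - squarefree_monomial (insert v \<tau>))"
    using assms by (auto simp: in_keys_iff lookup_minus lookup_squarefree_monomial)
  then show "insert v \<tau> \<in> multidegree_complex E b"
    using \<tau> assms by (auto simp: multidegree_complex_def in_keys_iff elim: spans_edge_mono)
qed

theorem koszul_class_squarefree_ideal_iff:
  "(\<exists>C. koszul_class [0] (rank_one
      (squarefree_ideal E :: ('v::finite, 'k::comm_ring_1) mpoly set)) i j C) \<longleftrightarrow>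
    (\<exists>W (c :: 'v set \<Rightarrow> 'k). card W = j \<and> essential_cycle (dual_complex E W) i c)"
  unfolding koszul_class_squarefree_ideal_iff_multidegree
proof
  assume "\<exists>b (c :: 'v set \<Rightarrow> 'k). monomial_deg b = j \<and> essential_cycle (multidegree_complex E b) i c"
  then obtain b and c :: "'v set \<Rightarrow> 'k" where b: "monomial_deg b = j"
      "essential_cycle (multidegree_complex E b) i c" by blast
  have le: "Poly_Mapping.lookup b v \<le> 1" for v
    using multidegree_complex_acyclic[of b v E i c] b(2) by linarith
  have "b = squarefree_monomial (Poly_Mapping.keys b)"
  proof (rule poly_mapping_eqI)
    show "Poly_Mapping.lookup b v =
        Poly_Mapping.lookup (squarefree_monomial (Poly_Mapping.keys b)) v" for v
      using le[of v] by (auto simp: lookup_squarefree_monomial in_keys_iff)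
  qed
  then show "\<exists>W (c :: 'v set \<Rightarrow> 'k). card W = j \<and> essential_cycle (dual_complex E W) i c"
    using b multidegree_complex_squarefree monomial_deg_squarefree_monomial by metis
next
  assume "\<exists>W (c :: 'v set \<Rightarrow> 'k). card W = j \<and> essential_cycle (dual_complex E W) i c"
  then show "\<exists>b (c :: 'v set \<Rightarrow> 'k). monomial_deg b = j \<and>
      essential_cycle (multidegree_complex E b) i c"
    using multidegree_complex_squarefree monomial_deg_squarefree_monomial by metis
qed

text \<open>
  The classes sit in internal degrees \<open>card W\<close>, which are at most the number of variables; this is the
  bound on the degrees that the existence of a minimal resolution requires.
\<close>

theorem reg_squarefree_ideal:
  "reg (squarefree_ideal E :: ('v::finite, 'k::field) mpoly set) =
    Sup {ereal (real (card W) - real i) | W i.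
      \<exists>c :: 'v set \<Rightarrow> 'k. essential_cycle (dual_complex E W) i c}"
proof -
  have "upward_closed {m. spans_edge E (Poly_Mapping.keys m)}"
    unfolding upward_closed_def
  proof clarify
    fix m n :: "'v \<Rightarrow>\<^sub>0 nat" assume "spans_edge E (Poly_Mapping.keys m)"
    then show "spans_edge E (Poly_Mapping.keys (m + n))"
      by (rule spans_edge_mono) (auto simp: in_keys_iff lookup_add)
  qed
  then have graded: "graded_submodule [0] (rank_one (squarefree_ideal E :: ('v, 'k) mpoly set))"
    unfolding squarefree_ideal_def by (rule graded_submodule_monomial_ideal)
  have "j \<le> card (UNIV :: 'v set)"
      if "\<exists>C. koszul_class [0] (rank_one (squarefree_ideal E :: ('v, 'k) mpoly set)) i j C" for i j
    using that unfolding koszul_class_squarefree_ideal_iff by (auto intro: card_mono)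
  from reg_eq_koszul[OF graded this] show ?thesis
    unfolding koszul_class_squarefree_ideal_iff by (auto intro!: arg_cong[where f = Sup])
qed

section \<open>Colon ideals of powers of edge ideals\<close>

definition edge_exponent :: "'v \<times> 'v \<Rightarrow> 'v \<Rightarrow>\<^sub>0 nat" where
  "edge_exponent e = Poly_Mapping.single (fst e) 1 + Poly_Mapping.single (snd e) 1"

text \<open>
  The exponents of the monomials in the \<open>t\<close>-th power of the edge ideal.
\<close>

fun edge_multiples :: "('v \<times> 'v) set \<Rightarrow> nat \<Rightarrow> ('v \<Rightarrow>\<^sub>0 nat) set" where
  "edge_multiples E 0 = UNIV"
| "edge_multiples E (Suc t) = {edge_exponent e + n | e n. e \<in> E \<and> n \<in> edge_multiples E t}"

lemma edge_multiples_add: "m \<in> edge_multiples E t \<Longrightarrow> m + n \<in> edge_multiples E t"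
proof (induction t arbitrary: m)
  case (Suc t)
  then obtain e k where "m = edge_exponent e + k" "e \<in> E" "k \<in> edge_multiples E t" by auto
  then have "m + n = edge_exponent e + (k + n)" "k + n \<in> edge_multiples E t"
    using Suc.IH by (auto simp: add.assoc)
  then show ?case using \<open>e \<in> E\<close> unfolding edge_multiples.simps by blast
qed simp

lemma upward_closed_edge_multiples: "upward_closed (edge_multiples E t)"
  by (simp add: upward_closed_def edge_multiples_add)

lemma edge_multiples_add_edge: "e \<in> E \<Longrightarrow> m \<in> edge_multiples E t \<Longrightarrow>
    edge_exponent e + m \<in> edge_multiples E (Suc t)"
  unfolding edge_multiples.simps by blast

lemma edge_ideal_eq_monomial_ideal:
  assumes edges: "edges G = (\<lambda>(a, b). {a, b}) ` E" and loopless: "\<And>a b. (a, b) \<in> E \<Longrightarrow> a \<noteq> b"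
  shows "edge_ideal G = (monomial_ideal (edge_multiples E 1) :: ('v, 'k::comm_ring_1) mpoly set)"
proof -
  have "edge_monomial {a, b} = (Poly_Mapping.single (edge_exponent (a, b)) 1 :: ('v, 'k) mpoly)"
      if "(a, b) \<in> E" for a b
    using loopless[OF that] by (simp add: edge_monomial_def Var_def mult_single edge_exponent_def)
  then have "edge_monomial ` edges G = (\<lambda>m. Poly_Mapping.single m (1::'k)) ` edge_exponent ` E"
    unfolding edges image_image by (intro image_cong) auto
  then have "edge_ideal G =
      (monomial_ideal {m + n | m n. m \<in> edge_exponent ` E} :: ('v, 'k) mpoly set)"
    by (simp only: edge_ideal_def ideal_generated_monomials)
  also have "{m + n | m n. m \<in> edge_exponent ` E} = edge_multiples E 1" by auto
  finally show ?thesis .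
qed

lemma ideal_power_monomial_ideal:
  "ideal_power (monomial_ideal (edge_multiples E 1)) t =
    (monomial_ideal (edge_multiples E t) :: ('v, 'k::comm_ring_1) mpoly set)"
proof (induction t)
  case 0
  show ?case by (simp add: monomial_ideal_def)
next
  case (Suc t)
  have "{m + n | m n. m \<in> edge_multiples E 1 \<and> n \<in> edge_multiples E t} = edge_multiples E (Suc t)"
  proof
    show "{m + n | m n. m \<in> edge_multiples E 1 \<and> n \<in> edge_multiples E t} \<subseteq> edge_multiples E (Suc t)"
    proof clarify
      fix m n assume "m \<in> edge_multiples E 1" and n: "n \<in> edge_multiples E t"
      then obtain e k where e: "m = edge_exponent e + k" "e \<in> E" by auto
      have "n + k \<in> edge_multiples E t" by (rule edge_multiples_add[OF n])
      then have "edge_exponent e + (n + k) \<in> edge_multiples E (Suc t)"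
        by (rule edge_multiples_add_edge[OF e(2)])
      then show "m + n \<in> edge_multiples E (Suc t)" by (simp add: e(1) add_ac)
    qed
    show "edge_multiples E (Suc t) \<subseteq> {m + n | m n. m \<in> edge_multiples E 1 \<and> n \<in> edge_multiples E t}"
    proof
      fix k assume "k \<in> edge_multiples E (Suc t)"
      then obtain e n where "k = edge_exponent e + n" "e \<in> E" "n \<in> edge_multiples E t" by auto
      moreover have "edge_exponent e \<in> edge_multiples E 1"
        using edge_multiples_add_edge[OF \<open>e \<in> E\<close>, of 0 0] by simp
      ultimately show "k \<in> {m + n | m n. m \<in> edge_multiples E 1 \<and> n \<in> edge_multiples E t}" by blast
    qed
  qed
  then show ?case
    by (simp only: ideal_power.simps Suc.IH
      ideal_generated_products[OF upward_closed_edge_multiples])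
qed

definition covers :: "('v \<times> 'v) set \<Rightarrow> 'v set \<Rightarrow> bool" where
  "covers E C \<longleftrightarrow> (\<forall>(a, b)\<in>E. a \<in> C \<or> b \<in> C)"

text \<open>
  A vertex cover is sparse on edges of the graph iff it contains exactly one end of each of them.
\<close>

definition sparse_on :: "('v \<times> 'v) list \<Rightarrow> 'v set \<Rightarrow> bool" where
  "sparse_on es C \<longleftrightarrow> (\<forall>(a, b)\<in>set es. \<not> (a \<in> C \<and> b \<in> C))"

definition weight :: "'v set \<Rightarrow> ('v::finite \<Rightarrow>\<^sub>0 nat) \<Rightarrow> nat" where
  "weight C m = (\<Sum>v\<in>C. Poly_Mapping.lookup m v)"

lemma weight_add: "weight C (m + n) = weight C m + weight C n"
  by (simp add: weight_def lookup_add sum.distrib)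

lemma weight_edge_exponent: "weight C (edge_exponent (a, b)) =
    (if a \<in> C then 1 else 0) + (if b \<in> C then 1 else 0)"
  by (simp add: edge_exponent_def weight_add) (simp add: weight_def lookup_single when_def)

lemma weight_edge_multiples:
  assumes "covers E C" "m \<in> edge_multiples E t"
  shows "t \<le> weight C m"
  using assms(2)
proof (induction t arbitrary: m)
  case (Suc t)
  then obtain a b n where m: "m = edge_exponent (a, b) + n" "(a, b) \<in> E" "n \<in> edge_multiples E t"
    by auto
  have "1 \<le> weight C (edge_exponent (a, b))"
    using assms(1) m(2) by (auto simp: weight_edge_exponent covers_def)
  then show ?case using Suc.IH[OF m(3)] by (simp add: m(1) weight_add)
qed simp

text \<open>
  The walk \<open>a, y\<^sub>1, x\<^sub>1, y\<^sub>2, x\<^sub>2, \<dots>, b\<close> in which the steps from \<open>A\<close> to \<open>B\<close> are arbitrary edges and each step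
  back from \<open>y\<^sub>l\<close> to \<open>x\<^sub>l\<close> runs along an edge \<open>(x\<^sub>l, y\<^sub>l)\<close> of the list \<open>es\<close>, given by its index.
\<close>

fun alternating_walk :: "('v \<times> 'v) set \<Rightarrow> ('v \<times> 'v) list \<Rightarrow> 'v \<Rightarrow> nat list \<Rightarrow> 'v \<Rightarrow> bool" where
  "alternating_walk E es a [] b \<longleftrightarrow> (a, b) \<in> E"
| "alternating_walk E es a (j # js) b \<longleftrightarrow>
     j < length es \<and> (a, snd (es ! j)) \<in> E \<and> alternating_walk E es (fst (es ! j)) js b"

lemma alternating_walk_append:
  "alternating_walk E es a (xs @ j # ys) b \<longleftrightarrow>
    alternating_walk E es a xs (snd (es ! j)) \<and> j < length es \<and> alternating_walk E es
        (fst (es ! j)) ys b"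
  by (induction xs arbitrary: a) auto

text \<open>
  Between two uses of the same list entry the walk returns to the same vertex, so the closed part
  can be cut out. This matters because the product of the list pays for each entry only once.
\<close>

lemma alternating_walk_distinct:
  "alternating_walk E es a js b \<Longrightarrow> \<exists>js'. distinct js' \<and> alternating_walk E es a js' b"
proof (induction "length js" arbitrary: js rule: less_induct)
  case less
  show ?case
  proof (cases "distinct js")
    case False
    then obtain xs ys zs j where js: "js = xs @ [j] @ ys @ [j] @ zs" using not_distinct_decomp
      by blast
    have "alternating_walk E es a ((xs @ j # ys) @ j # zs) b" using less.prems by (simp add: js)
    then have "alternating_walk E es a (xs @ j # zs) b"
      unfolding alternating_walk_append by blast
    then show ?thesis by (intro less.hyps[of "xs @ j # zs"]) (simp_all add: js)
  qed (use less.prems in blast)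
qed

lemma alternating_walk_indices: "alternating_walk E es a js b \<Longrightarrow> j \<in> set js \<Longrightarrow> j < length es"
  by (induction js arbitrary: a) auto

lemma alternating_walk_ends:
  "alternating_walk E es a js b \<Longrightarrow> \<exists>a'. (a', b) \<in> E"
  by (induction js arbitrary: a) auto

lemma alternating_walk_multiples:
  "alternating_walk E es a js b \<Longrightarrow>
    edge_exponent (a, b) + (\<Sum>j\<leftarrow>js. edge_exponent (es ! j)) \<in> edge_multiples E (Suc (length js))"
proof (induction js arbitrary: a)
  case Nil
  then show ?case using edge_multiples_add_edge[of "(a, b)" E 0 0] by simp
next
  case (Cons j js)
  define x y where "x = fst (es ! j)" "y = snd (es ! j)"
  have "edge_exponent (x, b) + (\<Sum>j\<leftarrow>js. edge_exponent (es ! j)) \<in> edge_multiples E (Suc (length js))"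
    using Cons by (simp add: x_y_def)
  moreover have "(a, y) \<in> E" using Cons.prems by (simp add: x_y_def)
  ultimately have "edge_exponent (a, y) + (edge_exponent (x, b) + (\<Sum>j\<leftarrow>js. edge_exponent (es ! j)))
      \<in> edge_multiples E (Suc (Suc (length js)))" by (rule edge_multiples_add_edge[rotated])
  moreover have "edge_exponent (a, y) + (edge_exponent (x, b) + (\<Sum>j\<leftarrow>js. edge_exponent (es ! j))) =
      edge_exponent (a, b) + (\<Sum>j\<leftarrow>j # js. edge_exponent (es ! j))"
    by (simp add: edge_exponent_def x_y_def add_ac)
  ultimately show ?case by simp
qed

lemma edge_multiples_add_sum:
  assumes "finite J" "\<And>j. j \<in> J \<Longrightarrow> f j \<in> E" "m \<in> edge_multiples E t"
  shows "m + (\<Sum>j\<in>J. edge_exponent (f j)) \<in> edge_multiples E (t + card J)"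
  using assms
proof (induction J rule: finite_induct)
  case (insert j J)
  then have "edge_exponent (f j) +
      (m + (\<Sum>j\<in>J. edge_exponent (f j))) \<in> edge_multiples E (Suc (t + card J))"
    by (intro edge_multiples_add_edge) auto
  then show ?case using insert.hyps by (simp add: add_ac)
qed simp

text \<open>
  Along the walk, \<open>a b\<close> times the list entries used equals the product of the edges traversed from \<open>A\<close>
  to \<open>B\<close>, which has one more factor than the number of entries used.
\<close>

lemma augmenting_walk:
  assumes es: "set es \<subseteq> E" and walk: "alternating_walk E es a js b"
    and ab: "a \<noteq> b" "a \<in> Poly_Mapping.keys m" "b \<in> Poly_Mapping.keys m"
  shows "m + (\<Sum>e\<leftarrow>es. edge_exponent e) \<in> edge_multiples E (Suc (length es))"
proof -
  obtain ks where ks: "distinct ks" "alternating_walk E es a ks b"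
    using alternating_walk_distinct[OF walk] by blast
  have sub: "set ks \<subseteq> {..<length es}" using alternating_walk_indices[OF ks(2)] by auto
  define m' where "m' = m - edge_exponent (a, b)"
  have m: "m = edge_exponent (a, b) + m'"
    using ab by (intro poly_mapping_eqI)
      (auto simp: m'_def edge_exponent_def lookup_add lookup_minus lookup_single in_keys_iff
          when_def)
  define n where "n = edge_exponent (a, b) + (\<Sum>j\<in>set ks. edge_exponent (es ! j))"
  have "n \<in> edge_multiples E (Suc (length ks))"
    using alternating_walk_multiples[OF ks(2)] ks(1)
    by (simp add: n_def sum_list_distinct_conv_sum_set)
  then have "n + (\<Sum>j\<in>{..<length es} - set ks. edge_exponent (es ! j)) \<in>
      edge_multiples E (Suc (length ks) + card ({..<length es} - set ks))"
    by (intro edge_multiples_add_sum) (use es in auto)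
  moreover have "Suc (length ks) + card ({..<length es} - set ks) = Suc (length es)"
    using sub ks(1) card_mono[OF _ sub] by (simp add: card_Diff_subset distinct_card)
  moreover have "n + (\<Sum>j\<in>{..<length es} - set ks. edge_exponent (es ! j)) + m' =
      m + (\<Sum>e\<leftarrow>es. edge_exponent e)"
  proof -
    have "(\<Sum>e\<leftarrow>es. edge_exponent e) = (\<Sum>j\<in>{..<length es}. edge_exponent (es ! j))"
      by (simp add: sum_list_sum_nth atLeast0LessThan)
    also have "\<dots> = (\<Sum>j\<in>{..<length es} - set ks. edge_exponent (es ! j)) +
        (\<Sum>j\<in>set ks. edge_exponent (es ! j))"
      by (rule sum.subset_diff[OF sub]) simp
    finally show ?thesis by (simp add: n_def m add_ac)
  qed
  ultimately show ?thesis using edge_multiples_add by metis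
qed

text \<open>
  Weighted Koenig duality at a matching that falls short by one. A sparse cover disjoint from the
  support of \<open>m\<close> gives the product weight at most \<open>length es\<close>, while \<open>length es + 1\<close> edges
  need at least one unit more. If there is no augmenting walk, the vertices of \<open>A\<close> that cannot be
  reached from the support of \<open>m\<close> form such a cover together with the vertices of \<open>B\<close> that can.
\<close>

lemma koenig_edge_multiples:
  assumes E: "E \<subseteq> A \<times> B" "A \<inter> B = {}" and es: "set es \<subseteq> E"
  shows "m + (\<Sum>e\<leftarrow>es. edge_exponent e) \<in> edge_multiples E (Suc (length es)) \<longleftrightarrow>
    (\<forall>C. covers E C \<and> sparse_on es C \<longrightarrow> C \<inter> Poly_Mapping.keys (m :: 'v::finite \<Rightarrow>\<^sub>0 nat) \<noteq> {})"
proof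
  assume mult: "m + (\<Sum>e\<leftarrow>es. edge_exponent e) \<in> edge_multiples E (Suc (length es))"
  show "\<forall>C. covers E C \<and> sparse_on es C \<longrightarrow> C \<inter> Poly_Mapping.keys m \<noteq> {}"
  proof (intro allI impI notI)
    fix C assume C: "covers E C \<and> sparse_on es C" and disj: "C \<inter> Poly_Mapping.keys m = {}"
    have "weight C m = 0" using disj by (auto simp: weight_def in_keys_iff)
    moreover have "weight C (\<Sum>e\<leftarrow>es. edge_exponent e) \<le> length es"
    proof -
      have "sparse_on es C" using C by blast
      then show ?thesis
      proof (induction es)
        case Nil
        then show ?case by (simp add: weight_def)
      next
        case (Cons e es)
        then show ?case by (cases e) (auto simp: weight_add weight_edge_exponent sparse_on_def)
      qed
    qed
    moreover have "Suc (length es) \<le> weight C (m + (\<Sum>e\<leftarrow>es. edge_exponent e))"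
      using weight_edge_multiples C mult by blast
    ultimately show False by (simp add: weight_add)
  qed
next
  assume meets: "\<forall>C. covers E C \<and> sparse_on es C \<longrightarrow> C \<inter> Poly_Mapping.keys m \<noteq> {}"
  show "m + (\<Sum>e\<leftarrow>es. edge_exponent e) \<in> edge_multiples E (Suc (length es))"
  proof (rule ccontr)
    assume no: "\<not> ?thesis"
    \<comment> \<open>The sets L and R consist of the vertices of A and of B reached from the support of m.\<close>
    define R where "R = {b. \<exists>a js. a \<in> A \<and> a \<in> Poly_Mapping.keys m \<and> alternating_walk E es a js b}"
    define L where "L = {a \<in> A. a \<in> Poly_Mapping.keys m \<or>
        (\<exists>j<length es. a = fst (es ! j) \<and> snd (es ! j) \<in> R)}"
    have RB: "R \<subseteq> B"
      using alternating_walk_ends[of E es] E(1) by (auto simp: R_def)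
    have closed: "b \<in> R" if "(a, b) \<in> E" "a \<in> L" for a b
    proof -
      have "a \<in> Poly_Mapping.keys m \<or> (\<exists>j<length es. a = fst (es ! j) \<and> snd (es ! j) \<in> R)"
          and "a \<in> A"
        using that(2) by (auto simp: L_def)
      then show ?thesis
      proof (elim disjE exE conjE)
        assume "a \<in> Poly_Mapping.keys m"
        then show ?thesis unfolding R_def using that(1) \<open>a \<in> A\<close>
          by (auto intro!: exI[of _ a] exI[of _ "[]"])
      next
        fix j assume j: "j < length es" "a = fst (es ! j)" "snd (es ! j) \<in> R"
        then obtain a' js where a': "a' \<in> A" "a' \<in> Poly_Mapping.keys m"
            "alternating_walk E es a' js (snd (es ! j))"
          by (auto simp: R_def)
        have "alternating_walk E es a' (js @ j # []) b"
          unfolding alternating_walk_append using a' j that(1) by simp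
        then show ?thesis unfolding R_def using a' by blast
      qed
    qed
    define C where "C = (A - L) \<union> R"
    have "covers E C"
      unfolding covers_def C_def using closed E(1) by auto
    moreover have "sparse_on es C"
      unfolding sparse_on_def
    proof clarify
      fix a b assume ab: "(a, b) \<in> set es" "a \<in> C" "b \<in> C"
      then have "a \<in> A" "b \<in> B" using es E(1) by auto
      then have "a \<notin> L" "b \<in> R" using ab RB E(2) by (auto simp: C_def)
      moreover obtain j where "j < length es" "es ! j = (a, b)" using ab(1)
        by (metis in_set_conv_nth)
      ultimately show False using \<open>a \<in> A\<close> by (force simp: L_def)
    qed
    ultimately obtain v where v: "v \<in> C" "v \<in> Poly_Mapping.keys m" using meets by blast
    then have "v \<in> R" by (auto simp: C_def L_def)
    then obtain a js where a: "a \<in> A" "a \<in> Poly_Mapping.keys m" "alternating_walk E es a js v"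
      by (auto simp: R_def)
    have "a \<noteq> v" using a(1) \<open>v \<in> R\<close> RB E(2) by auto
    from augmenting_walk[OF es a(3) this a(2) v(2)] show False using no by simp
  qed
qed

fun join_all :: "('v \<times> 'v) set \<Rightarrow> ('v \<times> 'v) list \<Rightarrow> ('v \<times> 'v) set" where
  "join_all E [] = E"
| "join_all E (e # es) = join_all (join_neighbours E e) es"

lemma join_neighbours_bipartite:
  "E \<subseteq> A \<times> B \<Longrightarrow> join_neighbours E e \<subseteq> A \<times> B"
  by (auto simp: join_neighbours_def)

text \<open>
  A sparse cover omits \<open>x\<close> or \<open>y\<close>, hence contains all neighbours of one of them and covers the new
  edges. Conversely, a cover of the joined graph contains all neighbours of \<open>x\<close> or all
  neighbours of \<open>y\<close>; if it contains both \<open>x\<close> and \<open>y\<close>, that one can be removed.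
\<close>

lemma sparse_covers_join_neighbours:
  assumes E: "E \<subseteq> A \<times> B" "A \<inter> B = {}" and xy: "(x, y) \<in> E"
  shows "(\<forall>C. covers E C \<and> sparse_on ((x, y) # es) C \<longrightarrow> C \<inter> S \<noteq> {}) \<longleftrightarrow>
    (\<forall>C. covers (join_neighbours E (x, y)) C \<and> sparse_on es C \<longrightarrow> C \<inter> S \<noteq> {})"
proof (intro iffI allI impI)
  fix C assume meets: "\<forall>C. covers E C \<and> sparse_on ((x, y) # es) C \<longrightarrow> C \<inter> S \<noteq> {}"
    and C: "covers (join_neighbours E (x, y)) C \<and> sparse_on es C"
  have cover: "covers E C" using C by (auto simp: covers_def join_neighbours_def)
  have sparse: "sparse_on es (C - {v})" for v using C by (auto simp: sparse_on_def)
  show "C \<inter> S \<noteq> {}"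
  proof (cases "x \<in> C \<and> y \<in> C")
    case False
    then have "sparse_on ((x, y) # es) C" using C by (auto simp: sparse_on_def)
    then show ?thesis using meets cover by blast
  next
    case True
    have "(\<forall>b. (x, b) \<in> E \<longrightarrow> b \<in> C) \<or> (\<forall>a. (a, y) \<in> E \<longrightarrow> a \<in> C)"
      using C by (auto simp: covers_def join_neighbours_def)
    then show ?thesis
    proof
      assume "\<forall>b. (x, b) \<in> E \<longrightarrow> b \<in> C"
      moreover have "a \<in> C \<or> b \<in> C" "b \<noteq> x" if "(a, b) \<in> E" for a b
        using that cover E xy by (auto simp: covers_def)
      ultimately have "covers E (C - {x})" unfolding covers_def by blast
      moreover have "sparse_on ((x, y) # es) (C - {x})" using sparse[of x]
        by (auto simp: sparse_on_def)
      ultimately show ?thesis using meets by blast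
    next
      assume "\<forall>a. (a, y) \<in> E \<longrightarrow> a \<in> C"
      moreover have "a \<in> C \<or> b \<in> C" "a \<noteq> y" if "(a, b) \<in> E" for a b
        using that cover E xy by (auto simp: covers_def)
      ultimately have "covers E (C - {y})" unfolding covers_def by blast
      moreover have "sparse_on ((x, y) # es) (C - {y})" using sparse[of y]
        by (auto simp: sparse_on_def)
      ultimately show ?thesis using meets by blast
    qed
  qed
next
  fix C assume meets: "\<forall>C. covers (join_neighbours E (x, y)) C \<and> sparse_on es C \<longrightarrow> C \<inter> S \<noteq> {}"
    and C: "covers E C \<and> sparse_on ((x, y) # es) C"
  have "covers (join_neighbours E (x, y)) C"
    using C by (auto simp: covers_def sparse_on_def join_neighbours_def)
  moreover have "sparse_on es C" using C by (auto simp: sparse_on_def)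
  ultimately show "C \<inter> S \<noteq> {}" using meets by blast
qed

lemma sparse_covers_iff_spans_edge:
  assumes "E \<subseteq> A \<times> B" "A \<inter> B = {}" "set es \<subseteq> E"
  shows "(\<forall>C. covers E C \<and> sparse_on es C \<longrightarrow> C \<inter> S \<noteq> {}) \<longleftrightarrow> spans_edge (join_all E es) S"
  using assms
proof (induction es arbitrary: E)
  case Nil
  have "spans_edge E S" if "\<forall>C. covers E C \<longrightarrow> C \<inter> S \<noteq> {}"
  proof (rule ccontr)
    assume "\<not> spans_edge E S"
    then have "covers E (- S)" by (auto simp: covers_def spans_edge_def)
    then show False using that by blast
  qed
  moreover have "C \<inter> S \<noteq> {}" if "spans_edge E S" "covers E C" for C
    using that by (auto simp: covers_def spans_edge_def)
  ultimately show ?case by (auto simp: sparse_on_def)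
next
  case (Cons e es)
  obtain x y where e: "e = (x, y)" by (cases e)
  have "set es \<subseteq> join_neighbours E e" using Cons.prems(3) by (auto simp: join_neighbours_def)
  from Cons.IH[OF join_neighbours_bipartite[OF Cons.prems(1)] Cons.prems(2) this] show ?case
    using sparse_covers_join_neighbours[OF Cons.prems(1,2), of x y es S] Cons.prems(3)
    by (simp add: e)
qed

lemma colon_edge_power:
  assumes edges: "edges G = (\<lambda>(a, b). {a, b}) ` E" and E: "E \<subseteq> A \<times> B" "A \<inter> B = {}"
      and es: "set es \<subseteq> E"
  shows "colon_ideal (ideal_power (edge_ideal G) (Suc (length es))) (\<Prod>(a, b)\<leftarrow>es.
      edge_monomial {a, b}) =
    (squarefree_ideal (join_all E es) :: ('v::finite, 'k::comm_ring_1) mpoly set)"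
proof -
  have loopless: "a \<noteq> b" if "(a, b) \<in> E" for a b using that E by auto
  have "(\<Prod>(a, b)\<leftarrow>es. edge_monomial {a, b}) =
      (Poly_Mapping.single (\<Sum>e\<leftarrow>es. edge_exponent e) 1 :: ('v, 'k) mpoly)"
    using es
  proof (induction es)
    case (Cons e es)
    obtain a b where e: "e = (a, b)" by (cases e)
    have "a \<noteq> b" using loopless Cons.prems by (simp add: e)
    then have "edge_monomial {a, b} = (Poly_Mapping.single (edge_exponent e) 1 :: ('v, 'k) mpoly)"
      by (simp add: edge_monomial_def Var_def mult_single edge_exponent_def e)
    then show ?case using Cons by (simp add: e mult_single)
  qed simp
  then have "colon_ideal (ideal_power (edge_ideal G) (Suc (length es))) (\<Prod>(a, b)\<leftarrow>es.
      edge_monomial {a, b}) =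
    (monomial_ideal {m. m + (\<Sum>e\<leftarrow>es. edge_exponent e) \<in> edge_multiples E (Suc (length es))}
        :: ('v, 'k) mpoly set)"
    by (simp only: edge_ideal_eq_monomial_ideal[OF edges loopless] ideal_power_monomial_ideal
      colon_monomial_ideal)
  then show ?thesis
    by (simp only: koenig_edge_multiples[OF E es] sparse_covers_iff_spans_edge[OF E es]
      squarefree_ideal_def)
qed

section \<open>The regularity bound\<close>

lemma essential_cycle_join_all:
  fixes c :: "'v::finite set \<Rightarrow> 'k::comm_ring_1"
  assumes "E \<subseteq> A \<times> B" "A \<inter> B = {}" "set es \<subseteq> E"
    and "essential_cycle (dual_complex (join_all E es) W) i c"
  shows "\<exists>W' i' (c' :: 'v set \<Rightarrow> 'k). essential_cycle (dual_complex E W') i' c' \<and>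
      card W' + i = card W + i'"
  using assms
proof (induction es arbitrary: E)
  case Nil
  then show ?case by auto
next
  case (Cons e es)
  obtain x y where e: "e = (x, y)" by (cases e)
  have sub: "set es \<subseteq> join_neighbours E e" using Cons.prems(3) by (auto simp: join_neighbours_def)
  have "essential_cycle (dual_complex (join_all (join_neighbours E e) es) W) i c"
    using Cons.prems(4) by simp
  from Cons.IH[OF join_neighbours_bipartite[OF Cons.prems(1)] Cons.prems(2) sub this]
  obtain W1 i1 and c1 :: "'v set \<Rightarrow> 'k"
    where 1: "essential_cycle (dual_complex (join_neighbours E e) W1) i1 c1"
        "card W1 + i = card W + i1" by blast
  have "(x, y) \<in> E" using Cons.prems(3) by (simp add: e)
  from essential_cycle_join_neighbours[OF Cons.prems(1,2) this 1(1)[unfolded e]]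
  obtain W2 i2 and c2 :: "'v set \<Rightarrow> 'k"
    where 2: "essential_cycle (dual_complex E W2) i2 c2" "card W2 + i1 = card W1 + i2" by blast
  have "card W2 + i = card W + i2" using 1(2) 2(2) by linarith
  then show ?case using 2(1) by blast
qed

theorem reg_colon_edge_power_le:
  assumes edges: "edges G = (\<lambda>(a, b). {a, b}) ` E" and E: "E \<subseteq> A \<times> B" "A \<inter> B = {}"
      and es: "set es \<subseteq> E"
  shows "reg (colon_ideal (ideal_power (edge_ideal G :: ('v::finite, 'k::field) mpoly set)
      (Suc (length es)))
      (\<Prod>(a, b)\<leftarrow>es. edge_monomial {a, b})) \<le> reg (edge_ideal G :: ('v, 'k) mpoly set)"
proof -
  have loopless: "a \<noteq> b" if "(a, b) \<in> E" for a b using that E by auto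
  have "m \<in> edge_multiples E 1 \<longleftrightarrow> spans_edge E (Poly_Mapping.keys m)" for m :: "'v \<Rightarrow>\<^sub>0 nat"
    using koenig_edge_multiples[OF E, of "[]" m] sparse_covers_iff_spans_edge[OF E, of "[]"
        "Poly_Mapping.keys m"]
    by simp
  then have "edge_multiples E 1 = {m. spans_edge E (Poly_Mapping.keys m)}" by blast
  then have "edge_ideal G = (squarefree_ideal E :: ('v, 'k) mpoly set)"
    by (simp only: edge_ideal_eq_monomial_ideal[OF edges loopless] squarefree_ideal_def)
  moreover have "reg (squarefree_ideal (join_all E es) :: ('v, 'k) mpoly set) \<le> reg
      (squarefree_ideal E :: ('v, 'k) mpoly set)"
    unfolding reg_squarefree_ideal
  proof (rule Sup_subset_mono, clarify)
    fix W i and c :: "'v set \<Rightarrow> 'k" assume "essential_cycle (dual_complex (join_all E es) W) i c"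
    from essential_cycle_join_all[OF E es this] obtain W' i' and c' :: "'v set \<Rightarrow> 'k"
      where "essential_cycle (dual_complex E W') i' c'" "card W' + i = card W + i'" by blast
    moreover from this(2) have "real (card W) - real i = real (card W') - real i'" by linarith
    ultimately show "\<exists>W' i'. ereal (real (card W) - real i) = ereal (real (card W') - real i') \<and>
        (\<exists>c :: 'v set \<Rightarrow> 'k. essential_cycle (dual_complex E W') i' c)"
      by (intro exI[of _ W'] exI[of _ i'] conjI exI[of _ c']) simp_all
  qed
  ultimately show ?thesis unfolding colon_edge_power[OF edges E es] by simp
qed

theorem corollary4p12:
  fixes G :: "'v::finite graph" and s :: nat and e :: "nat \<Rightarrow> 'v set"
  assumes "simple_graph G" and "vertices G = UNIV" and "bipartite G"
    and "s \<ge> 1" and "\<And>i. i \<in> {1..s} \<Longrightarrow> e i \<in> edges G"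
    and "unmixed G \<or>
         weakly_chordal G \<or>
         (\<exists>H :: 'v graph. simple_graph H \<and> bipartite H \<and> graph_isomorphic G (whiskered_graph H)) \<or>
         P6_free G"
  shows "reg (colon_ideal (ideal_power (edge_ideal G :: ('v, 'k::field) mpoly set) (s + 1))
                (\<Prod>i=1..s. edge_monomial (e i)))
         \<le> reg (edge_ideal G :: ('v, 'k) mpoly set)"
proof -
  obtain A B where AB: "A \<inter> B = {}" and orient: "\<And>f. f \<in> edges G \<Longrightarrow> \<exists>a\<in>A. \<exists>b\<in>B. f = {a, b}"
    using \<open>bipartite G\<close> unfolding bipartite_def by (elim exE conjE) simp
  define E where "E = {(a, b). a \<in> A \<and> b \<in> B \<and> {a, b} \<in> edges G}"
  have edges: "edges G = (\<lambda>(a, b). {a, b}) ` E"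
  proof
    show "edges G \<subseteq> (\<lambda>(a, b). {a, b}) ` E"
    proof
      fix f assume "f \<in> edges G"
      moreover from this obtain a b where "a \<in> A" "b \<in> B" "f = {a, b}" using orient by blast
      ultimately show "f \<in> (\<lambda>(a, b). {a, b}) ` E"
        by (intro image_eqI[of _ _ "(a, b)"]) (auto simp: E_def)
    qed
  qed (auto simp: E_def)
  have E: "E \<subseteq> A \<times> B" by (auto simp: E_def)
  have "\<exists>p. p \<in> E \<and> (i \<in> {1..s} \<longrightarrow> e i = {fst p, snd p})" if "i \<in> {1..s}" for i
    using assms(5)[OF that] unfolding edges by auto
  then obtain p where p: "\<And>i. i \<in> {1..s} \<Longrightarrow> p i \<in> E \<and> e i = {fst (p i), snd (p i)}" by metis
  define es where "es = map p [1..<Suc s]"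
  have es: "set es \<subseteq> E" using p by (auto simp: es_def simp del: upt_Suc)
  have "(\<Prod>(a, b)\<leftarrow>es. edge_monomial {a, b}) =
      (\<Prod>i\<leftarrow>[1..<Suc s]. edge_monomial {fst (p i), snd (p i)} :: ('v, 'k) mpoly)"
    by (simp add: es_def case_prod_beta o_def del: upt_Suc)
  also have "\<dots> = (\<Prod>i\<in>{1..s}. edge_monomial {fst (p i), snd (p i)})"
    by (subst prod.distinct_set_conv_list[symmetric])
      (auto simp: atLeastLessThanSuc_atLeastAtMost simp del: upt_Suc)
  also have "\<dots> = (\<Prod>i=1..s. edge_monomial (e i))"
    using p by (intro prod.cong) auto
  finally have "(\<Prod>(a, b)\<leftarrow>es. edge_monomial {a, b}) =
      (\<Prod>i=1..s. edge_monomial (e i) :: ('v, 'k) mpoly)" .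
  moreover have "length es = s" by (simp add: es_def)
  ultimately show ?thesis
    using reg_colon_edge_power_le[OF edges E AB es, where 'k = 'k] by simp
qed

end
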